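(* Let $L,H$ be causal models in a Markov category $\mathcal C$, with variables $V_L,V_H$, and $V_H^{\rm nin}\subseteq V_H^{\rm out}$. A constructive abstraction $L\to H$ with variable alignment $(\pi,\tau)$ is equivalent to a downward abstraction $(\pi,\tau)\colon(\mathrm{Do}(V_L),L)\to(\mathrm{Do}(V_H),H)$ such that $\pi(V_H^{\rm in})=V_L^{\rm in}$. That is, restricting $\pi$ and $\tau$ to variables gives a bijection from such downward abstractions to constructive abstractions $L\to H$.
   Context: **Categories.** A Markov category is a symmetric monoidal category with terminal unit $I$ in which each object has a commutative comonoid structure (copy, discard) compatible with $\otimes$. Morphisms are called channels; $f$ is deterministic if $\mathrm{copy}\circ f=(f\otimes f)\circ\mathrm{copy}$. Functors between Markov categories are strong symmetric monoidal, preserve copy, and have deterministic structure isomorphisms; natural transformations are monoidal with deterministic components; "epic" means all components are epic. **Causal models.** An open DAG is a finite DAG with vertex set $V$ and a subset $V^{\rm in}\subseteq V$ of parentless vertices (inputs); $V^{\rm nin}=V\setminus V^{\rm in}$. A causal model $M$ over it in $\mathcal C$ consists of an object of $\mathcal C$ (again written $X$) for each vertex $X$, a channel (mechanism) $c_X\colon\bigotimes_{Y\in\mathrm{Pa}(X)}Y\to X$ for each $X\in V^{\rm nin}$, and a subset $V^{\rm out}\subseteq V$ of outputs. A set of variables is also used for the list of its elements (lists of distinct variables are considered up to permutation) and for the tensor of the corresponding objects. For $O\subseteq V$, $M^{O}\colon V^{\rm in}\to O$ is the channel obtained by wiring together, with copy maps, the mechanisms of all non-input variables having a directed path (possibly of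 length 0) to $O$, copying each $X\in O$ once more to form an output, and discarding inputs with no path to $O$. For $S\subseteq V^{\rm nin}$, $M_{\mathrm{Do}(S)}$ is the causal model obtained by deleting the mechanisms of all $X\in S$ and all edges into $S$ and making each $X\in S$ an input; so $M_{\mathrm{Do}(S)}^{O}\colon V^{\rm in}\otimes S\to O$. **Queries.** A query signature $Q$ is a set of objects (types) and a set of generators (queries), each with finite lists of input and output types; it freely generates a Markov category $\mathbf Q$ (objects: lists of types; morphisms: string diagrams). A model of $Q$ in $\mathcal C$ is a functor $[\![-]\!]\colon\mathbf Q\to\mathcal C$. The signature $\mathrm{Do}(V)$ has types $V$ and a query $\mathrm{Do}(S)\colon V^{\rm in}\otimes S\to O$ for each $S\subseteq V^{\rm nin}$, $O\subseteq V^{\rm out}$; a causal model $M$ over $V$ models it by interpreting variables as in $M$ and this query as $M_{\mathrm{Do}(S)}^{O}$. **Downward abstraction** $(\pi,\tau)\colon(Q_L,L)\to(Q_H,H)$: a functor $\pi\colon\mathbf Q_H\to\mathbf Q_L$ sending each query of $Q_H$ to a query (generator) of $Q_L$, and an epic natural transformation $\tau\colon[\![-]\!]_L\circ\pi\Rightarrow[\![-]\!]_H$. **Constructive abstraction.** A variable alignment $(\pi,\tau)$ from $V_L$ to $V_H$ is a family of pairwise disjoint subsets $\pi(X)\subseteq V_L$, $X\in V_H$, with $\pi(V_H^{\rm in})=V_L^{\rm in}$ and $\pi(V_H^{\rm out})\subseteq V_L^{\rm out}$ (with $\pi(S)=\bigcup_{X\in S}\pi(X)$), together with an epic deterministic channel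 $\tau_X\colon\pi(X)\to X$ in $\mathcal C$ for each $X\in V_H$; put $\tau_S=\bigotimes_{X\in S}\tau_X$; all tensor products of the $\tau_X$ are also required to be epic. It is a constructive abstraction $L\to H$ if for all $S\subseteq V_H^{\rm nin}$, $$\tau_{V_H^{\rm out}}\circ L_{\mathrm{Do}(\pi(S))}^{\pi(V_H^{\rm out})}=H_{\mathrm{Do}(S)}^{V_H^{\rm out}}\circ(\tau_{V_H^{\rm in}}\otimes\tau_S).$$
   Formalization: The bijection is from isomorphism classes of downward abstractions (monoidal natural isomorphism of π compatible with τ), since strong monoidal functors are determined by their values on variables and queries only up to isomorphism. *)

theory Defs
  imports Main "HOL-Library.FuncSet"
begin

section \<open>Markov categories\<close>

record ('o, 'a) markov_data =
  Ob :: "'o set"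
  Ar :: "'a set"
  Dom :: "'a \<Rightarrow> 'o"
  Cod :: "'a \<Rightarrow> 'o"
  Idn :: "'o \<Rightarrow> 'a"
  Cmp :: "'a \<Rightarrow> 'a \<Rightarrow> 'a"  (infixr "\<cdot>\<index>" 55)
  Unt :: "'o"
  TOb :: "'o \<Rightarrow> 'o \<Rightarrow> 'o"  (infixr "\<odot>\<index>" 70)
  TAr :: "'a \<Rightarrow> 'a \<Rightarrow> 'a"  (infixr "\<otimes>\<index>" 70)
  assoc :: "'o \<Rightarrow> 'o \<Rightarrow> 'o \<Rightarrow> 'a"
  lunit :: "'o \<Rightarrow> 'a"
  runit :: "'o \<Rightarrow> 'a"
  symm :: "'o \<Rightarrow> 'o \<Rightarrow> 'a"
  copy :: "'o \<Rightarrow> 'a"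
  disc :: "'o \<Rightarrow> 'a"

definition hom :: "('o, 'a) markov_data \<Rightarrow> 'o \<Rightarrow> 'o \<Rightarrow> 'a set" where
  "hom C X Y = {f \<in> Ar C. Dom C f = X \<and> Cod C f = Y}"

definition inverse_arrows :: "('o, 'a) markov_data \<Rightarrow> 'a \<Rightarrow> 'a \<Rightarrow> bool" where
  "inverse_arrows C f g \<longleftrightarrow> f \<in> Ar C \<and> g \<in> hom C (Cod C f) (Dom C f) \<and>
     Cmp C g f = Idn C (Dom C f) \<and> Cmp C f g = Idn C (Cod C f)"

definition iso_arrow :: "('o, 'a) markov_data \<Rightarrow> 'a \<Rightarrow> bool" where
  "iso_arrow C f \<longleftrightarrow> (\<exists>g. inverse_arrows C f g)"

definition inv_arrow :: "('o, 'a) markov_data \<Rightarrow> 'a \<Rightarrow> 'a" where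
  "inv_arrow C f = (THE g. inverse_arrows C f g)"

definition epic :: "('o, 'a) markov_data \<Rightarrow> 'a \<Rightarrow> bool" where
  "epic C f \<longleftrightarrow> f \<in> Ar C \<and>
     (\<forall>Z. \<forall>g \<in> hom C (Cod C f) Z. \<forall>h \<in> hom C (Cod C f) Z. Cmp C g f = Cmp C h f \<longrightarrow> g = h)"

definition deterministic :: "('o, 'a) markov_data \<Rightarrow> 'a \<Rightarrow> bool" where
  "deterministic C f \<longleftrightarrow> f \<in> Ar C \<and>
     Cmp C (copy C (Cod C f)) f = Cmp C (TAr C f f) (copy C (Dom C f))"

text \<open>The canonical map \<open>(W \<odot> X) \<odot> (Y \<odot> Z) \<rightarrow> (W \<odot> Y) \<odot> (X \<odot> Z)\<close>.\<close>

definition interchange :: "('o, 'a) markov_data \<Rightarrow> 'o \<Rightarrow> 'o \<Rightarrow> 'o \<Rightarrow> 'o \<Rightarrow> 'a" where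
  "interchange C W X Y Z =
     (let X_YZ = Cmp C (assoc C Y X Z)
                   (Cmp C (TAr C (symm C X Y) (Idn C Z)) (inv_arrow C (assoc C X Y Z)))
      in Cmp C (inv_arrow C (assoc C W Y (TOb C X Z)))
           (Cmp C (TAr C (Idn C W) X_YZ) (assoc C W X (TOb C Y Z))))"

locale category =
  fixes C :: "('o, 'a) markov_data" (structure)
  assumes dom_ob: "f \<in> Ar C \<Longrightarrow> Dom C f \<in> Ob C"
    and cod_ob: "f \<in> Ar C \<Longrightarrow> Cod C f \<in> Ob C"
    and id_hom: "X \<in> Ob C \<Longrightarrow> Idn C X \<in> hom C X X"
    and cmp_hom: "\<lbrakk>f \<in> hom C X Y; g \<in> hom C Y Z\<rbrakk> \<Longrightarrow> g \<cdot> f \<in> hom C X Z"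
    and cmp_id_right: "f \<in> hom C X Y \<Longrightarrow> f \<cdot> Idn C X = f"
    and cmp_id_left: "f \<in> hom C X Y \<Longrightarrow> Idn C Y \<cdot> f = f"
    and cmp_assoc: "\<lbrakk>f \<in> hom C W X; g \<in> hom C X Y; h \<in> hom C Y Z\<rbrakk> \<Longrightarrow> (h \<cdot> g) \<cdot> f = h \<cdot> (g \<cdot> f)"

locale symmetric_monoidal_category = category +
  assumes unit_ob: "Unt C \<in> Ob C"
    and tensor_ob: "\<lbrakk>X \<in> Ob C; Y \<in> Ob C\<rbrakk> \<Longrightarrow> X \<odot> Y \<in> Ob C"
    and tensor_hom: "\<lbrakk>f \<in> hom C X Y; g \<in> hom C X' Y'\<rbrakk> \<Longrightarrow> f \<otimes> g \<in> hom C (X \<odot> X') (Y \<odot> Y')"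
    and tensor_id: "\<lbrakk>X \<in> Ob C; Y \<in> Ob C\<rbrakk> \<Longrightarrow> Idn C X \<otimes> Idn C Y = Idn C (X \<odot> Y)"
    and tensor_cmp: "\<lbrakk>f \<in> hom C X Y; g \<in> hom C Y Z; f' \<in> hom C X' Y'; g' \<in> hom C Y' Z'\<rbrakk>
          \<Longrightarrow> (g \<cdot> f) \<otimes> (g' \<cdot> f') = (g \<otimes> g') \<cdot> (f \<otimes> f')"
    and assoc_hom: "\<lbrakk>X \<in> Ob C; Y \<in> Ob C; Z \<in> Ob C\<rbrakk>
          \<Longrightarrow> assoc C X Y Z \<in> hom C ((X \<odot> Y) \<odot> Z) (X \<odot> (Y \<odot> Z))"
    and assoc_iso: "\<lbrakk>X \<in> Ob C; Y \<in> Ob C; Z \<in> Ob C\<rbrakk> \<Longrightarrow> iso_arrow C (assoc C X Y Z)"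
    and assoc_natural: "\<lbrakk>f \<in> hom C X X'; g \<in> hom C Y Y'; h \<in> hom C Z Z'\<rbrakk>
          \<Longrightarrow> assoc C X' Y' Z' \<cdot> ((f \<otimes> g) \<otimes> h) = (f \<otimes> (g \<otimes> h)) \<cdot> assoc C X Y Z"
    and lunit_hom: "X \<in> Ob C \<Longrightarrow> lunit C X \<in> hom C (Unt C \<odot> X) X"
    and lunit_iso: "X \<in> Ob C \<Longrightarrow> iso_arrow C (lunit C X)"
    and lunit_natural: "f \<in> hom C X Y \<Longrightarrow> lunit C Y \<cdot> (Idn C (Unt C) \<otimes> f) = f \<cdot> lunit C X"
    and runit_hom: "X \<in> Ob C \<Longrightarrow> runit C X \<in> hom C (X \<odot> Unt C) X"
    and runit_iso: "X \<in> Ob C \<Longrightarrow> iso_arrow C (runit C X)"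
    and runit_natural: "f \<in> hom C X Y \<Longrightarrow> runit C Y \<cdot> (f \<otimes> Idn C (Unt C)) = f \<cdot> runit C X"
    and symm_hom: "\<lbrakk>X \<in> Ob C; Y \<in> Ob C\<rbrakk> \<Longrightarrow> symm C X Y \<in> hom C (X \<odot> Y) (Y \<odot> X)"
    and symm_natural: "\<lbrakk>f \<in> hom C X X'; g \<in> hom C Y Y'\<rbrakk>
          \<Longrightarrow> symm C X' Y' \<cdot> (f \<otimes> g) = (g \<otimes> f) \<cdot> symm C X Y"
    and symm_symm: "\<lbrakk>X \<in> Ob C; Y \<in> Ob C\<rbrakk> \<Longrightarrow> symm C Y X \<cdot> symm C X Y = Idn C (X \<odot> Y)"
    and pentagon: "\<lbrakk>W \<in> Ob C; X \<in> Ob C; Y \<in> Ob C; Z \<in> Ob C\<rbrakk>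
          \<Longrightarrow> (Idn C W \<otimes> assoc C X Y Z) \<cdot> assoc C W (X \<odot> Y) Z \<cdot> (assoc C W X Y \<otimes> Idn C Z)
              = assoc C W X (Y \<odot> Z) \<cdot> assoc C (W \<odot> X) Y Z"
    and triangle: "\<lbrakk>X \<in> Ob C; Y \<in> Ob C\<rbrakk>
          \<Longrightarrow> (Idn C X \<otimes> lunit C Y) \<cdot> assoc C X (Unt C) Y = runit C X \<otimes> Idn C Y"
    and hexagon: "\<lbrakk>X \<in> Ob C; Y \<in> Ob C; Z \<in> Ob C\<rbrakk>
          \<Longrightarrow> assoc C Y Z X \<cdot> symm C X (Y \<odot> Z) \<cdot> assoc C X Y Z
              = (Idn C Y \<otimes> symm C X Z) \<cdot> assoc C Y X Z \<cdot> (symm C X Y \<otimes> Idn C Z)"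

text \<open>
  Terminality of the unit makes \<open>disc\<close> natural and compatible with \<open>\<otimes>\<close>, and determines
  \<open>copy\<close> on the unit.
\<close>

locale markov_category = symmetric_monoidal_category +
  assumes disc_hom: "X \<in> Ob C \<Longrightarrow> disc C X \<in> hom C X (Unt C)"
    and terminal: "f \<in> hom C X (Unt C) \<Longrightarrow> f = disc C X"
    and copy_hom: "X \<in> Ob C \<Longrightarrow> copy C X \<in> hom C X (X \<odot> X)"
    and copy_assoc: "X \<in> Ob C \<Longrightarrow>
          assoc C X X X \<cdot> (copy C X \<otimes> Idn C X) \<cdot> copy C X = (Idn C X \<otimes> copy C X) \<cdot> copy C X"
    and copy_counit_left: "X \<in> Ob C \<Longrightarrow> lunit C X \<cdot> (disc C X \<otimes> Idn C X) \<cdot> copy C X = Idn C X"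
    and copy_counit_right: "X \<in> Ob C \<Longrightarrow> runit C X \<cdot> (Idn C X \<otimes> disc C X) \<cdot> copy C X = Idn C X"
    and copy_comm: "X \<in> Ob C \<Longrightarrow> symm C X X \<cdot> copy C X = copy C X"
    and copy_tensor: "\<lbrakk>X \<in> Ob C; Y \<in> Ob C\<rbrakk>
          \<Longrightarrow> copy C (X \<odot> Y) = interchange C X X Y Y \<cdot> (copy C X \<otimes> copy C Y)"


section \<open>Functors and natural transformations\<close>

record ('o, 'a, 'p, 'b) mfunctor =
  FOb :: "'o \<Rightarrow> 'p"
  FAr :: "'a \<Rightarrow> 'b"
  FMul :: "'o \<Rightarrow> 'o \<Rightarrow> 'b"
  FUnt :: "'b"

locale markov_functor =
  fixes C :: "('o, 'a) markov_data" and D :: "('p, 'b) markov_data"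
    and F :: "('o, 'a, 'p, 'b) mfunctor"
  assumes ob: "X \<in> Ob C \<Longrightarrow> FOb F X \<in> Ob D"
    and ar: "f \<in> hom C X Y \<Longrightarrow> FAr F f \<in> hom D (FOb F X) (FOb F Y)"
    and ar_id: "X \<in> Ob C \<Longrightarrow> FAr F (Idn C X) = Idn D (FOb F X)"
    and ar_cmp: "\<lbrakk>f \<in> hom C X Y; g \<in> hom C Y Z\<rbrakk>
          \<Longrightarrow> FAr F (g \<cdot>\<^bsub>C\<^esub> f) = FAr F g \<cdot>\<^bsub>D\<^esub> FAr F f"
    and mul_hom: "\<lbrakk>X \<in> Ob C; Y \<in> Ob C\<rbrakk>
          \<Longrightarrow> FMul F X Y \<in> hom D (FOb F X \<odot>\<^bsub>D\<^esub> FOb F Y) (FOb F (X \<odot>\<^bsub>C\<^esub> Y))"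
    and mul_iso: "\<lbrakk>X \<in> Ob C; Y \<in> Ob C\<rbrakk> \<Longrightarrow> iso_arrow D (FMul F X Y)"
    and mul_det: "\<lbrakk>X \<in> Ob C; Y \<in> Ob C\<rbrakk> \<Longrightarrow> deterministic D (FMul F X Y)"
    and mul_natural: "\<lbrakk>f \<in> hom C X X'; g \<in> hom C Y Y'\<rbrakk>
          \<Longrightarrow> FAr F (f \<otimes>\<^bsub>C\<^esub> g) \<cdot>\<^bsub>D\<^esub> FMul F X Y = FMul F X' Y' \<cdot>\<^bsub>D\<^esub> (FAr F f \<otimes>\<^bsub>D\<^esub> FAr F g)"
    and unt_hom: "FUnt F \<in> hom D (Unt D) (FOb F (Unt C))"
    and unt_iso: "iso_arrow D (FUnt F)"
    and unt_det: "deterministic D (FUnt F)"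
    and mul_assoc: "\<lbrakk>X \<in> Ob C; Y \<in> Ob C; Z \<in> Ob C\<rbrakk>
          \<Longrightarrow> FAr F (assoc C X Y Z) \<cdot>\<^bsub>D\<^esub> FMul F (X \<odot>\<^bsub>C\<^esub> Y) Z \<cdot>\<^bsub>D\<^esub> (FMul F X Y \<otimes>\<^bsub>D\<^esub> Idn D (FOb F Z))
              = FMul F X (Y \<odot>\<^bsub>C\<^esub> Z) \<cdot>\<^bsub>D\<^esub> (Idn D (FOb F X) \<otimes>\<^bsub>D\<^esub> FMul F Y Z)
                  \<cdot>\<^bsub>D\<^esub> assoc D (FOb F X) (FOb F Y) (FOb F Z)"
    and mul_lunit: "X \<in> Ob C
          \<Longrightarrow> FAr F (lunit C X) \<cdot>\<^bsub>D\<^esub> FMul F (Unt C) X \<cdot>\<^bsub>D\<^esub> (FUnt F \<otimes>\<^bsub>D\<^esub> Idn D (FOb F X))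
              = lunit D (FOb F X)"
    and mul_runit: "X \<in> Ob C
          \<Longrightarrow> FAr F (runit C X) \<cdot>\<^bsub>D\<^esub> FMul F X (Unt C) \<cdot>\<^bsub>D\<^esub> (Idn D (FOb F X) \<otimes>\<^bsub>D\<^esub> FUnt F)
              = runit D (FOb F X)"
    and mul_symm: "\<lbrakk>X \<in> Ob C; Y \<in> Ob C\<rbrakk>
          \<Longrightarrow> FAr F (symm C X Y) \<cdot>\<^bsub>D\<^esub> FMul F X Y = FMul F Y X \<cdot>\<^bsub>D\<^esub> symm D (FOb F X) (FOb F Y)"
    and ar_copy: "X \<in> Ob C \<Longrightarrow> FAr F (copy C X) = FMul F X X \<cdot>\<^bsub>D\<^esub> copy D (FOb F X)"

definition comp_functor ::
  "('p, 'b) markov_data \<Rightarrow> ('o, 'a) markov_data \<Rightarrow>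
   ('p, 'b, 'o, 'a) mfunctor \<Rightarrow> ('r, 'c, 'p, 'b) mfunctor \<Rightarrow> ('r, 'c, 'o, 'a) mfunctor" where
  "comp_functor D E G F =
     \<lparr>FOb = FOb G \<circ> FOb F,
      FAr = FAr G \<circ> FAr F,
      FMul = (\<lambda>X Y. FAr G (FMul F X Y) \<cdot>\<^bsub>E\<^esub> FMul G (FOb F X) (FOb F Y)),
      FUnt = FAr G (FUnt F) \<cdot>\<^bsub>E\<^esub> FUnt G\<rparr>"

locale markov_transformation =
  fixes C :: "('o, 'a) markov_data" and D :: "('p, 'b) markov_data"
    and F G :: "('o, 'a, 'p, 'b) mfunctor" and \<tau> :: "'o \<Rightarrow> 'b"
  assumes component_hom: "X \<in> Ob C \<Longrightarrow> \<tau> X \<in> hom D (FOb F X) (FOb G X)"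
    and component_det: "X \<in> Ob C \<Longrightarrow> deterministic D (\<tau> X)"
    and natural: "f \<in> hom C X Y \<Longrightarrow> \<tau> Y \<cdot>\<^bsub>D\<^esub> FAr F f = FAr G f \<cdot>\<^bsub>D\<^esub> \<tau> X"
    and monoidal_mul: "\<lbrakk>X \<in> Ob C; Y \<in> Ob C\<rbrakk>
          \<Longrightarrow> \<tau> (X \<odot>\<^bsub>C\<^esub> Y) \<cdot>\<^bsub>D\<^esub> FMul F X Y = FMul G X Y \<cdot>\<^bsub>D\<^esub> (\<tau> X \<otimes>\<^bsub>D\<^esub> \<tau> Y)"
    and monoidal_unt: "\<tau> (Unt C) \<cdot>\<^bsub>D\<^esub> FUnt F = FUnt G"


section \<open>Finite tensor products\<close>

text \<open>
  \<open>[X\<^sub>1, \<dots>, X\<^sub>n]\<close> is sent to \<open>X\<^sub>1 \<odot> (X\<^sub>2 \<odot> (\<dots> \<odot> X\<^sub>n))\<close>, and a singleton \<open>[X]\<close> to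
  \<open>X\<close> itself.
\<close>

fun tens :: "('o, 'a) markov_data \<Rightarrow> 'o list \<Rightarrow> 'o" where
  "tens C [] = Unt C"
| "tens C [X] = X"
| "tens C (X # Y # Xs) = TOb C X (tens C (Y # Xs))"

text \<open>The canonical isomorphism \<open>X \<odot> tens Xs \<rightarrow> tens (X # Xs)\<close>.\<close>

definition tens_cons :: "('o, 'a) markov_data \<Rightarrow> 'o \<Rightarrow> 'o list \<Rightarrow> 'a" where
  "tens_cons C X Xs = (if Xs = [] then runit C X else Idn C (tens C (X # Xs)))"

text \<open>The canonical isomorphism \<open>tens Xs \<odot> tens Ys \<rightarrow> tens (Xs @ Ys)\<close>.\<close>

primrec tens_append :: "('o, 'a) markov_data \<Rightarrow> 'o list \<Rightarrow> 'o list \<Rightarrow> 'a" where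
  "tens_append C [] Ys = lunit C (tens C Ys)"
| "tens_append C (X # Xs) Ys =
     tens_cons C X (Xs @ Ys)
       \<cdot>\<^bsub>C\<^esub> (Idn C X \<otimes>\<^bsub>C\<^esub> tens_append C Xs Ys)
       \<cdot>\<^bsub>C\<^esub> assoc C X (tens C Xs) (tens C Ys)
       \<cdot>\<^bsub>C\<^esub> (inv_arrow C (tens_cons C X Xs) \<otimes>\<^bsub>C\<^esub> Idn C (tens C Ys))"


section \<open>Query signatures and the free Markov category\<close>

record ('t, 'q) signature =
  types :: "'t set"
  queries :: "'q set"
  inp :: "'q \<Rightarrow> 't list"
  outp :: "'q \<Rightarrow> 't list"

datatype ('t, 'q) diagram =
    DId "'t list"
  | DGen 'q
  | DCmp "('t, 'q) diagram" "('t, 'q) diagram"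
  | DPar "('t, 'q) diagram" "('t, 'q) diagram"
  | DSwap "'t list" "'t list"
  | DCopy "'t list"
  | DDisc "'t list"

primrec dsrc :: "('t, 'q) signature \<Rightarrow> ('t, 'q) diagram \<Rightarrow> 't list" where
  "dsrc Q (DId \<Gamma>) = \<Gamma>"
| "dsrc Q (DGen q) = inp Q q"
| "dsrc Q (DCmp g f) = dsrc Q f"
| "dsrc Q (DPar f g) = dsrc Q f @ dsrc Q g"
| "dsrc Q (DSwap \<Gamma> \<Delta>) = \<Gamma> @ \<Delta>"
| "dsrc Q (DCopy \<Gamma>) = \<Gamma>"
| "dsrc Q (DDisc \<Gamma>) = \<Gamma>"

primrec dtgt :: "('t, 'q) signature \<Rightarrow> ('t, 'q) diagram \<Rightarrow> 't list" where
  "dtgt Q (DId \<Gamma>) = \<Gamma>"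
| "dtgt Q (DGen q) = outp Q q"
| "dtgt Q (DCmp g f) = dtgt Q g"
| "dtgt Q (DPar f g) = dtgt Q f @ dtgt Q g"
| "dtgt Q (DSwap \<Gamma> \<Delta>) = \<Delta> @ \<Gamma>"
| "dtgt Q (DCopy \<Gamma>) = \<Gamma> @ \<Gamma>"
| "dtgt Q (DDisc \<Gamma>) = []"

primrec well_typed :: "('t, 'q) signature \<Rightarrow> ('t, 'q) diagram \<Rightarrow> bool" where
  "well_typed Q (DId \<Gamma>) \<longleftrightarrow> \<Gamma> \<in> lists (types Q)"
| "well_typed Q (DGen q) \<longleftrightarrow>
     q \<in> queries Q \<and> inp Q q \<in> lists (types Q) \<and> outp Q q \<in> lists (types Q)"
| "well_typed Q (DCmp g f) \<longleftrightarrow> well_typed Q g \<and> well_typed Q f \<and> dtgt Q f = dsrc Q g"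
| "well_typed Q (DPar f g) \<longleftrightarrow> well_typed Q f \<and> well_typed Q g"
| "well_typed Q (DSwap \<Gamma> \<Delta>) \<longleftrightarrow> \<Gamma> \<in> lists (types Q) \<and> \<Delta> \<in> lists (types Q)"
| "well_typed Q (DCopy \<Gamma>) \<longleftrightarrow> \<Gamma> \<in> lists (types Q)"
| "well_typed Q (DDisc \<Gamma>) \<longleftrightarrow> \<Gamma> \<in> lists (types Q)"

text \<open>
  The least congruence on well-typed diagrams that makes them a strict Markov category.
\<close>

inductive deq :: "('t, 'q) signature \<Rightarrow> ('t, 'q) diagram \<Rightarrow> ('t, 'q) diagram \<Rightarrow> bool"
  for Q :: "('t, 'q) signature" where
  refl: "well_typed Q f \<Longrightarrow> deq Q f f"
| sym: "deq Q f g \<Longrightarrow> deq Q g f"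
| trans: "\<lbrakk>deq Q f g; deq Q g h\<rbrakk> \<Longrightarrow> deq Q f h"
| cong_cmp: "\<lbrakk>deq Q f f'; deq Q g g'; dtgt Q f = dsrc Q g\<rbrakk> \<Longrightarrow> deq Q (DCmp g f) (DCmp g' f')"
| cong_par: "\<lbrakk>deq Q f f'; deq Q g g'\<rbrakk> \<Longrightarrow> deq Q (DPar f g) (DPar f' g')"
| id_right: "well_typed Q f \<Longrightarrow> deq Q (DCmp f (DId (dsrc Q f))) f"
| id_left: "well_typed Q f \<Longrightarrow> deq Q (DCmp (DId (dtgt Q f)) f) f"
| cmp_assoc: "well_typed Q (DCmp h (DCmp g f)) \<Longrightarrow> deq Q (DCmp (DCmp h g) f) (DCmp h (DCmp g f))"
| par_id: "\<lbrakk>\<Gamma> \<in> lists (types Q); \<Delta> \<in> lists (types Q)\<rbrakk>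
    \<Longrightarrow> deq Q (DPar (DId \<Gamma>) (DId \<Delta>)) (DId (\<Gamma> @ \<Delta>))"
| par_cmp: "\<lbrakk>well_typed Q (DCmp g f); well_typed Q (DCmp g' f')\<rbrakk>
    \<Longrightarrow> deq Q (DPar (DCmp g f) (DCmp g' f')) (DCmp (DPar g g') (DPar f f'))"
| par_assoc: "\<lbrakk>well_typed Q f; well_typed Q g; well_typed Q h\<rbrakk>
    \<Longrightarrow> deq Q (DPar (DPar f g) h) (DPar f (DPar g h))"
| par_unit_left: "well_typed Q f \<Longrightarrow> deq Q (DPar (DId []) f) f"
| par_unit_right: "well_typed Q f \<Longrightarrow> deq Q (DPar f (DId [])) f"
| swap_natural: "\<lbrakk>well_typed Q f; well_typed Q g\<rbrakk>
    \<Longrightarrow> deq Q (DCmp (DSwap (dtgt Q f) (dtgt Q g)) (DPar f g))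
              (DCmp (DPar g f) (DSwap (dsrc Q f) (dsrc Q g)))"
| swap_swap: "\<lbrakk>\<Gamma> \<in> lists (types Q); \<Delta> \<in> lists (types Q)\<rbrakk>
    \<Longrightarrow> deq Q (DCmp (DSwap \<Delta> \<Gamma>) (DSwap \<Gamma> \<Delta>)) (DId (\<Gamma> @ \<Delta>))"
| swap_append: "\<lbrakk>\<Gamma> \<in> lists (types Q); \<Delta> \<in> lists (types Q); \<Theta> \<in> lists (types Q)\<rbrakk>
    \<Longrightarrow> deq Q (DSwap \<Gamma> (\<Delta> @ \<Theta>))
              (DCmp (DPar (DId \<Delta>) (DSwap \<Gamma> \<Theta>)) (DPar (DSwap \<Gamma> \<Delta>) (DId \<Theta>)))"
| copy_assoc: "\<Gamma> \<in> lists (types Q)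
    \<Longrightarrow> deq Q (DCmp (DPar (DCopy \<Gamma>) (DId \<Gamma>)) (DCopy \<Gamma>)) (DCmp (DPar (DId \<Gamma>) (DCopy \<Gamma>)) (DCopy \<Gamma>))"
| copy_counit_left: "\<Gamma> \<in> lists (types Q)
    \<Longrightarrow> deq Q (DCmp (DPar (DDisc \<Gamma>) (DId \<Gamma>)) (DCopy \<Gamma>)) (DId \<Gamma>)"
| copy_counit_right: "\<Gamma> \<in> lists (types Q)
    \<Longrightarrow> deq Q (DCmp (DPar (DId \<Gamma>) (DDisc \<Gamma>)) (DCopy \<Gamma>)) (DId \<Gamma>)"
| copy_comm: "\<Gamma> \<in> lists (types Q) \<Longrightarrow> deq Q (DCmp (DSwap \<Gamma> \<Gamma>) (DCopy \<Gamma>)) (DCopy \<Gamma>)"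
| copy_append: "\<lbrakk>\<Gamma> \<in> lists (types Q); \<Delta> \<in> lists (types Q)\<rbrakk>
    \<Longrightarrow> deq Q (DCopy (\<Gamma> @ \<Delta>))
              (DCmp (DPar (DId \<Gamma>) (DPar (DSwap \<Gamma> \<Delta>) (DId \<Delta>))) (DPar (DCopy \<Gamma>) (DCopy \<Delta>)))"
| disc_terminal: "\<lbrakk>well_typed Q f; dtgt Q f = []\<rbrakk> \<Longrightarrow> deq Q f (DDisc (dsrc Q f))"

definition dclass :: "('t, 'q) signature \<Rightarrow> ('t, 'q) diagram \<Rightarrow> ('t, 'q) diagram set" where
  "dclass Q f = {g. deq Q f g}"

definition drep :: "('t, 'q) diagram set \<Rightarrow> ('t, 'q) diagram" where
  "drep K = (SOME f. f \<in> K)"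

definition free_markov :: "('t, 'q) signature \<Rightarrow> ('t list, ('t, 'q) diagram set) markov_data" where
  "free_markov Q =
     \<lparr>Ob = lists (types Q),
      Ar = dclass Q ` {f. well_typed Q f},
      Dom = (\<lambda>K. dsrc Q (drep K)),
      Cod = (\<lambda>K. dtgt Q (drep K)),
      Idn = (\<lambda>\<Gamma>. dclass Q (DId \<Gamma>)),
      Cmp = (\<lambda>K K'. dclass Q (DCmp (drep K) (drep K'))),
      Unt = [],
      TOb = (@),
      TAr = (\<lambda>K K'. dclass Q (DPar (drep K) (drep K'))),
      assoc = (\<lambda>\<Gamma> \<Delta> \<Theta>. dclass Q (DId (\<Gamma> @ \<Delta> @ \<Theta>))),
      lunit = (\<lambda>\<Gamma>. dclass Q (DId \<Gamma>)),
      runit = (\<lambda>\<Gamma>. dclass Q (DId \<Gamma>)),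
      symm = (\<lambda>\<Gamma> \<Delta>. dclass Q (DSwap \<Gamma> \<Delta>)),
      copy = (\<lambda>\<Gamma>. dclass Q (DCopy \<Gamma>)),
      disc = (\<lambda>\<Gamma>. dclass Q (DDisc \<Gamma>))\<rparr>"

text \<open>
  The functor out of the free Markov category determined by objects \<open>ob\<close> for the types and
  channels \<open>ch\<close> for the queries.
\<close>

primrec interpret_diagram ::
  "('o, 'a) markov_data \<Rightarrow> ('t, 'q) signature \<Rightarrow> ('t \<Rightarrow> 'o) \<Rightarrow> ('q \<Rightarrow> 'a) \<Rightarrow> ('t, 'q) diagram \<Rightarrow> 'a" where
  "interpret_diagram C Q ob ch (DId \<Gamma>) = Idn C (tens C (map ob \<Gamma>))"
| "interpret_diagram C Q ob ch (DGen q) = ch q"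
| "interpret_diagram C Q ob ch (DCmp g f) =
     interpret_diagram C Q ob ch g \<cdot>\<^bsub>C\<^esub> interpret_diagram C Q ob ch f"
| "interpret_diagram C Q ob ch (DPar f g) =
     tens_append C (map ob (dtgt Q f)) (map ob (dtgt Q g))
       \<cdot>\<^bsub>C\<^esub> (interpret_diagram C Q ob ch f \<otimes>\<^bsub>C\<^esub> interpret_diagram C Q ob ch g)
       \<cdot>\<^bsub>C\<^esub> inv_arrow C (tens_append C (map ob (dsrc Q f)) (map ob (dsrc Q g)))"
| "interpret_diagram C Q ob ch (DSwap \<Gamma> \<Delta>) =
     tens_append C (map ob \<Delta>) (map ob \<Gamma>)
       \<cdot>\<^bsub>C\<^esub> symm C (tens C (map ob \<Gamma>)) (tens C (map ob \<Delta>))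
       \<cdot>\<^bsub>C\<^esub> inv_arrow C (tens_append C (map ob \<Gamma>) (map ob \<Delta>))"
| "interpret_diagram C Q ob ch (DCopy \<Gamma>) =
     tens_append C (map ob \<Gamma>) (map ob \<Gamma>) \<cdot>\<^bsub>C\<^esub> copy C (tens C (map ob \<Gamma>))"
| "interpret_diagram C Q ob ch (DDisc \<Gamma>) = disc C (tens C (map ob \<Gamma>))"

definition interpretation_functor ::
  "('o, 'a) markov_data \<Rightarrow> ('t, 'q) signature \<Rightarrow> ('t \<Rightarrow> 'o) \<Rightarrow> ('q \<Rightarrow> 'a)
    \<Rightarrow> ('t list, ('t, 'q) diagram set, 'o, 'a) mfunctor" where
  "interpretation_functor C Q ob ch =
     \<lparr>FOb = (\<lambda>\<Gamma>. tens C (map ob \<Gamma>)),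
      FAr = (\<lambda>K. interpret_diagram C Q ob ch (drep K)),
      FMul = (\<lambda>\<Gamma> \<Delta>. tens_append C (map ob \<Gamma>) (map ob \<Delta>)),
      FUnt = Idn C (Unt C)\<rparr>"


section \<open>Downward abstractions\<close>

primrec wire_permutation :: "('t, 'q) diagram \<Rightarrow> bool" where
  "wire_permutation (DId \<Gamma>) \<longleftrightarrow> True"
| "wire_permutation (DGen q) \<longleftrightarrow> False"
| "wire_permutation (DCmp g f) \<longleftrightarrow> wire_permutation g \<and> wire_permutation f"
| "wire_permutation (DPar f g) \<longleftrightarrow> wire_permutation f \<and> wire_permutation g"
| "wire_permutation (DSwap \<Gamma> \<Delta>) \<longleftrightarrow> True"
| "wire_permutation (DCopy \<Gamma>) \<longleftrightarrow> False"
| "wire_permutation (DDisc \<Gamma>) \<longleftrightarrow> False"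

text \<open>
  The input and output lists of a query matter only up to permutation, so an arrow counts as a
  query when it is a generator with its input and output wires reordered.  If these lists are
  distinct, as for the signatures \<open>do_signature\<close> below, the reorderings are unique.
\<close>

definition is_query :: "('t, 'q) signature \<Rightarrow> ('t, 'q) diagram set \<Rightarrow> bool" where
  "is_query Q K \<longleftrightarrow>
     (\<exists>q p p'. wire_permutation p \<and> wire_permutation p' \<and>
        well_typed Q (DCmp p' (DCmp (DGen q) p)) \<and> K = dclass Q (DCmp p' (DCmp (DGen q) p)))"

definition downward_abstraction ::
  "('o, 'a) markov_data
    \<Rightarrow> ('s, 'p) signature \<Rightarrow> ('s list, ('s, 'p) diagram set, 'o, 'a) mfunctor
    \<Rightarrow> ('t, 'q) signature \<Rightarrow> ('t list, ('t, 'q) diagram set, 'o, 'a) mfunctor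
    \<Rightarrow> ('t list, ('t, 'q) diagram set, 's list, ('s, 'p) diagram set) mfunctor
    \<Rightarrow> ('t list \<Rightarrow> 'a) \<Rightarrow> bool" where
  "downward_abstraction C QL FL QH FH \<pi> \<tau> \<longleftrightarrow>
     markov_functor (free_markov QL) C FL \<and> markov_functor (free_markov QH) C FH \<and>
     markov_functor (free_markov QH) (free_markov QL) \<pi> \<and>
     (\<forall>q \<in> queries QH. is_query QL (FAr \<pi> (dclass QH (DGen q)))) \<and>
     markov_transformation (free_markov QH) C (comp_functor (free_markov QL) C FL \<pi>) FH \<tau> \<and>
     (\<forall>\<Gamma> \<in> Ob (free_markov QH). epic C (\<tau> \<Gamma>))"

text \<open>
  Two downward abstractions are isomorphic if their functors are related by a monoidal natural
  isomorphism under which the two transformations correspond.  In particular the order of the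
  elements of the lists \<open>\<pi> \<Gamma>\<close> and the structure isomorphisms of \<open>\<pi>\<close> are irrelevant up to
  isomorphism.
\<close>

definition isomorphic_abstractions ::
  "('o, 'a) markov_data
    \<Rightarrow> ('s, 'p) signature \<Rightarrow> ('s list, ('s, 'p) diagram set, 'o, 'a) mfunctor
    \<Rightarrow> ('t, 'q) signature
    \<Rightarrow> ('t list, ('t, 'q) diagram set, 's list, ('s, 'p) diagram set) mfunctor \<times> ('t list \<Rightarrow> 'a)
    \<Rightarrow> ('t list, ('t, 'q) diagram set, 's list, ('s, 'p) diagram set) mfunctor \<times> ('t list \<Rightarrow> 'a)
    \<Rightarrow> bool" where
  "isomorphic_abstractions C QL FL QH = (\<lambda>(\<pi>, \<tau>) (\<pi>', \<tau>').
     \<exists>\<alpha>. markov_transformation (free_markov QH) (free_markov QL) \<pi> \<pi>' \<alpha> \<and>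
         (\<forall>\<Gamma> \<in> Ob (free_markov QH).
            iso_arrow (free_markov QL) (\<alpha> \<Gamma>) \<and> \<tau>' \<Gamma> \<cdot>\<^bsub>C\<^esub> FAr FL (\<alpha> \<Gamma>) = \<tau> \<Gamma>))"


section \<open>Causal models\<close>

text \<open>
  The vertex set comes with a listing, which induces one of each of its subsets.
\<close>

record ('v, 'o, 'a) causal_model =
  vlist :: "'v list"
  edges :: "('v \<times> 'v) set"
  ins :: "'v set"
  outs :: "'v set"
  vob :: "'v \<Rightarrow> 'o"
  mech :: "'v \<Rightarrow> 'a"

definition verts :: "('v, 'o, 'a) causal_model \<Rightarrow> 'v set" where
  "verts M = set (vlist M)"

definition nin :: "('v, 'o, 'a) causal_model \<Rightarrow> 'v set" where
  "nin M = verts M - ins M"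

definition parents :: "('v, 'o, 'a) causal_model \<Rightarrow> 'v \<Rightarrow> 'v set" where
  "parents M X = {Y. (Y, X) \<in> edges M}"

definition listing :: "('v, 'o, 'a) causal_model \<Rightarrow> 'v set \<Rightarrow> 'v list" where
  "listing M A = filter (\<lambda>X. X \<in> A) (vlist M)"

locale is_causal_model =
  fixes C :: "('o, 'a) markov_data" and M :: "('v, 'o, 'a) causal_model"
  assumes distinct_vlist: "distinct (vlist M)"
    and edges_verts: "edges M \<subseteq> verts M \<times> verts M"
    and acyclic_edges: "acyclic (edges M)"
    and ins_verts: "ins M \<subseteq> verts M"
    and ins_parentless: "X \<in> ins M \<Longrightarrow> parents M X = {}"
    and outs_verts: "outs M \<subseteq> verts M"
    and vob_ob: "X \<in> verts M \<Longrightarrow> vob M X \<in> Ob C"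
    and mech_hom: "X \<in> nin M
          \<Longrightarrow> mech M X \<in> hom C (tens C (map (vob M) (listing M (parents M X)))) (vob M X)"

definition intervene :: "('v, 'o, 'a) causal_model \<Rightarrow> 'v set \<Rightarrow> ('v, 'o, 'a) causal_model" where
  "intervene M S = M\<lparr>edges := {(Y, X) \<in> edges M. X \<notin> S}, ins := ins M \<union> S\<rparr>"

text \<open>
  \<open>wire_proj C ob ws z\<close> keeps the wire \<open>z\<close> of \<open>ws\<close> and discards all others;
  \<open>wire_select C ob ws zs\<close> copies the wires \<open>ws\<close> as often as needed and outputs \<open>zs\<close>.
  If \<open>zs\<close> is a reordering of the distinct list \<open>ws\<close>, it is the corresponding permutation of
  tensor factors.
\<close>

primrec wire_proj :: "('o, 'a) markov_data \<Rightarrow> ('v \<Rightarrow> 'o) \<Rightarrow> 'v list \<Rightarrow> 'v \<Rightarrow> 'a" where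
  "wire_proj C ob [] z = undefined"
| "wire_proj C ob (w # ws) z =
     (if w = z then runit C (ob w) \<cdot>\<^bsub>C\<^esub> (Idn C (ob w) \<otimes>\<^bsub>C\<^esub> disc C (tens C (map ob ws)))
      else lunit C (ob z) \<cdot>\<^bsub>C\<^esub> (disc C (ob w) \<otimes>\<^bsub>C\<^esub> wire_proj C ob ws z))
     \<cdot>\<^bsub>C\<^esub> inv_arrow C (tens_cons C (ob w) (map ob ws))"

primrec wire_select :: "('o, 'a) markov_data \<Rightarrow> ('v \<Rightarrow> 'o) \<Rightarrow> 'v list \<Rightarrow> 'v list \<Rightarrow> 'a" where
  "wire_select C ob ws [] = disc C (tens C (map ob ws))"
| "wire_select C ob ws (z # zs) =
     tens_cons C (ob z) (map ob zs)
       \<cdot>\<^bsub>C\<^esub> (wire_proj C ob ws z \<otimes>\<^bsub>C\<^esub> wire_select C ob ws zs)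
       \<cdot>\<^bsub>C\<^esub> copy C (tens C (map ob ws))"

text \<open>
  \<open>run_mechs C M ws ts os\<close> starts from the wires \<open>ws\<close>, adds a new wire for each
  variable of \<open>ts\<close> in turn by applying its mechanism to copies of its parents, and finally
  outputs \<open>os\<close>, discarding whatever else is left.
\<close>

definition add_mech :: "('o, 'a) markov_data \<Rightarrow> ('v, 'o, 'a) causal_model \<Rightarrow> 'v list \<Rightarrow> 'v \<Rightarrow> 'a" where
  "add_mech C M ws X =
     tens_cons C (vob M X) (map (vob M) ws)
       \<cdot>\<^bsub>C\<^esub> ((mech M X \<cdot>\<^bsub>C\<^esub> wire_select C (vob M) ws (listing M (parents M X)))
             \<otimes>\<^bsub>C\<^esub> Idn C (tens C (map (vob M) ws)))
       \<cdot>\<^bsub>C\<^esub> copy C (tens C (map (vob M) ws))"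

primrec run_mechs ::
  "('o, 'a) markov_data \<Rightarrow> ('v, 'o, 'a) causal_model \<Rightarrow> 'v list \<Rightarrow> 'v list \<Rightarrow> 'v list \<Rightarrow> 'a" where
  "run_mechs C M ws [] os = wire_select C (vob M) ws os"
| "run_mechs C M ws (X # ts) os = run_mechs C M (X # ws) ts os \<cdot>\<^bsub>C\<^esub> add_mech C M ws X"

text \<open>The choice of topological order does not affect the channel defined below.\<close>

definition topological_order :: "('v, 'o, 'a) causal_model \<Rightarrow> 'v list" where
  "topological_order M =
     (SOME ts. distinct ts \<and> set ts = verts M \<and> sorted_wrt (\<lambda>X Y. (Y, X) \<notin> edges M) ts)"

text \<open>
  The channel of \<open>M\<close> from its inputs, listed as \<open>is\<close>, to the variables \<open>os\<close>.
\<close>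

definition channel :: "('o, 'a) markov_data \<Rightarrow> ('v, 'o, 'a) causal_model \<Rightarrow> 'v list \<Rightarrow> 'v list \<Rightarrow> 'a" where
  "channel C M is os =
     run_mechs C M is
       (filter (\<lambda>X. X \<in> nin M \<and> (\<exists>Y \<in> set os. (X, Y) \<in> (edges M)\<^sup>*)) (topological_order M)) os"

text \<open>The query \<open>(S, O)\<close> is \<open>Do(S)\<close> with outputs \<open>O\<close>.\<close>

definition do_signature :: "('v, 'o, 'a) causal_model \<Rightarrow> ('v, 'v set \<times> 'v set) signature" where
  "do_signature M =
     \<lparr>types = verts M,
      queries = {(S, O'). S \<subseteq> nin M \<and> O' \<subseteq> outs M},
      inp = (\<lambda>(S, O'). listing M (ins M) @ listing M S),
      outp = (\<lambda>(S, O'). listing M O')\<rparr>"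

definition do_model ::
  "('o, 'a) markov_data \<Rightarrow> ('v, 'o, 'a) causal_model
    \<Rightarrow> ('v list, ('v, 'v set \<times> 'v set) diagram set, 'o, 'a) mfunctor" where
  "do_model C M =
     interpretation_functor C (do_signature M) (vob M)
       (\<lambda>(S, O'). channel C (intervene M S) (listing M (ins M) @ listing M S) (listing M O'))"


section \<open>Constructive abstractions\<close>

text \<open>
  For a list \<open>Xs\<close> of high-level variables, the tensor product of the channels \<open>\<tau> X\<close>.  Its
  domain is the tensor product of the concatenation of the lists \<open>\<pi> X\<close>.
\<close>

primrec tensor_alignment ::
  "('o, 'a) markov_data \<Rightarrow> ('l, 'o, 'a) causal_model \<Rightarrow> ('h, 'o, 'a) causal_model
    \<Rightarrow> ('h \<Rightarrow> 'l set) \<Rightarrow> ('h \<Rightarrow> 'a) \<Rightarrow> 'h list \<Rightarrow> 'a" where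
  "tensor_alignment C L H \<pi> \<tau> [] = Idn C (Unt C)"
| "tensor_alignment C L H \<pi> \<tau> (X # Xs) =
     tens_cons C (vob H X) (map (vob H) Xs)
       \<cdot>\<^bsub>C\<^esub> (\<tau> X \<otimes>\<^bsub>C\<^esub> tensor_alignment C L H \<pi> \<tau> Xs)
       \<cdot>\<^bsub>C\<^esub> inv_arrow C (tens_append C (map (vob L) (listing L (\<pi> X)))
              (map (vob L) (concat (map (\<lambda>Y. listing L (\<pi> Y)) Xs))))"

locale variable_alignment =
  fixes C :: "('o, 'a) markov_data"
    and L :: "('l, 'o, 'a) causal_model" and H :: "('h, 'o, 'a) causal_model"
    and \<pi> :: "'h \<Rightarrow> 'l set" and \<tau> :: "'h \<Rightarrow> 'a"
  assumes align_verts: "X \<in> verts H \<Longrightarrow> \<pi> X \<subseteq> verts L"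
    and align_disjoint: "\<lbrakk>X \<in> verts H; Y \<in> verts H; X \<noteq> Y\<rbrakk> \<Longrightarrow> \<pi> X \<inter> \<pi> Y = {}"
    and align_ins: "\<Union> (\<pi> ` ins H) = ins L"
    and align_outs: "\<Union> (\<pi> ` outs H) \<subseteq> outs L"
    and align_hom: "X \<in> verts H
          \<Longrightarrow> \<tau> X \<in> hom C (tens C (map (vob L) (listing L (\<pi> X)))) (vob H X)"
    and align_det: "X \<in> verts H \<Longrightarrow> deterministic C (\<tau> X)"
    and align_epic: "X \<in> verts H \<Longrightarrow> epic C (\<tau> X)"
    and align_tensor_epic: "Xs \<in> lists (verts H) \<Longrightarrow> epic C (tensor_alignment C L H \<pi> \<tau> Xs)"

text \<open>
  In the equation below, the inputs and outputs of the low-level channel are listed in the order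
  in which they occur in the tensor products of the channels \<open>\<tau> X\<close>.
\<close>

definition constructive_abstraction ::
  "('o, 'a) markov_data \<Rightarrow> ('l, 'o, 'a) causal_model \<Rightarrow> ('h, 'o, 'a) causal_model
    \<Rightarrow> ('h \<Rightarrow> 'l set) \<Rightarrow> ('h \<Rightarrow> 'a) \<Rightarrow> bool" where
  "constructive_abstraction C L H \<pi> \<tau> \<longleftrightarrow>
     variable_alignment C L H \<pi> \<tau> \<and>
     (\<forall>S \<subseteq> nin H.
        let is = listing H (ins H) @ listing H S;
            os = listing H (outs H);
            low = (\<lambda>Xs. concat (map (\<lambda>X. listing L (\<pi> X)) Xs))
        in tensor_alignment C L H \<pi> \<tau> os
             \<cdot>\<^bsub>C\<^esub> channel C (intervene L (\<Union> (\<pi> ` S))) (low is) (low os)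
           = channel C (intervene H S) is os \<cdot>\<^bsub>C\<^esub> tensor_alignment C L H \<pi> \<tau> is)"

text \<open>Only the values of \<open>\<pi>\<close> and \<open>\<tau>\<close> at the variables of \<open>H\<close> are relevant.\<close>

definition constructive_abstractions ::
  "('o, 'a) markov_data \<Rightarrow> ('l, 'o, 'a) causal_model \<Rightarrow> ('h, 'o, 'a) causal_model
    \<Rightarrow> (('h \<Rightarrow> 'l set) \<times> ('h \<Rightarrow> 'a)) set" where
  "constructive_abstractions C L H =
     {(\<pi>, \<tau>). \<pi> \<in> extensional (verts H) \<and> \<tau> \<in> extensional (verts H) \<and>
              constructive_abstraction C L H \<pi> \<tau>}"


section \<open>Downward abstractions of causal models\<close>

type_synonym ('l, 'h, 'a) do_abstraction =
  "('h list, ('h, 'h set \<times> 'h set) diagram set,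
    'l list, ('l, 'l set \<times> 'l set) diagram set) mfunctor \<times> ('h list \<Rightarrow> 'a)"

definition do_abstractions ::
  "('o, 'a) markov_data \<Rightarrow> ('l, 'o, 'a) causal_model \<Rightarrow> ('h, 'o, 'a) causal_model
    \<Rightarrow> ('l, 'h, 'a) do_abstraction set" where
  "do_abstractions C L H =
     {(\<pi>, \<tau>).
        downward_abstraction C (do_signature L) (do_model C L) (do_signature H) (do_model C H) \<pi> \<tau> \<and>
        (\<Union>X \<in> ins H. set (FOb \<pi> [X])) = ins L}"

definition do_abstractions_iso ::
  "('o, 'a) markov_data \<Rightarrow> ('l, 'o, 'a) causal_model \<Rightarrow> ('h, 'o, 'a) causal_model
    \<Rightarrow> (('l, 'h, 'a) do_abstraction \<times> ('l, 'h, 'a) do_abstraction) set" where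
  "do_abstractions_iso C L H =
     {(A, B). A \<in> do_abstractions C L H \<and> B \<in> do_abstractions C L H \<and>
        isomorphic_abstractions C (do_signature L) (do_model C L) (do_signature H) A B}"

text \<open>
  The list \<open>\<pi> [X]\<close> becomes a set, so \<open>\<tau> [X]\<close> is precomposed with the permutation
  from the chosen listing of that set.
\<close>

definition restrict_to_variables ::
  "('o, 'a) markov_data \<Rightarrow> ('l, 'o, 'a) causal_model \<Rightarrow> ('h, 'o, 'a) causal_model
    \<Rightarrow> ('l, 'h, 'a) do_abstraction \<Rightarrow> ('h \<Rightarrow> 'l set) \<times> ('h \<Rightarrow> 'a)" where
  "restrict_to_variables C L H = (\<lambda>(\<pi>, \<tau>).
     (\<lambda>X \<in> verts H. set (FOb \<pi> [X]),
      \<lambda>X \<in> verts H. \<tau> [X] \<cdot>\<^bsub>C\<^esub> wire_select C (vob L) (listing L (set (FOb \<pi> [X]))) (FOb \<pi> [X])))"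

end

theory Submission
  imports Defs "HOL-Library.Multiset"
begin

text \<open>
  The deterministic arrows of a Markov category form a cartesian category: an arrow
  \<open>f\<close> into \<open>X \<odot> Y\<close> is recovered as \<open>(p\<^sub>1 f \<otimes> p\<^sub>2 f) \<cdot> copy\<close>, and cocommutativity and
  coassociativity of \<open>copy\<close> exhibit \<open>symm\<close> and \<open>assoc\<close> as such pairings.  All coherence
  questions are therefore settled by comparing projections, and the projections of a diagram are
  computed by tracing its output wires back to its inputs.  Tracing is also invariant under the
  equations of the free Markov category; hence isomorphisms in that category permute wires, and a
  deterministic one with distinct input wires is determined by its source and target.

  A pair \<open>(\<pi>, \<tau>)\<close> of a variable alignment yields a functor between the free Markov
  categories by universality, and \<open>\<tau>\<close> extends uniquely to a monoidal transformation, which is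
  natural as soon as it is natural at the queries.  Naturality at \<open>Do(S)\<close> with all outputs is the
  equation of a constructive abstraction; the other output sets follow by discarding.  Conversely,
  the query \<open>Do(V\<^sup>n\<^sup>i\<^sup>n)\<close> has all variables as distinct inputs, which forces the lists
  \<open>\<pi> X\<close> to be distinct and disjoint, and every downward abstraction is isomorphic to the one
  built from its restriction to variables.
\<close>

section \<open>Calculus in Markov categories\<close>

text \<open>A bijection on the nose is out of reach: a functor between free categories chooses an
  order on each list \<open>\<pi> [X]\<close> and structure isomorphisms, while an alignment records
  neither. Hence the quotient, in which every abstraction is compared with one canonical
  representative.

  The obstacle is that arrows of the free category are classes of diagrams without a normal form:
  even the class of an identity has representatives that contain queries whose results are
  discarded. Two devices stand in for normal forms. Traces are defined on diagrams, where invariance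
  is checked equation by equation, and they show that an invertible class loses no wire. Moreover,
  the free category is itself a Markov category that models its own signature, with the quotient map
  as interpretation; so what is proved about all models by comparing projections specialises to
  equations between classes of diagrams.

  Tensor products in \<open>C\<close> carry associators and unitors, so every step on lists brings a
  canonical isomorphism; as these are deterministic, projections compute them. Distinctness of lists
  is tracked because a wire can then be addressed by its variable.\<close>

context category begin

lemma hom_self: "f \<in> Ar C \<Longrightarrow> f \<in> hom C (Dom C f) (Cod C f)"
  by (simp add: hom_def)

text \<open>Here and below, typing is stated through \<open>Ar\<close>, \<open>Dom\<close> and
  \<open>Cod\<close> instead of \<open>hom\<close>, so that the simplifier can discharge side
  conditions by rewriting.\<close>

lemma id_simps [simp]:
  assumes "X \<in> Ob C" shows "Idn C X \<in> Ar C" "Dom C (Idn C X) = X" "Cod C (Idn C X) = X"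
  using id_hom[OF assms] by (auto simp: hom_def)

lemma cmp_simps [simp]:
  assumes "f \<in> Ar C" "g \<in> Ar C" "Dom C g = Cod C f"
  shows "g \<cdot> f \<in> Ar C" "Dom C (g \<cdot> f) = Dom C f" "Cod C (g \<cdot> f) = Cod C g"
  using cmp_hom[of f "Dom C f" "Cod C f" g "Cod C g"] assms by (auto simp: hom_def)

lemma cmp_id_simps [simp]:
  assumes "f \<in> Ar C"
  shows "Dom C f = X \<Longrightarrow> f \<cdot> Idn C X = f" "Cod C f = Y \<Longrightarrow> Idn C Y \<cdot> f = f"
  using cmp_id_right[of f "Dom C f" "Cod C f"] cmp_id_left[of f "Dom C f" "Cod C f"] assms
  by (auto simp: hom_def)

lemma cmpA [simp]:
  assumes "f \<in> Ar C" "g \<in> Ar C" "h \<in> Ar C" "Dom C g = Cod C f" "Dom C h = Cod C g"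
  shows "(h \<cdot> g) \<cdot> f = h \<cdot> (g \<cdot> f)"
  using cmp_assoc[of f "Dom C f" "Cod C f" g "Cod C g" h "Cod C h"] assms by (auto simp: hom_def)

lemma ob_simps [simp]: "f \<in> Ar C \<Longrightarrow> Dom C f \<in> Ob C" "f \<in> Ar C \<Longrightarrow> Cod C f \<in> Ob C"
  by (auto intro: dom_ob cod_ob)

text \<open>\<open>cmpA\<close> brackets composites to the right, where an equation for
  \<open>h \<cdot> g\<close> no longer matches once something precedes it. This rule restores the
  match; the \<open>_reassoc\<close> variants below serve the same end.\<close>

lemma cmp_reassoc:
  assumes "h \<cdot> g = k" "f \<in> Ar C" "g \<in> Ar C" "h \<in> Ar C" "Dom C g = Cod C f" "Dom C h = Cod C g"
  shows "h \<cdot> (g \<cdot> f) = k \<cdot> f"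
  using assms cmpA[of f g h] by simp

lemma inverse_unique:
  assumes "inverse_arrows C f g" "inverse_arrows C f h" shows "g = h"
proof -
  note [simp del] = cmpA
  have g: "g \<in> hom C (Cod C f) (Dom C f)" and h: "h \<in> hom C (Cod C f) (Dom C f)"
    and f: "f \<in> hom C (Dom C f) (Cod C f)"
    using assms by (auto simp: inverse_arrows_def hom_def)
  have "g = (h \<cdot> f) \<cdot> g" using assms g by (auto simp: inverse_arrows_def hom_def)
  also have "\<dots> = h \<cdot> (f \<cdot> g)" using cmp_assoc[OF g f h] .
  also have "\<dots> = h" using assms h by (auto simp: inverse_arrows_def hom_def)
  finally show ?thesis .
qed

lemma inverse_arrows_inv: "iso_arrow C f \<Longrightarrow> inverse_arrows C f (inv_arrow C f)"
  unfolding iso_arrow_def inv_arrow_def by (metis inverse_unique theI)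

lemma inv_eq: "inverse_arrows C f g \<Longrightarrow> inv_arrow C f = g"
  using inverse_arrows_inv inverse_unique iso_arrow_def by metis

lemma iso_ar [simp]: "iso_arrow C f \<Longrightarrow> f \<in> Ar C"
  by (auto simp: iso_arrow_def inverse_arrows_def)

lemma inv_simps [simp]:
  assumes "iso_arrow C f"
  shows "inv_arrow C f \<in> Ar C" "Dom C (inv_arrow C f) = Cod C f" "Cod C (inv_arrow C f) = Dom C f"
    "f \<cdot> inv_arrow C f = Idn C (Cod C f)" "inv_arrow C f \<cdot> f = Idn C (Dom C f)"
  using inverse_arrows_inv[OF assms] by (auto simp: inverse_arrows_def hom_def)

lemma inv_reassoc [simp]:
  assumes "iso_arrow C f" "k \<in> Ar C"
  shows "Cod C k = Cod C f \<Longrightarrow> f \<cdot> (inv_arrow C f \<cdot> k) = k"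
    "Cod C k = Dom C f \<Longrightarrow> inv_arrow C f \<cdot> (f \<cdot> k) = k"
proof -
  assume "Cod C k = Cod C f"
  thus "f \<cdot> (inv_arrow C f \<cdot> k) = k" using assms cmpA[of k "inv_arrow C f" f] by simp
next
  assume "Cod C k = Dom C f"
  thus "inv_arrow C f \<cdot> (f \<cdot> k) = k" using assms cmpA[of k f "inv_arrow C f"] by simp
qed

lemma iso_id [simp]: "X \<in> Ob C \<Longrightarrow> iso_arrow C (Idn C X)"
  unfolding iso_arrow_def inverse_arrows_def by (auto simp: hom_def intro!: exI[of _ "Idn C X"])

lemma inv_id [simp]: "X \<in> Ob C \<Longrightarrow> inv_arrow C (Idn C X) = Idn C X"
  by (rule inv_eq) (simp add: inverse_arrows_def hom_def)

lemma iso_inv [simp]: "iso_arrow C f \<Longrightarrow> iso_arrow C (inv_arrow C f)"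
  unfolding iso_arrow_def[of C "inv_arrow C f"] by (rule exI[of _ f]) (simp add: inverse_arrows_def hom_def)

lemma iso_cmp [simp]:
  assumes "iso_arrow C f" "iso_arrow C g" "Dom C g = Cod C f"
  shows "iso_arrow C (g \<cdot> f)"
  unfolding iso_arrow_def
  by (rule exI[of _ "inv_arrow C f \<cdot> inv_arrow C g"]) (use assms in \<open>simp add: inverse_arrows_def hom_def\<close>)

lemma iso_cancel_right:
  assumes "iso_arrow C e" "f \<in> Ar C" "g \<in> Ar C" "Dom C f = Cod C e" "Dom C g = Cod C e" "f \<cdot> e = g \<cdot> e"
  shows "f = g"
proof -
  have "f = (f \<cdot> e) \<cdot> inv_arrow C e" using assms(1-5) by simp
  also have "\<dots> = g" using assms(1-5) unfolding assms(6) by simp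
  finally show ?thesis .
qed

lemma iso_cancel_left:
  assumes "iso_arrow C e" "f \<in> Ar C" "g \<in> Ar C" "Cod C f = Dom C e" "Cod C g = Dom C e" "e \<cdot> f = e \<cdot> g"
  shows "f = g"
proof -
  have "f = inv_arrow C e \<cdot> (e \<cdot> f)" using assms(1-5) by simp
  also have "\<dots> = g" using assms(1-5) unfolding assms(6) by simp
  finally show ?thesis .
qed

lemma epic_cmp_iso:
  assumes "epic C f" "iso_arrow C e" "Dom C f = Cod C e" shows "epic C (f \<cdot> e)"
proof -
  have f: "f \<in> Ar C" using assms(1) by (simp add: epic_def)
  have "g = h" if gh: "g \<in> hom C (Cod C f) Z" "h \<in> hom C (Cod C f) Z" "g \<cdot> f \<cdot> e = h \<cdot> f \<cdot> e" for Z g h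
  proof -
    have "g \<cdot> f = h \<cdot> f"
      by (rule iso_cancel_right[OF assms(2)]) (use gh assms f in \<open>auto simp: hom_def\<close>)
    thus ?thesis using assms(1) gh by (auto simp: epic_def)
  qed
  thus ?thesis using f assms by (auto simp: epic_def)
qed

end

section \<open>Symmetric monoidal calculus\<close>

context symmetric_monoidal_category begin

lemma tensor_simps [simp]:
  assumes "f \<in> Ar C" "g \<in> Ar C"
  shows "f \<otimes> g \<in> Ar C" "Dom C (f \<otimes> g) = Dom C f \<odot> Dom C g" "Cod C (f \<otimes> g) = Cod C f \<odot> Cod C g"
  using tensor_hom[OF hom_self[OF assms(1)] hom_self[OF assms(2)]] by (auto simp: hom_def)

declare tensor_ob [simp] unit_ob [simp] tensor_id [simp]

lemma tensor_cmp_simp [simp]: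
  assumes "f \<in> Ar C" "g \<in> Ar C" "f' \<in> Ar C" "g' \<in> Ar C" "Dom C g = Cod C f" "Dom C g' = Cod C f'"
  shows "(g \<otimes> g') \<cdot> (f \<otimes> f') = (g \<cdot> f) \<otimes> (g' \<cdot> f')"
  using tensor_cmp[of f "Dom C f" "Cod C f" g "Cod C g" f' "Dom C f'" "Cod C f'" g' "Cod C g'"] assms
  by (auto simp: hom_def)

lemma tensor_cmp_reassoc [simp]:
  assumes "f \<in> Ar C" "g \<in> Ar C" "f' \<in> Ar C" "g' \<in> Ar C" "Dom C g = Cod C f" "Dom C g' = Cod C f'"
    "k \<in> Ar C" "Cod C k = Dom C f \<odot> Dom C f'"
  shows "(g \<otimes> g') \<cdot> ((f \<otimes> f') \<cdot> k) = ((g \<cdot> f) \<otimes> (g' \<cdot> f')) \<cdot> k"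
  using assms cmpA[of k "f \<otimes> f'" "g \<otimes> g'"] by simp

lemma structure_simps [simp]:
  assumes "X \<in> Ob C"
  shows "lunit C X \<in> Ar C" "Dom C (lunit C X) = Unt C \<odot> X" "Cod C (lunit C X) = X"
    "runit C X \<in> Ar C" "Dom C (runit C X) = X \<odot> Unt C" "Cod C (runit C X) = X"
    "Y \<in> Ob C \<Longrightarrow> symm C X Y \<in> Ar C"
    "Y \<in> Ob C \<Longrightarrow> Dom C (symm C X Y) = X \<odot> Y"
    "Y \<in> Ob C \<Longrightarrow> Cod C (symm C X Y) = Y \<odot> X"
    "Y \<in> Ob C \<Longrightarrow> Z \<in> Ob C \<Longrightarrow> assoc C X Y Z \<in> Ar C"
    "Y \<in> Ob C \<Longrightarrow> Z \<in> Ob C \<Longrightarrow> Dom C (assoc C X Y Z) = (X \<odot> Y) \<odot> Z"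
    "Y \<in> Ob C \<Longrightarrow> Z \<in> Ob C \<Longrightarrow> Cod C (assoc C X Y Z) = X \<odot> Y \<odot> Z"
  using assms lunit_hom[of X] runit_hom[of X] symm_hom[of X Y] assoc_hom[of X Y Z]
  by (auto simp: hom_def)

declare assoc_iso [simp] lunit_iso [simp] runit_iso [simp]

lemma natural_simps:
  assumes "f \<in> Ar C"
  shows "Cod C f = Y \<Longrightarrow> lunit C Y \<cdot> (Idn C (Unt C) \<otimes> f) = f \<cdot> lunit C (Dom C f)"
    "Cod C f = Y \<Longrightarrow> runit C Y \<cdot> (f \<otimes> Idn C (Unt C)) = f \<cdot> runit C (Dom C f)"
    "g \<in> Ar C \<Longrightarrow> Cod C f = Y \<Longrightarrow> Cod C g = Y' \<Longrightarrow>
       symm C Y Y' \<cdot> (f \<otimes> g) = (g \<otimes> f) \<cdot> symm C (Dom C f) (Dom C g)"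
    "g \<in> Ar C \<Longrightarrow> h \<in> Ar C \<Longrightarrow> Cod C f = Y \<Longrightarrow> Cod C g = Y' \<Longrightarrow> Cod C h = Y'' \<Longrightarrow>
       assoc C Y Y' Y'' \<cdot> ((f \<otimes> g) \<otimes> h) = (f \<otimes> (g \<otimes> h)) \<cdot> assoc C (Dom C f) (Dom C g) (Dom C h)"
  using assms lunit_natural[of f "Dom C f" "Cod C f"] runit_natural[of f "Dom C f" "Cod C f"]
    symm_natural[of f "Dom C f" "Cod C f" g "Dom C g" "Cod C g"]
    assoc_natural[of f "Dom C f" "Cod C f" g "Dom C g" "Cod C g" h "Dom C h" "Cod C h"]
  by (auto simp: hom_def)

lemma natural_reassoc:
  assumes "f \<in> Ar C" "k \<in> Ar C"
  shows "Cod C f = Y \<Longrightarrow> Cod C k = Unt C \<odot> Dom C f \<Longrightarrow>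
       lunit C Y \<cdot> ((Idn C (Unt C) \<otimes> f) \<cdot> k) = f \<cdot> (lunit C (Dom C f) \<cdot> k)"
    "Cod C f = Y \<Longrightarrow> Cod C k = Dom C f \<odot> Unt C \<Longrightarrow>
       runit C Y \<cdot> ((f \<otimes> Idn C (Unt C)) \<cdot> k) = f \<cdot> (runit C (Dom C f) \<cdot> k)"
    "g \<in> Ar C \<Longrightarrow> Cod C f = Y \<Longrightarrow> Cod C g = Y' \<Longrightarrow> Cod C k = Dom C f \<odot> Dom C g \<Longrightarrow>
       symm C Y Y' \<cdot> ((f \<otimes> g) \<cdot> k) = (g \<otimes> f) \<cdot> (symm C (Dom C f) (Dom C g) \<cdot> k)"
    "g \<in> Ar C \<Longrightarrow> h \<in> Ar C \<Longrightarrow> Cod C f = Y \<Longrightarrow> Cod C g = Y' \<Longrightarrow> Cod C h = Y'' \<Longrightarrow>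
       Cod C k = (Dom C f \<odot> Dom C g) \<odot> Dom C h \<Longrightarrow>
       assoc C Y Y' Y'' \<cdot> (((f \<otimes> g) \<otimes> h) \<cdot> k) = (f \<otimes> (g \<otimes> h)) \<cdot> (assoc C (Dom C f) (Dom C g) (Dom C h) \<cdot> k)"
  using assms
  by (auto simp: cmp_reassoc[OF natural_simps(1)] cmp_reassoc[OF natural_simps(2)]
      cmp_reassoc[OF natural_simps(3)] cmp_reassoc[OF natural_simps(4)])

lemma iso_tensor:
  assumes "iso_arrow C f" "iso_arrow C g"
  shows "iso_arrow C (f \<otimes> g)" "inv_arrow C (f \<otimes> g) = inv_arrow C f \<otimes> inv_arrow C g"
proof -
  have "inverse_arrows C (f \<otimes> g) (inv_arrow C f \<otimes> inv_arrow C g)"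
    using assms by (simp add: inverse_arrows_def hom_def)
  thus "iso_arrow C (f \<otimes> g)" "inv_arrow C (f \<otimes> g) = inv_arrow C f \<otimes> inv_arrow C g"
    by (auto simp: iso_arrow_def intro: inv_eq)
qed

declare iso_tensor(1) [simp]

lemma interchange_simps [simp]:
  assumes "W \<in> Ob C" "X \<in> Ob C" "Y \<in> Ob C" "Z \<in> Ob C"
  shows "interchange C W X Y Z \<in> Ar C"
    "Dom C (interchange C W X Y Z) = (W \<odot> X) \<odot> Y \<odot> Z"
    "Cod C (interchange C W X Y Z) = (W \<odot> Y) \<odot> X \<odot> Z"
  using assms by (auto simp: interchange_def Let_def)

lemma inv_assoc_natural:
  assumes "f \<in> Ar C" "g \<in> Ar C" "h \<in> Ar C" "Cod C f = X" "Cod C g = Y" "Cod C h = Z"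
  shows "inv_arrow C (assoc C X Y Z) \<cdot> (f \<otimes> (g \<otimes> h))
    = ((f \<otimes> g) \<otimes> h) \<cdot> inv_arrow C (assoc C (Dom C f) (Dom C g) (Dom C h))" (is "?a \<cdot> ?l = ?r \<cdot> ?b")
proof -
  let ?A = "assoc C X Y Z" and ?B = "assoc C (Dom C f) (Dom C g) (Dom C h)"
  have "?a \<cdot> ?l = ?a \<cdot> ((?l \<cdot> ?B) \<cdot> ?b)" using assms by auto
  also have "?l \<cdot> ?B = ?A \<cdot> ?r" using natural_simps(4)[OF assms] by simp
  also have "?a \<cdot> ((?A \<cdot> ?r) \<cdot> ?b) = ?r \<cdot> ?b" using assms by auto
  finally show ?thesis .
qed

text \<open>The interchange is a composite of associators around one braiding, so naturality is
  inherited factor by factor.\<close>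

lemma interchange_natural:
  assumes "f \<in> Ar C" "g \<in> Ar C" "h \<in> Ar C" "k \<in> Ar C"
  shows "interchange C (Cod C f) (Cod C g) (Cod C h) (Cod C k) \<cdot> ((f \<otimes> g) \<otimes> (h \<otimes> k))
    = ((f \<otimes> h) \<otimes> (g \<otimes> k)) \<cdot> interchange C (Dom C f) (Dom C g) (Dom C h) (Dom C k)"
proof -
  \<comment> \<open>The inner exchange of \<open>X\<close> and \<open>Y\<close> in
    \<open>X \<odot> (Y \<odot> Z)\<close>; the outer associators are treated separately at the
    end.\<close>
  define m where "m X Y Z = assoc C Y X Z \<cdot> (symm C X Y \<otimes> Idn C Z) \<cdot> inv_arrow C (assoc C X Y Z)" for X Y Z
  have m [simp]: "m X Y Z \<in> Ar C" "Dom C (m X Y Z) = X \<odot> Y \<odot> Z" "Cod C (m X Y Z) = Y \<odot> X \<odot> Z"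
    if "X \<in> Ob C" "Y \<in> Ob C" "Z \<in> Ob C" for X Y Z
    using that by (auto simp: m_def)
  have int: "interchange C W X Y Z
      = inv_arrow C (assoc C W Y (X \<odot> Z)) \<cdot> (Idn C W \<otimes> m X Y Z) \<cdot> assoc C W X (Y \<odot> Z)" for W X Y Z
    by (simp add: interchange_def m_def Let_def)
  have mid: "m (Cod C g) (Cod C h) (Cod C k) \<cdot> (g \<otimes> (h \<otimes> k))
      = (h \<otimes> (g \<otimes> k)) \<cdot> m (Dom C g) (Dom C h) (Dom C k)"
  proof -
    have "m (Cod C g) (Cod C h) (Cod C k) \<cdot> (g \<otimes> (h \<otimes> k)) =
      assoc C (Cod C h) (Cod C g) (Cod C k) \<cdot> (((symm C (Cod C g) (Cod C h) \<cdot> (g \<otimes> h)) \<otimes> k)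
        \<cdot> inv_arrow C (assoc C (Dom C g) (Dom C h) (Dom C k)))"
      using assms by (simp add: m_def inv_assoc_natural)
    also have "symm C (Cod C g) (Cod C h) \<cdot> (g \<otimes> h) = (h \<otimes> g) \<cdot> symm C (Dom C g) (Dom C h)"
      using assms by (simp add: natural_simps)
    also have "((h \<otimes> g) \<cdot> symm C (Dom C g) (Dom C h)) \<otimes> k
        = ((h \<otimes> g) \<otimes> k) \<cdot> (symm C (Dom C g) (Dom C h) \<otimes> Idn C (Dom C k))"
      using assms by simp
    finally show ?thesis
      using assms by (simp add: m_def natural_reassoc del: tensor_cmp_reassoc tensor_cmp_simp)
  qed
  have split: "f \<otimes> ((h \<otimes> (g \<otimes> k)) \<cdot> m (Dom C g) (Dom C h) (Dom C k))
      = (f \<otimes> (h \<otimes> (g \<otimes> k))) \<cdot> (Idn C (Dom C f) \<otimes> m (Dom C g) (Dom C h) (Dom C k))"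
    using assms by simp
  show ?thesis
    using assms
    by (simp add: int natural_simps(4) mid)
       (simp add: split cmp_reassoc[OF inv_assoc_natural] del: tensor_cmp_reassoc tensor_cmp_simp)
qed

end

section \<open>Projections and deterministic arrows of a Markov category\<close>

context markov_category begin

lemma markov_simps [simp]:
  assumes "X \<in> Ob C"
  shows "copy C X \<in> Ar C" "Dom C (copy C X) = X" "Cod C (copy C X) = X \<odot> X"
    "disc C X \<in> Ar C" "Dom C (disc C X) = X" "Cod C (disc C X) = Unt C"
  using assms copy_hom[of X] disc_hom[of X] by (auto simp: hom_def)

lemma to_unit_eq: "f \<in> Ar C \<Longrightarrow> Cod C f = Unt C \<Longrightarrow> f = disc C (Dom C f)"
  by (rule terminal) (simp add: hom_def)

lemma to_unit_unique:
  "f \<in> Ar C \<Longrightarrow> g \<in> Ar C \<Longrightarrow> Cod C f = Unt C \<Longrightarrow> Cod C g = Unt C \<Longrightarrow> Dom C f = Dom C g \<Longrightarrow> f = g"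
  using to_unit_eq by metis

text \<open>Any object isomorphic to the unit is terminal too. This is applied to
  \<open>Unt C \<odot> Unt C\<close> and later to the image of the empty list under a
  functor.\<close>

lemma to_iso_unit_unique:
  assumes "iso_arrow C e" "Dom C e = Unt C" "f \<in> Ar C" "g \<in> Ar C" "Cod C f = Cod C e" "Cod C g = Cod C e"
    "Dom C f = Dom C g"
  shows "f = g"
  by (rule iso_cancel_left[of "inv_arrow C e"]) (use assms in \<open>auto intro!: to_unit_unique\<close>)

lemma disc_natural [simp]: "f \<in> Ar C \<Longrightarrow> Cod C f = Y \<Longrightarrow> disc C Y \<cdot> f = disc C (Dom C f)"
  by (rule to_unit_unique) auto

lemma disc_natural_reassoc [simp]:
  "f \<in> Ar C \<Longrightarrow> Cod C f = Y \<Longrightarrow> k \<in> Ar C \<Longrightarrow> Cod C k = Dom C f \<Longrightarrow> disc C Y \<cdot> (f \<cdot> k) = disc C (Dom C k)"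
  by (rule to_unit_unique) auto

lemma disc_unit [simp]: "disc C (Unt C) = Idn C (Unt C)"
  by (rule to_unit_unique) auto

text \<open>Marginalisation to one factor. On deterministic arrows \<open>pr1\<close> and
  \<open>pr2\<close> are the projections of a cartesian product.\<close>

definition pr1 :: "'a \<Rightarrow> 'a \<Rightarrow> 'b" where
  "pr1 X Y = runit C X \<cdot> (Idn C X \<otimes> disc C Y)"

definition pr2 :: "'a \<Rightarrow> 'a \<Rightarrow> 'b" where
  "pr2 X Y = lunit C Y \<cdot> (disc C X \<otimes> Idn C Y)"

lemma pr_simps [simp]:
  assumes "X \<in> Ob C" "Y \<in> Ob C"
  shows "pr1 X Y \<in> Ar C" "Dom C (pr1 X Y) = X \<odot> Y" "Cod C (pr1 X Y) = X"
    "pr2 X Y \<in> Ar C" "Dom C (pr2 X Y) = X \<odot> Y" "Cod C (pr2 X Y) = Y"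
  using assms by (auto simp: pr1_def pr2_def)

text \<open>Valid for arbitrary channels: discarding a factor absorbs whatever was applied to it, as
  the unit is terminal.\<close>

lemma pr_tensor [simp]:
  assumes "f \<in> Ar C" "g \<in> Ar C" "Cod C f = X" "Cod C g = Y"
  shows "pr1 X Y \<cdot> (f \<otimes> g) = f \<cdot> pr1 (Dom C f) (Dom C g)"
    "pr2 X Y \<cdot> (f \<otimes> g) = g \<cdot> pr2 (Dom C f) (Dom C g)"
proof -
  have "pr1 X Y \<cdot> (f \<otimes> g) = runit C X \<cdot> ((f \<otimes> Idn C (Unt C)) \<cdot> (Idn C (Dom C f) \<otimes> disc C (Dom C g)))"
    using assms by (auto simp: pr1_def)
  also have "\<dots> = f \<cdot> pr1 (Dom C f) (Dom C g)"
    using assms by (simp add: pr1_def natural_reassoc del: tensor_cmp_simp)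
  finally show "pr1 X Y \<cdot> (f \<otimes> g) = f \<cdot> pr1 (Dom C f) (Dom C g)" .
  have "pr2 X Y \<cdot> (f \<otimes> g) = lunit C Y \<cdot> ((Idn C (Unt C) \<otimes> g) \<cdot> (disc C (Dom C f) \<otimes> Idn C (Dom C g)))"
    using assms by (auto simp: pr2_def)
  also have "\<dots> = g \<cdot> pr2 (Dom C f) (Dom C g)"
    using assms by (simp add: pr2_def natural_reassoc del: tensor_cmp_simp)
  finally show "pr2 X Y \<cdot> (f \<otimes> g) = g \<cdot> pr2 (Dom C f) (Dom C g)" .
qed

lemma pr_tensor_reassoc [simp]:
  assumes "f \<in> Ar C" "g \<in> Ar C" "Cod C f = X" "Cod C g = Y" "k \<in> Ar C" "Cod C k = Dom C f \<odot> Dom C g"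
  shows "pr1 X Y \<cdot> ((f \<otimes> g) \<cdot> k) = f \<cdot> (pr1 (Dom C f) (Dom C g) \<cdot> k)"
    "pr2 X Y \<cdot> ((f \<otimes> g) \<cdot> k) = g \<cdot> (pr2 (Dom C f) (Dom C g) \<cdot> k)"
  using assms by (auto simp: cmp_reassoc[OF pr_tensor(1)] cmp_reassoc[OF pr_tensor(2)])

lemma pr_copy [simp]:
  assumes "X \<in> Ob C"
  shows "pr1 X X \<cdot> copy C X = Idn C X" "pr2 X X \<cdot> copy C X = Idn C X"
  using copy_counit_right[OF assms] copy_counit_left[OF assms] assms by (auto simp: pr1_def pr2_def)

lemma pr_copy_reassoc [simp]:
  assumes "k \<in> Ar C" "Cod C k = X"
  shows "pr1 X X \<cdot> (copy C X \<cdot> k) = k" "pr2 X X \<cdot> (copy C X \<cdot> k) = k"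
  using assms by (auto simp: cmp_reassoc[OF pr_copy(1)] cmp_reassoc[OF pr_copy(2)])

text \<open>Both exchanged objects are the unit, and the braiding of
  \<open>Unt C \<odot> Unt C\<close> is the identity by terminality.\<close>

lemma runit_lunit_interchange:
  assumes "X \<in> Ob C" "Y \<in> Ob C"
  shows "interchange C X (Unt C) (Unt C) Y = Idn C ((X \<odot> Unt C) \<odot> (Unt C \<odot> Y))"
proof -
  have "symm C (Unt C) (Unt C) = Idn C (Unt C \<odot> Unt C)"
    by (rule to_iso_unit_unique[of "inv_arrow C (lunit C (Unt C))"]) auto
  thus ?thesis using assms by (simp add: interchange_def Let_def)
qed

text \<open>Surjective pairing. After \<open>copy_tensor\<close> the discards slide through the
  interchange, which thereby becomes trivial, and the counit laws of the two factors remain.\<close>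

lemma copy_pr:
  assumes "X \<in> Ob C" "Y \<in> Ob C"
  shows "(pr1 X Y \<otimes> pr2 X Y) \<cdot> copy C (X \<odot> Y) = Idn C (X \<odot> Y)"
proof -
  have "(pr1 X Y \<otimes> pr2 X Y) \<cdot> copy C (X \<odot> Y)
    = (runit C X \<otimes> lunit C Y) \<cdot> (((Idn C X \<otimes> disc C Y) \<otimes> (disc C X \<otimes> Idn C Y)) \<cdot> interchange C X X Y Y)
      \<cdot> (copy C X \<otimes> copy C Y)"
    using assms by (simp add: pr1_def pr2_def copy_tensor)
  also have "((Idn C X \<otimes> disc C Y) \<otimes> (disc C X \<otimes> Idn C Y)) \<cdot> interchange C X X Y Y
    = interchange C X (Unt C) (Unt C) Y \<cdot> ((Idn C X \<otimes> disc C X) \<otimes> (disc C Y \<otimes> Idn C Y))"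
    using interchange_natural[of "Idn C X" "disc C X" "disc C Y" "Idn C Y"] assms by simp
  also have "(runit C X \<otimes> lunit C Y) \<cdot> (interchange C X (Unt C) (Unt C) Y \<cdot> ((Idn C X \<otimes> disc C X) \<otimes> (disc C Y \<otimes> Idn C Y)))
      \<cdot> (copy C X \<otimes> copy C Y)
      = (runit C X \<cdot> (Idn C X \<otimes> disc C X) \<cdot> copy C X) \<otimes> (lunit C Y \<cdot> (disc C Y \<otimes> Idn C Y) \<cdot> copy C Y)"
    using assms by (simp add: runit_lunit_interchange)
  also have "\<dots> = Idn C (X \<odot> Y)"
    using assms copy_counit_left copy_counit_right by simp
  finally show ?thesis .
qed

abbreviation det :: "'b \<Rightarrow> bool" where "det \<equiv> deterministic C"

lemma det_ar [simp]: "det f \<Longrightarrow> f \<in> Ar C"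
  by (simp add: deterministic_def)

lemma detI: "f \<in> Ar C \<Longrightarrow> copy C (Cod C f) \<cdot> f = (f \<otimes> f) \<cdot> copy C (Dom C f) \<Longrightarrow> det f"
  by (simp add: deterministic_def)

lemma det_copy: "det f \<Longrightarrow> Cod C f = Y \<Longrightarrow> copy C Y \<cdot> f = (f \<otimes> f) \<cdot> copy C (Dom C f)"
  unfolding deterministic_def by auto

lemma det_copy_reassoc:
  "det f \<Longrightarrow> Cod C f = Y \<Longrightarrow> k \<in> Ar C \<Longrightarrow> Cod C k = Dom C f \<Longrightarrow>
    copy C Y \<cdot> (f \<cdot> k) = (f \<otimes> f) \<cdot> (copy C (Dom C f) \<cdot> k)"
  by (rule HOL.trans[OF cmp_reassoc[OF det_copy]]) auto

lemma det_id [simp]: "X \<in> Ob C \<Longrightarrow> det (Idn C X)"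
  by (rule detI) simp_all

lemma det_cmp [simp]:
  assumes "det f" "det g" "Dom C g = Cod C f" shows "det (g \<cdot> f)"
proof -
  note [simp] = det_ar[OF assms(1)] det_ar[OF assms(2)] assms(3)
  have "copy C (Cod C g) \<cdot> (g \<cdot> f) = (g \<otimes> g) \<cdot> (copy C (Dom C g) \<cdot> f)"
    by (rule det_copy_reassoc[OF assms(2)]) auto
  also have "copy C (Dom C g) \<cdot> f = (f \<otimes> f) \<cdot> copy C (Dom C f)"
    by (rule det_copy[OF assms(1)]) auto
  finally show ?thesis by (intro detI) simp_all
qed

lemma det_disc [simp]: "X \<in> Ob C \<Longrightarrow> det (disc C X)"
  by (rule detI) (auto intro!: to_iso_unit_unique[of "inv_arrow C (lunit C (Unt C))"])

lemma det_tensor [simp]: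
  assumes "det f" "det g" shows "det (f \<otimes> g)"
proof -
  note [simp] = det_ar[OF assms(1)] det_ar[OF assms(2)]
  let ?X = "Dom C f" and ?Y = "Dom C g"
  have "copy C (Cod C f \<odot> Cod C g) \<cdot> (f \<otimes> g)
    = interchange C (Cod C f) (Cod C f) (Cod C g) (Cod C g) \<cdot> (((f \<otimes> f) \<otimes> (g \<otimes> g)) \<cdot> (copy C ?X \<otimes> copy C ?Y))"
    using assms by (simp add: copy_tensor det_copy)
  also have "\<dots> = ((f \<otimes> g) \<otimes> (f \<otimes> g)) \<cdot> (interchange C ?X ?X ?Y ?Y \<cdot> (copy C ?X \<otimes> copy C ?Y))"
    using cmp_reassoc[OF interchange_natural[of f f g g], of "copy C ?X \<otimes> copy C ?Y"]
    by (simp del: tensor_cmp_simp)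
  finally show ?thesis by (intro detI) (simp_all add: copy_tensor)
qed

lemma copy_assoc_inv:
  assumes "X \<in> Ob C"
  shows "(copy C X \<otimes> Idn C X) \<cdot> copy C X = inv_arrow C (assoc C X X X) \<cdot> (Idn C X \<otimes> copy C X) \<cdot> copy C X"
  by (rule iso_cancel_left[of "assoc C X X X"]) (use assms in \<open>auto simp: copy_assoc\<close>)

text \<open>Copying twice is insensitive to exchanging the two middle wires: coassociativity makes
  them the outputs of a single copy, and cocommutativity absorbs the swap.\<close>

lemma det_copy_arrow [simp]:
  assumes X [simp]: "X \<in> Ob C" shows "det (copy C X)"
proof -
  let ?D = "copy C X" and ?I = "Idn C X" and ?a = "assoc C X X X"
  have 1: "assoc C X X (X \<odot> X) \<cdot> ((?D \<otimes> ?D) \<cdot> ?D) = (?I \<otimes> ((?I \<otimes> ?D) \<cdot> ?D)) \<cdot> ?D"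
  proof -
    have "(?D \<otimes> ?D) \<cdot> ?D = ((?I \<otimes> ?I) \<otimes> ?D) \<cdot> ((?D \<otimes> ?I) \<cdot> ?D)" by simp
    hence "assoc C X X (X \<odot> X) \<cdot> ((?D \<otimes> ?D) \<cdot> ?D)
        = assoc C X X (X \<odot> X) \<cdot> (((?I \<otimes> ?I) \<otimes> ?D) \<cdot> ((?D \<otimes> ?I) \<cdot> ?D))" by (rule arg_cong)
    also have "\<dots> = (?I \<otimes> (?I \<otimes> ?D)) \<cdot> (?a \<cdot> ((?D \<otimes> ?I) \<cdot> ?D))"
      using natural_reassoc(4)[of ?I "(?D \<otimes> ?I) \<cdot> ?D" ?I ?D X X "X \<odot> X"]
      by (simp del: tensor_id tensor_cmp_simp tensor_cmp_reassoc)
    also have "?a \<cdot> ((?D \<otimes> ?I) \<cdot> ?D) = (?I \<otimes> ?D) \<cdot> ?D" by (rule copy_assoc[OF X])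
    finally show ?thesis by simp
  qed
  have 2: "?a \<cdot> (symm C X X \<otimes> ?I) \<cdot> (inv_arrow C ?a \<cdot> ((?I \<otimes> ?D) \<cdot> ?D)) = (?I \<otimes> ?D) \<cdot> ?D"
  proof -
    have "inv_arrow C ?a \<cdot> ((?I \<otimes> ?D) \<cdot> ?D) = (?D \<otimes> ?I) \<cdot> ?D" by (rule copy_assoc_inv[OF X, symmetric])
    thus ?thesis by (simp add: copy_comm copy_assoc)
  qed
  have "copy C (X \<odot> X) \<cdot> ?D = inv_arrow C (assoc C X X (X \<odot> X)) \<cdot>
      (?I \<otimes> (?a \<cdot> (symm C X X \<otimes> ?I) \<cdot> inv_arrow C ?a)) \<cdot> (assoc C X X (X \<odot> X) \<cdot> ((?D \<otimes> ?D) \<cdot> ?D))"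
    by (simp add: copy_tensor interchange_def Let_def)
  also have "\<dots> = inv_arrow C (assoc C X X (X \<odot> X)) \<cdot>
      (?I \<otimes> (?a \<cdot> (symm C X X \<otimes> ?I) \<cdot> (inv_arrow C ?a \<cdot> ((?I \<otimes> ?D) \<cdot> ?D)))) \<cdot> ?D"
    unfolding 1 by simp
  also have "\<dots> = inv_arrow C (assoc C X X (X \<odot> X)) \<cdot> (assoc C X X (X \<odot> X) \<cdot> ((?D \<otimes> ?D) \<cdot> ?D))"
    unfolding 1 2 ..
  also have "\<dots> = (?D \<otimes> ?D) \<cdot> ?D" by simp
  finally show ?thesis by (intro detI) simp_all
qed

lemma det_inv [simp]:
  assumes "det f" "iso_arrow C f" shows "det (inv_arrow C f)"
proof -
  have "copy C (Dom C f) \<cdot> inv_arrow C f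
      = (inv_arrow C f \<otimes> inv_arrow C f) \<cdot> ((f \<otimes> f) \<cdot> copy C (Dom C f)) \<cdot> inv_arrow C f"
    using assms(2) by simp
  also have "\<dots> = (inv_arrow C f \<otimes> inv_arrow C f) \<cdot> copy C (Cod C f)"
    using assms by (simp flip: det_copy)
  finally show ?thesis using assms(2) by (intro detI) simp_all
qed

lemma inv_det_lunit:
  assumes X [simp]: "X \<in> Ob C"
  shows "inv_arrow C (lunit C X) = (disc C X \<otimes> Idn C X) \<cdot> copy C X"
    "inv_arrow C (runit C X) = (Idn C X \<otimes> disc C X) \<cdot> copy C X"
  by (rule iso_cancel_left[of "lunit C X"]; simp add: copy_counit_left)
     (rule iso_cancel_left[of "runit C X"]; simp add: copy_counit_right)

text \<open>The counit laws present the inverse of a unitor as a discard after a copy, which is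
  deterministic; the unitor is the inverse of that inverse.\<close>

lemma det_unitors [simp]:
  assumes X [simp]: "X \<in> Ob C"
  shows "det (lunit C X)" "det (runit C X)"
proof -
  have inv_inv: "inv_arrow C (inv_arrow C f) = f" if "iso_arrow C f" for f
    by (rule inv_eq) (use that in \<open>simp add: inverse_arrows_def hom_def\<close>)
  have "det (inv_arrow C (lunit C X))" "det (inv_arrow C (runit C X))" by (simp_all add: inv_det_lunit)
  hence "det (inv_arrow C (inv_arrow C (lunit C X)))" "det (inv_arrow C (inv_arrow C (runit C X)))" by simp_all
  thus "det (lunit C X)" "det (runit C X)" by (simp_all add: inv_inv)
qed

lemma pr_det [simp]:
  assumes "X \<in> Ob C" "Y \<in> Ob C" shows "det (pr1 X Y)" "det (pr2 X Y)"
  using assms by (auto simp: pr1_def pr2_def)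

lemma symm_eq_pair:
  assumes "X \<in> Ob C" "Y \<in> Ob C"
  shows "symm C X Y = (pr2 X Y \<otimes> pr1 X Y) \<cdot> copy C (X \<odot> Y)"
proof -
  \<comment> \<open>Cocommutativity inserts a swap after the copy, and naturality carries it past
    the two projections.\<close>
  have "(pr2 X Y \<otimes> pr1 X Y) \<cdot> copy C (X \<odot> Y) = (pr2 X Y \<otimes> pr1 X Y) \<cdot> (symm C (X \<odot> Y) (X \<odot> Y) \<cdot> copy C (X \<odot> Y))"
    using assms by (simp add: copy_comm)
  also have "\<dots> = symm C X Y \<cdot> ((pr1 X Y \<otimes> pr2 X Y) \<cdot> copy C (X \<odot> Y))"
    using assms by (simp add: natural_reassoc)
  also have "\<dots> = symm C X Y" using assms by (simp add: copy_pr)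
  finally show ?thesis ..
qed

lemma det_symm [simp]: "X \<in> Ob C \<Longrightarrow> Y \<in> Ob C \<Longrightarrow> det (symm C X Y)"
  by (simp add: symm_eq_pair)

lemma pr_symm [simp]:
  assumes "X \<in> Ob C" "Y \<in> Ob C"
  shows "pr1 Y X \<cdot> symm C X Y = pr2 X Y" "pr2 Y X \<cdot> symm C X Y = pr1 X Y"
  using assms by (auto simp: symm_eq_pair)

lemma pr_symm_reassoc [simp]:
  assumes "X \<in> Ob C" "Y \<in> Ob C" "k \<in> Ar C" "Cod C k = X \<odot> Y"
  shows "pr1 Y X \<cdot> (symm C X Y \<cdot> k) = pr2 X Y \<cdot> k" "pr2 Y X \<cdot> (symm C X Y \<cdot> k) = pr1 X Y \<cdot> k"
  using assms by (auto simp: cmp_reassoc[OF pr_symm(1)] cmp_reassoc[OF pr_symm(2)])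

lemma assoc_eq_pair:
  assumes [simp]: "X \<in> Ob C" "Y \<in> Ob C" "Z \<in> Ob C"
  defines "f \<equiv> pr1 X Y \<cdot> pr1 (X \<odot> Y) Z" and "g \<equiv> pr2 X Y \<cdot> pr1 (X \<odot> Y) Z" and "h \<equiv> pr2 (X \<odot> Y) Z"
  shows "assoc C X Y Z = (f \<otimes> ((g \<otimes> h) \<cdot> copy C ((X \<odot> Y) \<odot> Z))) \<cdot> copy C ((X \<odot> Y) \<odot> Z)"
proof -
  let ?T = "(X \<odot> Y) \<odot> Z"
  let ?D = "copy C ?T" and ?I = "Idn C ?T"
  have f [simp]: "f \<in> Ar C" "Dom C f = ?T" "Cod C f = X" and g [simp]: "g \<in> Ar C" "Dom C g = ?T" "Cod C g = Y"
    and h [simp]: "h \<in> Ar C" "Dom C h = ?T" "Cod C h = Z"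
    by (auto simp: f_def g_def h_def)
  \<comment> \<open>\<open>f\<close> and \<open>g\<close> are the two components of
    \<open>pr1 (X \<odot> Y) Z\<close>; pairing them gives it back because that projection is
    deterministic.\<close>
  have fg: "(f \<otimes> g) \<cdot> ?D = pr1 (X \<odot> Y) Z"
  proof -
    have "(f \<otimes> g) \<cdot> ?D = (pr1 X Y \<otimes> pr2 X Y) \<cdot> ((pr1 (X \<odot> Y) Z \<otimes> pr1 (X \<odot> Y) Z) \<cdot> ?D)"
      by (simp add: f_def g_def)
    also have "(pr1 (X \<odot> Y) Z \<otimes> pr1 (X \<odot> Y) Z) \<cdot> ?D = copy C (X \<odot> Y) \<cdot> pr1 (X \<odot> Y) Z"
      by (simp add: det_copy)
    also have "(pr1 X Y \<otimes> pr2 X Y) \<cdot> (copy C (X \<odot> Y) \<cdot> pr1 (X \<odot> Y) Z) = pr1 (X \<odot> Y) Z"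
      using cmp_reassoc[OF copy_pr[of X Y], of "pr1 (X \<odot> Y) Z"] by simp
    finally show ?thesis .
  qed
  have "(f \<otimes> ((g \<otimes> h) \<cdot> ?D)) \<cdot> ?D = (f \<otimes> (g \<otimes> h)) \<cdot> ((?I \<otimes> ?D) \<cdot> ?D)" by simp
  also have "(?I \<otimes> ?D) \<cdot> ?D = assoc C ?T ?T ?T \<cdot> ((?D \<otimes> ?I) \<cdot> ?D)" by (simp add: copy_assoc)
  also have "(f \<otimes> (g \<otimes> h)) \<cdot> (assoc C ?T ?T ?T \<cdot> ((?D \<otimes> ?I) \<cdot> ?D))
      = assoc C X Y Z \<cdot> (((f \<otimes> g) \<otimes> h) \<cdot> ((?D \<otimes> ?I) \<cdot> ?D))"
    by (simp add: natural_reassoc(4)[of f _ g h X Y Z] del: tensor_cmp_simp tensor_cmp_reassoc)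
  also have "((f \<otimes> g) \<otimes> h) \<cdot> ((?D \<otimes> ?I) \<cdot> ?D) = (((f \<otimes> g) \<cdot> ?D) \<otimes> h) \<cdot> ?D" by simp
  also have "\<dots> = Idn C ?T" unfolding fg unfolding h_def by (simp add: copy_pr)
  finally show ?thesis by simp
qed

lemma det_assoc [simp]:
  "X \<in> Ob C \<Longrightarrow> Y \<in> Ob C \<Longrightarrow> Z \<in> Ob C \<Longrightarrow> det (assoc C X Y Z)"
  by (simp add: assoc_eq_pair)

lemma pr_assoc [simp]:
  assumes [simp]: "X \<in> Ob C" "Y \<in> Ob C" "Z \<in> Ob C"
  shows "pr1 X (Y \<odot> Z) \<cdot> assoc C X Y Z = pr1 X Y \<cdot> pr1 (X \<odot> Y) Z"
    "pr1 Y Z \<cdot> (pr2 X (Y \<odot> Z) \<cdot> assoc C X Y Z) = pr2 X Y \<cdot> pr1 (X \<odot> Y) Z"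
    "pr2 Y Z \<cdot> (pr2 X (Y \<odot> Z) \<cdot> assoc C X Y Z) = pr2 (X \<odot> Y) Z"
  by (auto simp: assoc_eq_pair)

lemma pr_assoc_reassoc [simp]:
  assumes [simp]: "X \<in> Ob C" "Y \<in> Ob C" "Z \<in> Ob C" "k \<in> Ar C" "Cod C k = (X \<odot> Y) \<odot> Z"
  shows "pr1 X (Y \<odot> Z) \<cdot> (assoc C X Y Z \<cdot> k) = pr1 X Y \<cdot> (pr1 (X \<odot> Y) Z \<cdot> k)"
    "pr1 Y Z \<cdot> (pr2 X (Y \<odot> Z) \<cdot> (assoc C X Y Z \<cdot> k)) = pr2 X Y \<cdot> (pr1 (X \<odot> Y) Z \<cdot> k)"
    "pr2 Y Z \<cdot> (pr2 X (Y \<odot> Z) \<cdot> (assoc C X Y Z \<cdot> k)) = pr2 (X \<odot> Y) Z \<cdot> k"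
  using pr_assoc[of X Y Z] cmpA[of k "assoc C X Y Z" "pr2 X (Y \<odot> Z)"]
    cmp_reassoc[OF pr_assoc(1)[of X Y Z], of k]
    cmp_reassoc[of "pr1 Y Z" "pr2 X (Y \<odot> Z) \<cdot> assoc C X Y Z" "pr2 X Y \<cdot> pr1 (X \<odot> Y) Z" k]
    cmp_reassoc[of "pr2 Y Z" "pr2 X (Y \<odot> Z) \<cdot> assoc C X Y Z" "pr2 (X \<odot> Y) Z" k]
  by auto

text \<open>Determinism moves the copy from the target to the source of \<open>f\<close>, which
  turns surjective pairing on the target into a factorisation of \<open>f\<close>.\<close>

lemma det_pair_eq:
  assumes "det f" "Cod C f = X \<odot> Y" "X \<in> Ob C" "Y \<in> Ob C"
  shows "f = ((pr1 X Y \<cdot> f) \<otimes> (pr2 X Y \<cdot> f)) \<cdot> copy C (Dom C f)"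
proof -
  have "((pr1 X Y \<cdot> f) \<otimes> (pr2 X Y \<cdot> f)) \<cdot> copy C (Dom C f) = (pr1 X Y \<otimes> pr2 X Y) \<cdot> ((f \<otimes> f) \<cdot> copy C (Dom C f))"
    using assms by simp
  also have "\<dots> = (pr1 X Y \<otimes> pr2 X Y) \<cdot> (copy C (X \<odot> Y) \<cdot> f)"
    using assms by (simp add: det_copy)
  also have "\<dots> = f"
    using assms cmp_reassoc[OF copy_pr[of X Y], of f] by simp
  finally show ?thesis ..
qed

lemma det_pair_ext:
  assumes "det f" "det g" "Cod C f = X \<odot> Y" "Cod C g = X \<odot> Y" "Dom C f = Dom C g" "X \<in> Ob C" "Y \<in> Ob C"
    "pr1 X Y \<cdot> f = pr1 X Y \<cdot> g" "pr2 X Y \<cdot> f = pr2 X Y \<cdot> g"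
  shows "f = g"
  using det_pair_eq[of f X Y] det_pair_eq[of g X Y] assms by simp

end

section \<open>Wires in tensor products of lists\<close>

text \<open>The first occurrence; for an absent element the value is the length of the list.\<close>

primrec index_of :: "'v list \<Rightarrow> 'v \<Rightarrow> nat" where
  "index_of [] z = 0"
| "index_of (w # ws) z = (if w = z then 0 else Suc (index_of ws z))"

lemma index_of_less [simp]: "z \<in> set ws \<Longrightarrow> index_of ws z < length ws"
  by (induction ws) auto

lemma nth_index_of [simp]: "z \<in> set ws \<Longrightarrow> ws ! index_of ws z = z"
  by (induction ws) auto

lemma index_of_nth [simp]: "distinct ws \<Longrightarrow> i < length ws \<Longrightarrow> index_of ws (ws ! i) = i"
  by (metis index_of_less nth_eq_iff_index_eq nth_index_of nth_mem)

lemma index_of_append: "index_of (xs @ ys) z = (if z \<in> set xs then index_of xs z else length xs + index_of ys z)"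
  by (induction xs) auto

context markov_category begin

lemma tens_ob [simp]: "set As \<subseteq> Ob C \<Longrightarrow> tens C As \<in> Ob C"
proof (induction As)
  case (Cons A As)
  thus ?case by (cases As) auto
qed simp

lemma tens_cons_simps [simp]:
  assumes "A \<in> Ob C" "set As \<subseteq> Ob C"
  shows "tens_cons C A As \<in> Ar C" "Dom C (tens_cons C A As) = A \<odot> tens C As"
    "Cod C (tens_cons C A As) = tens C (A # As)" "iso_arrow C (tens_cons C A As)" "det (tens_cons C A As)"
  using assms by (cases As; auto simp: tens_cons_def)+

text \<open>Indexed by position, since lists in the free category may repeat a type. Undoing
  \<open>tens_cons\<close> hides that \<open>tens C [A]\<close> is \<open>A\<close> itself and keeps
  the recursion uniform.\<close>

primrec proj :: "'a list \<Rightarrow> nat \<Rightarrow> 'b" where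
  "proj [] i = undefined"
| "proj (A # As) i = (case i of 0 \<Rightarrow> pr1 A (tens C As) | Suc j \<Rightarrow> proj As j \<cdot> pr2 A (tens C As))
     \<cdot> inv_arrow C (tens_cons C A As)"

declare proj.simps [simp del]

lemma proj_simps [simp]:
  assumes "set As \<subseteq> Ob C" "i < length As"
  shows "proj As i \<in> Ar C" "Dom C (proj As i) = tens C As" "Cod C (proj As i) = As ! i" "det (proj As i)"
proof -
  have "proj As i \<in> Ar C \<and> Dom C (proj As i) = tens C As \<and> Cod C (proj As i) = As ! i \<and> det (proj As i)"
    using assms
  proof (induction As arbitrary: i)
    case (Cons A As)
    show ?case
    proof (cases i)
      case (Suc j)
      thus ?thesis using Cons.prems Cons.IH[of j] by (simp add: proj.simps)
    qed (use Cons in \<open>simp add: proj.simps\<close>)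
  qed simp
  thus "proj As i \<in> Ar C" "Dom C (proj As i) = tens C As" "Cod C (proj As i) = As ! i" "det (proj As i)" by auto
qed

lemma proj_cons [simp]:
  assumes "A \<in> Ob C" "set As \<subseteq> Ob C"
  shows "proj (A # As) 0 \<cdot> tens_cons C A As = pr1 A (tens C As)"
    "i < length As \<Longrightarrow> proj (A # As) (Suc i) \<cdot> tens_cons C A As = proj As i \<cdot> pr2 A (tens C As)"
  using assms by (simp_all add: proj.simps)

lemma proj_cons_reassoc [simp]:
  assumes "A \<in> Ob C" "set As \<subseteq> Ob C" "k \<in> Ar C" "Cod C k = A \<odot> tens C As"
  shows "proj (A # As) 0 \<cdot> (tens_cons C A As \<cdot> k) = pr1 A (tens C As) \<cdot> k"
    "i < length As \<Longrightarrow> proj (A # As) (Suc i) \<cdot> (tens_cons C A As \<cdot> k) = proj As i \<cdot> (pr2 A (tens C As) \<cdot> k)"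
proof -
  show "proj (A # As) 0 \<cdot> (tens_cons C A As \<cdot> k) = pr1 A (tens C As) \<cdot> k"
    by (rule cmp_reassoc[OF proj_cons(1)]) (use assms in auto)
  show "proj (A # As) (Suc i) \<cdot> (tens_cons C A As \<cdot> k) = proj As i \<cdot> (pr2 A (tens C As) \<cdot> k)" if "i < length As"
    by (subst cmp_reassoc[OF proj_cons(2)]) (use assms that in auto)
qed

text \<open>The head is split off by \<open>det_pair_ext\<close>; for the empty list the target is
  terminal. An equation between canonical maps thereby becomes a computation with indices.\<close>

lemma det_ext:
  assumes "det f" "det g" "Cod C f = tens C As" "Cod C g = tens C As" "Dom C f = Dom C g" "set As \<subseteq> Ob C"
    and "\<And>i. i < length As \<Longrightarrow> proj As i \<cdot> f = proj As i \<cdot> g"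
  shows "f = g"
  using assms
proof (induction As arbitrary: f g)
  case Nil
  thus ?case by (intro to_unit_unique) auto
next
  case (Cons A As)
  let ?c = "tens_cons C A As"
  note [simp] = det_ar[OF Cons.prems(1)] det_ar[OF Cons.prems(2)] Cons.prems(1-6)
  have A [simp]: "A \<in> Ob C" and As [simp]: "set As \<subseteq> Ob C" using Cons.prems by auto
  have "inv_arrow C ?c \<cdot> f = inv_arrow C ?c \<cdot> g"
  proof (rule det_pair_ext[of _ _ A "tens C As"])
    have "proj (A # As) 0 \<cdot> f = proj (A # As) 0 \<cdot> g" using Cons.prems(7)[of 0] by simp
    thus "pr1 A (tens C As) \<cdot> (inv_arrow C ?c \<cdot> f) = pr1 A (tens C As) \<cdot> (inv_arrow C ?c \<cdot> g)"
      by (simp add: proj.simps)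
    show "pr2 A (tens C As) \<cdot> (inv_arrow C ?c \<cdot> f) = pr2 A (tens C As) \<cdot> (inv_arrow C ?c \<cdot> g)"
    proof (rule Cons.IH)
      fix i assume i: "i < length As"
      have "proj (A # As) (Suc i) \<cdot> f = proj (A # As) (Suc i) \<cdot> g" using Cons.prems(7)[of "Suc i"] i by simp
      thus "proj As i \<cdot> (pr2 A (tens C As) \<cdot> (inv_arrow C ?c \<cdot> f)) = proj As i \<cdot> (pr2 A (tens C As) \<cdot> (inv_arrow C ?c \<cdot> g))"
        using i by (simp add: proj.simps)
    qed simp_all
  qed simp_all
  thus ?case
    by (intro iso_cancel_left[of "inv_arrow C ?c" f g]) simp_all
qed

lemma tens_append_simps [simp]:
  assumes "set As \<subseteq> Ob C" "set Bs \<subseteq> Ob C"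
  shows "tens_append C As Bs \<in> Ar C" "Dom C (tens_append C As Bs) = tens C As \<odot> tens C Bs"
    "Cod C (tens_append C As Bs) = tens C (As @ Bs)" "iso_arrow C (tens_append C As Bs)" "det (tens_append C As Bs)"
proof -
  have "tens_append C As Bs \<in> Ar C \<and> Dom C (tens_append C As Bs) = tens C As \<odot> tens C Bs \<and>
    Cod C (tens_append C As Bs) = tens C (As @ Bs) \<and> iso_arrow C (tens_append C As Bs) \<and> det (tens_append C As Bs)"
    using assms by (induction As) simp_all
  thus "tens_append C As Bs \<in> Ar C" "Dom C (tens_append C As Bs) = tens C As \<odot> tens C Bs"
    "Cod C (tens_append C As Bs) = tens C (As @ Bs)" "iso_arrow C (tens_append C As Bs)" "det (tens_append C As Bs)"
    by auto
qed

lemma proj_append [simp]: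
  assumes "set As \<subseteq> Ob C" "set Bs \<subseteq> Ob C"
  shows "i < length As \<Longrightarrow> proj (As @ Bs) i \<cdot> tens_append C As Bs = proj As i \<cdot> pr1 (tens C As) (tens C Bs)"
    "i < length Bs \<Longrightarrow>
      proj (As @ Bs) (length As + i) \<cdot> tens_append C As Bs = proj Bs i \<cdot> pr2 (tens C As) (tens C Bs)"
proof -
  show "proj (As @ Bs) i \<cdot> tens_append C As Bs = proj As i \<cdot> pr1 (tens C As) (tens C Bs)" if "i < length As"
    using assms that
  proof (induction As arbitrary: i)
    case (Cons A As)
    note [simp] = tens_cons_simps(1-5)[of A As] tens_cons_simps(1-5)[of A "As @ Bs"]
    have IH: "proj (As @ Bs) j \<cdot> (tens_append C As Bs \<cdot> k) = proj As j \<cdot> (pr1 (tens C As) (tens C Bs) \<cdot> k)"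
      if "j < length As" "k \<in> Ar C" "Cod C k = tens C As \<odot> tens C Bs" for j k
      using Cons that by (subst cmp_reassoc[OF Cons.IH[of j]]) auto
    show ?case
      using Cons.prems by (cases i) (simp_all add: IH, simp_all add: proj.simps)
  qed simp
  show "proj (As @ Bs) (length As + i) \<cdot> tens_append C As Bs = proj Bs i \<cdot> pr2 (tens C As) (tens C Bs)"
    if "i < length Bs"
    using assms that
  proof (induction As)
    case Nil
    thus ?case by (simp add: pr2_def)
  next
    case (Cons A As)
    have IH: "proj (As @ Bs) (length As + i) \<cdot> (tens_append C As Bs \<cdot> k) = proj Bs i \<cdot> (pr2 (tens C As) (tens C Bs) \<cdot> k)"
      if "k \<in> Ar C" "Cod C k = tens C As \<odot> tens C Bs" for k
      using Cons that by (subst cmp_reassoc[OF Cons.IH]) auto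
    show ?case
      using Cons.prems by (simp add: IH)
  qed
qed

lemma proj_append_reassoc [simp]:
  assumes "set As \<subseteq> Ob C" "set Bs \<subseteq> Ob C" "k \<in> Ar C" "Cod C k = tens C As \<odot> tens C Bs"
  shows "i < length As \<Longrightarrow>
      proj (As @ Bs) i \<cdot> (tens_append C As Bs \<cdot> k) = proj As i \<cdot> (pr1 (tens C As) (tens C Bs) \<cdot> k)"
    "i < length Bs \<Longrightarrow>
      proj (As @ Bs) (length As + i) \<cdot> (tens_append C As Bs \<cdot> k) = proj Bs i \<cdot> (pr2 (tens C As) (tens C Bs) \<cdot> k)"
proof -
  show "proj (As @ Bs) i \<cdot> (tens_append C As Bs \<cdot> k) = proj As i \<cdot> (pr1 (tens C As) (tens C Bs) \<cdot> k)" if "i < length As"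
    by (subst cmp_reassoc[OF proj_append(1)]) (use assms that in auto)
  show "proj (As @ Bs) (length As + i) \<cdot> (tens_append C As Bs \<cdot> k) = proj Bs i \<cdot> (pr2 (tens C As) (tens C Bs) \<cdot> k)"
    if "i < length Bs"
    by (subst cmp_reassoc[OF proj_append(2)]) (use assms that in auto)
qed

lemma proj_append_inv:
  assumes "set As \<subseteq> Ob C" "set Bs \<subseteq> Ob C"
  shows "i < length As \<Longrightarrow>
      proj As i \<cdot> (pr1 (tens C As) (tens C Bs) \<cdot> inv_arrow C (tens_append C As Bs)) = proj (As @ Bs) i"
    "i < length Bs \<Longrightarrow>
      proj Bs i \<cdot> (pr2 (tens C As) (tens C Bs) \<cdot> inv_arrow C (tens_append C As Bs)) = proj (As @ Bs) (length As + i)"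
proof -
  let ?a = "tens_append C As Bs"
  show "proj As i \<cdot> (pr1 (tens C As) (tens C Bs) \<cdot> inv_arrow C ?a) = proj (As @ Bs) i" if "i < length As"
    using proj_append_reassoc(1)[of As Bs "inv_arrow C ?a" i] assms that by simp
  show "proj Bs i \<cdot> (pr2 (tens C As) (tens C Bs) \<cdot> inv_arrow C ?a) = proj (As @ Bs) (length As + i)"
    if "i < length Bs"
    using proj_append_reassoc(2)[of As Bs "inv_arrow C ?a" i] assms that by simp
qed

lemma proj_single: "A \<in> Ob C \<Longrightarrow> proj [A] 0 = Idn C A"
  by (simp add: proj.simps tens_cons_def pr1_def)

lemma tens_append_Nil2:
  assumes A: "set As \<subseteq> Ob C" shows "tens_append C As [] = runit C (tens C As)"
proof -
  note [simp del] = tens_append.simps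
  have ta: "tens_append C As [] \<in> Ar C" "Dom C (tens_append C As []) = tens C As \<odot> Unt C"
    "Cod C (tens_append C As []) = tens C As" "det (tens_append C As [])"
    using tens_append_simps[of As "[]"] A by simp_all
  show ?thesis
  proof (rule det_ext[of _ _ As])
    fix i assume "i < length As"
    thus "proj As i \<cdot> tens_append C As [] = proj As i \<cdot> runit C (tens C As)"
      using proj_append(1)[of As "[]" i] A by (simp add: pr1_def ta)
  qed (use A ta in simp_all)
qed

lemma tens_append_single:
  assumes "A \<in> Ob C" "set As \<subseteq> Ob C"
  shows "tens_append C [A] As = tens_cons C A As"
proof (rule det_ext[of _ _ "A # As"])
  fix i assume "i < length (A # As)"
  thus "proj (A # As) i \<cdot> tens_append C [A] As = proj (A # As) i \<cdot> tens_cons C A As"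
    using assms proj_append[of "[A]" As] by (cases i) (auto simp: proj_single simp del: tens_append.simps)
qed (use assms in \<open>auto simp del: tens_append.simps\<close>)

text \<open>All maps involved are deterministic, so this coherence equation is a check on three
  ranges of positions.\<close>

lemma tens_append_assoc:
  assumes [simp]: "set As \<subseteq> Ob C" "set Bs \<subseteq> Ob C" "set Cs \<subseteq> Ob C"
  shows "tens_append C (As @ Bs) Cs \<cdot> (tens_append C As Bs \<otimes> Idn C (tens C Cs))
    = tens_append C As (Bs @ Cs) \<cdot> (Idn C (tens C As) \<otimes> tens_append C Bs Cs)
      \<cdot> assoc C (tens C As) (tens C Bs) (tens C Cs)"
proof (rule det_ext[of _ _ "As @ Bs @ Cs"])
  fix i assume i: "i < length (As @ Bs @ Cs)"
  consider (1) "i < length As" | (2) j where "i = length As + j" "j < length Bs"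
    | (3) j where "i = length As + (length Bs + j)" "j < length Cs"
    using i by (cases "i < length As"; cases "i < length As + length Bs")
      (auto, metis add_diff_inverse_nat add_less_cancel_left, metis add.assoc add_diff_inverse_nat add_less_cancel_left)
  thus "proj (As @ Bs @ Cs) i \<cdot> (tens_append C (As @ Bs) Cs \<cdot> (tens_append C As Bs \<otimes> Idn C (tens C Cs)))
    = proj (As @ Bs @ Cs) i \<cdot> (tens_append C As (Bs @ Cs) \<cdot> (Idn C (tens C As) \<otimes> tens_append C Bs Cs)
      \<cdot> assoc C (tens C As) (tens C Bs) (tens C Cs))"
  proof cases
    case 1
    thus ?thesis using proj_append_reassoc(1)[of "As @ Bs" Cs "tens_append C As Bs \<otimes> Idn C (tens C Cs)" i] by simp
  next
    case 2
    thus ?thesis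
      using proj_append_reassoc(1)[of "As @ Bs" Cs "tens_append C As Bs \<otimes> Idn C (tens C Cs)" i] by simp
  next
    case 3
    thus ?thesis
      using proj_append_reassoc(2)[of "As @ Bs" Cs "tens_append C As Bs \<otimes> Idn C (tens C Cs)" j] by (simp add: add.assoc)
  qed
qed simp_all

subsection \<open>Selecting wires\<close>

text \<open>The link between wires addressed by name and by position: a repeated name refers to its
  first occurrence.\<close>

lemma wire_proj_eq:
  assumes "z \<in> set ws" "ob ` set ws \<subseteq> Ob C"
  shows "wire_proj C ob ws z = proj (map ob ws) (index_of ws z)"
  using assms
proof (induction ws)
  case (Cons w ws)
  \<comment> \<open>For a later wire, \<open>wire_proj\<close> discards the head within one tensor
    product; splitting that product exposes \<open>pr2\<close>.\<close>
  have pr2: "lunit C (ob z) \<cdot> (disc C (ob w) \<otimes> p) = p \<cdot> pr2 (ob w) (Dom C p)"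
    if "p \<in> Ar C" "Cod C p = ob z" for p
  proof -
    have "lunit C (ob z) \<cdot> (disc C (ob w) \<otimes> p)
      = lunit C (ob z) \<cdot> ((Idn C (Unt C) \<otimes> p) \<cdot> (disc C (ob w) \<otimes> Idn C (Dom C p)))"
      using that Cons.prems by simp
    also have "\<dots> = p \<cdot> pr2 (ob w) (Dom C p)"
      using that Cons.prems by (simp add: pr2_def natural_reassoc del: tensor_cmp_simp)
    finally show ?thesis .
  qed
  show ?case
  proof (cases "w = z")
    case False
    hence z: "z \<in> set ws" using Cons.prems by auto
    have "wire_proj C ob (w # ws) z
      = (lunit C (ob z) \<cdot> (disc C (ob w) \<otimes> proj (map ob ws) (index_of ws z))) \<cdot> inv_arrow C (tens_cons C (ob w) (map ob ws))"
      using False Cons.IH[OF z] Cons.prems by simp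
    also have "\<dots> = (proj (map ob ws) (index_of ws z) \<cdot> pr2 (ob w) (tens C (map ob ws))) \<cdot> inv_arrow C (tens_cons C (ob w) (map ob ws))"
      using Cons.prems z by (subst pr2) auto
    also have "\<dots> = proj (map ob (w # ws)) (index_of (w # ws) z)"
      using False by (simp add: proj.simps)
    finally show ?thesis .
  qed (use Cons.prems in \<open>simp add: proj.simps pr1_def\<close>)
qed simp

lemma wire_proj_simps [simp]:
  assumes "z \<in> set ws" "ob ` set ws \<subseteq> Ob C"
  shows "wire_proj C ob ws z \<in> Ar C" "Dom C (wire_proj C ob ws z) = tens C (map ob ws)"
    "Cod C (wire_proj C ob ws z) = ob z" "det (wire_proj C ob ws z)"
  using assms by (simp_all add: wire_proj_eq)

declare wire_proj.simps [simp del]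

lemma wire_proj_cons [simp]:
  assumes "ob w \<in> Ob C" "ob ` set ws \<subseteq> Ob C"
  shows "w = z \<Longrightarrow> wire_proj C ob (w # ws) z \<cdot> tens_cons C (ob w) (map ob ws) = pr1 (ob w) (tens C (map ob ws))"
    "w \<noteq> z \<Longrightarrow> z \<in> set ws \<Longrightarrow> wire_proj C ob (w # ws) z \<cdot> tens_cons C (ob w) (map ob ws)
      = wire_proj C ob ws z \<cdot> pr2 (ob w) (tens C (map ob ws))"
  using assms by (simp_all add: wire_proj_eq)

lemma wire_proj_cons_reassoc [simp]:
  assumes "ob w \<in> Ob C" "ob ` set ws \<subseteq> Ob C" "k \<in> Ar C" "Cod C k = ob w \<odot> tens C (map ob ws)"
  shows "w = z \<Longrightarrow> wire_proj C ob (w # ws) z \<cdot> (tens_cons C (ob w) (map ob ws) \<cdot> k) = pr1 (ob w) (tens C (map ob ws)) \<cdot> k"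
    "w \<noteq> z \<Longrightarrow> z \<in> set ws \<Longrightarrow> wire_proj C ob (w # ws) z \<cdot> (tens_cons C (ob w) (map ob ws) \<cdot> k)
      = wire_proj C ob ws z \<cdot> (pr2 (ob w) (tens C (map ob ws)) \<cdot> k)"
  using assms by (simp_all add: wire_proj_eq)

lemma wire_select_simps [simp]:
  assumes "set zs \<subseteq> set ws" "ob ` set ws \<subseteq> Ob C"
  shows "wire_select C ob ws zs \<in> Ar C" "Dom C (wire_select C ob ws zs) = tens C (map ob ws)"
    "Cod C (wire_select C ob ws zs) = tens C (map ob zs)" "det (wire_select C ob ws zs)"
proof -
  have "wire_select C ob ws zs \<in> Ar C \<and> Dom C (wire_select C ob ws zs) = tens C (map ob ws) \<and>
    Cod C (wire_select C ob ws zs) = tens C (map ob zs) \<and> det (wire_select C ob ws zs)"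
    using assms
  proof (induction zs)
    case (Cons z zs)
    moreover have "ob z \<in> Ob C" "ob ` set zs \<subseteq> Ob C" using Cons.prems by auto
    ultimately show ?case by simp
  qed simp
  thus "wire_select C ob ws zs \<in> Ar C" "Dom C (wire_select C ob ws zs) = tens C (map ob ws)"
    "Cod C (wire_select C ob ws zs) = tens C (map ob zs)" "det (wire_select C ob ws zs)" by auto
qed

lemma proj_select:
  assumes "set zs \<subseteq> set ws" "ob ` set ws \<subseteq> Ob C" "i < length zs"
  shows "proj (map ob zs) i \<cdot> wire_select C ob ws zs = wire_proj C ob ws (zs ! i)"
  using assms
proof (induction zs arbitrary: i)
  case (Cons z zs)
  moreover have "ob z \<in> Ob C" "ob ` set zs \<subseteq> Ob C" using Cons.prems by auto
  ultimately show ?case by (cases i) auto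
qed simp

lemma wire_proj_select [simp]:
  assumes "set zs \<subseteq> set ws" "ob ` set ws \<subseteq> Ob C" "z \<in> set zs"
  shows "wire_proj C ob zs z \<cdot> wire_select C ob ws zs = wire_proj C ob ws z"
proof -
  have "ob ` set zs \<subseteq> Ob C" using assms by auto
  thus ?thesis using assms by (simp add: wire_proj_eq[of z zs] proj_select)
qed

lemma wire_proj_select_reassoc [simp]:
  assumes "set zs \<subseteq> set ws" "ob ` set ws \<subseteq> Ob C" "z \<in> set zs" "k \<in> Ar C" "Cod C k = tens C (map ob ws)"
  shows "wire_proj C ob zs z \<cdot> (wire_select C ob ws zs \<cdot> k) = wire_proj C ob ws z \<cdot> k"
proof -
  have "ob ` set zs \<subseteq> Ob C" using assms by auto
  thus ?thesis using assms by (subst cmp_reassoc[OF wire_proj_select]) auto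
qed

text \<open>The means to recognise a composite as a wire selection by its projections alone, with no
  unfolding of the recursion of \<open>wire_select\<close>.\<close>

lemma select_eqI:
  assumes "det h" "Dom C h = tens C (map ob ws)" "Cod C h = tens C (map ob zs)"
    "set zs \<subseteq> set ws" "ob ` set ws \<subseteq> Ob C"
    "\<And>i. i < length zs \<Longrightarrow> proj (map ob zs) i \<cdot> h = wire_proj C ob ws (zs ! i)"
  shows "h = wire_select C ob ws zs"
proof (rule det_ext[of _ _ "map ob zs"])
  show "set (map ob zs) \<subseteq> Ob C" using assms by auto
qed (use assms in \<open>auto simp: proj_select\<close>)

text \<open>\<open>wire_proj\<close> reaches only first occurrences, so names test every position
  exactly when the list is distinct.\<close>

lemma det_ext_wire:
  assumes "det f" "det g" "Cod C f = tens C (map ob zs)" "Cod C g = tens C (map ob zs)" "Dom C f = Dom C g"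
    "ob ` set zs \<subseteq> Ob C" "distinct zs"
    and "\<And>z. z \<in> set zs \<Longrightarrow> wire_proj C ob zs z \<cdot> f = wire_proj C ob zs z \<cdot> g"
  shows "f = g"
proof (rule det_ext[of _ _ "map ob zs"])
  fix i assume i: "i < length (map ob zs)"
  thus "proj (map ob zs) i \<cdot> f = proj (map ob zs) i \<cdot> g"
    using assms(8)[of "zs ! i"] assms(6,7) by (simp add: wire_proj_eq)
qed (use assms in auto)

lemma select_select [simp]:
  assumes "set zs \<subseteq> set ys" "set ys \<subseteq> set ws" "ob ` set ws \<subseteq> Ob C"
  shows "wire_select C ob ys zs \<cdot> wire_select C ob ws ys = wire_select C ob ws zs"
proof (rule select_eqI)
  have ys: "ob ` set ys \<subseteq> Ob C" and zs: "ob ` set zs \<subseteq> Ob C" using assms by auto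
  fix i assume i: "i < length zs"
  hence z: "zs ! i \<in> set ys" using assms by auto
  have "proj (map ob zs) i \<cdot> (wire_select C ob ys zs \<cdot> wire_select C ob ws ys)
    = wire_proj C ob ys (zs ! i) \<cdot> wire_select C ob ws ys"
    using assms i ys zs by (subst cmp_reassoc[OF proj_select]) auto
  thus "proj (map ob zs) i \<cdot> (wire_select C ob ys zs \<cdot> wire_select C ob ws ys) = wire_proj C ob ws (zs ! i)"
    using z assms by simp
next
  have ys: "ob ` set ys \<subseteq> Ob C" using assms by auto
  show "det (wire_select C ob ys zs \<cdot> wire_select C ob ws ys)"
    "Dom C (wire_select C ob ys zs \<cdot> wire_select C ob ws ys) = tens C (map ob ws)"
    "Cod C (wire_select C ob ys zs \<cdot> wire_select C ob ws ys) = tens C (map ob zs)"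
    using assms ys by auto
qed (use assms in auto)

lemma select_id [simp]:
  assumes "ob ` set ws \<subseteq> Ob C" "distinct ws"
  shows "wire_select C ob ws ws = Idn C (tens C (map ob ws))"
  by (rule select_eqI[symmetric]) (use assms in \<open>auto simp: wire_proj_eq\<close>)

lemma select_iso:
  assumes "ob ` set ws \<subseteq> Ob C" "distinct ws" "distinct zs" "set zs = set ws"
  shows "iso_arrow C (wire_select C ob ws zs)"
  unfolding iso_arrow_def
  by (rule exI[of _ "wire_select C ob zs ws"]) (use assms in \<open>simp add: inverse_arrows_def hom_def\<close>)

end

section \<open>The free Markov category\<close>

lemma well_typed_lists [simp]:
  assumes "well_typed Q f" shows "dsrc Q f \<in> lists (types Q)" "dtgt Q f \<in> lists (types Q)"
  using assms by (induction f) auto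

lemma deq_typed:
  assumes "deq Q f g"
  shows "well_typed Q f \<and> well_typed Q g \<and> dsrc Q f = dsrc Q g \<and> dtgt Q f = dtgt Q g"
  using assms by (induction rule: deq.induct) (auto dest: well_typed_lists)

lemma dclass_eqI: "deq Q f g \<Longrightarrow> dclass Q f = dclass Q g"
  unfolding dclass_def by (auto intro: deq.sym deq.trans)

lemma drep_dclass: "well_typed Q f \<Longrightarrow> deq Q f (drep (dclass Q f))"
  unfolding drep_def dclass_def by (auto intro: someI deq.refl)

lemma dclass_eq_iff: "well_typed Q g \<Longrightarrow> dclass Q f = dclass Q g \<longleftrightarrow> deq Q f g"
  using dclass_eqI[of Q f g] deq.refl[of Q g] by (auto simp: dclass_def)

lemma free_fields [simp]:
  "Ob (free_markov Q) = lists (types Q)" "Ar (free_markov Q) = dclass Q ` {f. well_typed Q f}"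
  "Unt (free_markov Q) = []" "TOb (free_markov Q) = (@)"
  "Idn (free_markov Q) \<Gamma> = dclass Q (DId \<Gamma>)"
  "symm (free_markov Q) \<Gamma> \<Delta> = dclass Q (DSwap \<Gamma> \<Delta>)"
  "copy (free_markov Q) \<Gamma> = dclass Q (DCopy \<Gamma>)"
  "disc (free_markov Q) \<Gamma> = dclass Q (DDisc \<Gamma>)"
  "assoc (free_markov Q) \<Gamma> \<Delta> \<Theta> = dclass Q (DId (\<Gamma> @ \<Delta> @ \<Theta>))"
  "lunit (free_markov Q) \<Gamma> = dclass Q (DId \<Gamma>)"
  "runit (free_markov Q) \<Gamma> = dclass Q (DId \<Gamma>)"
  by (auto simp: free_markov_def)

lemma free_dom_cod [simp]:
  assumes "well_typed Q f"
  shows "Dom (free_markov Q) (dclass Q f) = dsrc Q f" "Cod (free_markov Q) (dclass Q f) = dtgt Q f"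
  using deq_typed[OF drep_dclass[OF assms]] by (auto simp: free_markov_def)

text \<open>Composition is defined on representatives chosen by \<open>drep\<close>; the congruence
  rules make the choice immaterial, so that later work happens at the level of
  \<open>dclass\<close>.\<close>

lemma free_cmp [simp]:
  assumes "well_typed Q (DCmp g f)"
  shows "Cmp (free_markov Q) (dclass Q g) (dclass Q f) = dclass Q (DCmp g f)"
proof -
  have "deq Q (DCmp g f) (DCmp (drep (dclass Q g)) (drep (dclass Q f)))"
    using assms by (auto intro: deq.cong_cmp drep_dclass)
  thus ?thesis by (simp add: free_markov_def dclass_eqI)
qed

lemma free_tensor [simp]:
  assumes "well_typed Q f" "well_typed Q g"
  shows "TAr (free_markov Q) (dclass Q f) (dclass Q g) = dclass Q (DPar f g)"
proof -
  have "deq Q (DPar f g) (DPar (drep (dclass Q f)) (drep (dclass Q g)))"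
    using assms by (auto intro: deq.cong_par drep_dclass)
  thus ?thesis by (simp add: free_markov_def dclass_eqI)
qed

lemma free_hom_iff:
  "K \<in> hom (free_markov Q) \<Gamma> \<Delta> \<longleftrightarrow> (\<exists>f. well_typed Q f \<and> dsrc Q f = \<Gamma> \<and> dtgt Q f = \<Delta> \<and> K = dclass Q f)"
  by (auto simp: hom_def)

lemma free_homE:
  assumes "K \<in> hom (free_markov Q) \<Gamma> \<Delta>"
  obtains f where "well_typed Q f" "dsrc Q f = \<Gamma>" "dtgt Q f = \<Delta>" "K = dclass Q f"
  using assms by (auto simp: free_hom_iff)

lemma free_homI:
  "well_typed Q f \<Longrightarrow> dsrc Q f = \<Gamma> \<Longrightarrow> dtgt Q f = \<Delta> \<Longrightarrow> dclass Q f \<in> hom (free_markov Q) \<Gamma> \<Delta>"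
  by (auto simp: free_hom_iff)

lemma category_free: "category (free_markov Q)"
proof
  fix f assume "f \<in> Ar (free_markov Q)"
  then obtain d where "well_typed Q d" "f = dclass Q d" by auto
  thus "Dom (free_markov Q) f \<in> Ob (free_markov Q)" "Cod (free_markov Q) f \<in> Ob (free_markov Q)"
    by simp_all
next
  fix X assume "X \<in> Ob (free_markov Q)"
  thus "Idn (free_markov Q) X \<in> hom (free_markov Q) X X" by (auto intro!: free_homI)
next
  fix f X Y g Z assume "f \<in> hom (free_markov Q) X Y" "g \<in> hom (free_markov Q) Y Z"
  thus "g \<cdot>\<^bsub>free_markov Q\<^esub> f \<in> hom (free_markov Q) X Z"
    by (auto elim!: free_homE intro!: free_homI)
next
  fix f X Y assume "f \<in> hom (free_markov Q) X Y"
  then obtain f' where f: "well_typed Q f'" "dsrc Q f' = X" "dtgt Q f' = Y" "f = dclass Q f'"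
    by (rule free_homE)
  thus "f \<cdot>\<^bsub>free_markov Q\<^esub> Idn (free_markov Q) X = f" "Idn (free_markov Q) Y \<cdot>\<^bsub>free_markov Q\<^esub> f = f"
    using well_typed_lists[OF f(1)] f dclass_eqI[OF deq.id_right[OF f(1)]] dclass_eqI[OF deq.id_left[OF f(1)]]
    by simp_all
next
  fix f W X g Y h Z
  assume "f \<in> hom (free_markov Q) W X" "g \<in> hom (free_markov Q) X Y" "h \<in> hom (free_markov Q) Y Z"
  thus "(h \<cdot>\<^bsub>free_markov Q\<^esub> g) \<cdot>\<^bsub>free_markov Q\<^esub> f = h \<cdot>\<^bsub>free_markov Q\<^esub> g \<cdot>\<^bsub>free_markov Q\<^esub> f"
    by (elim free_homE) (clarsimp simp: dclass_eqI[OF deq.cmp_assoc])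
qed

lemma free_id_cmp [simp]:
  assumes "well_typed Q f"
  shows "dtgt Q f = \<Gamma> \<Longrightarrow> dclass Q (DCmp (DId \<Gamma>) f) = dclass Q f"
    "dsrc Q f = \<Gamma> \<Longrightarrow> dclass Q (DCmp f (DId \<Gamma>)) = dclass Q f"
  using assms by (auto intro!: dclass_eqI intro: deq.id_left deq.id_right)

lemma free_par_id [simp]:
  "\<Gamma> \<in> lists (types Q) \<Longrightarrow> \<Delta> \<in> lists (types Q) \<Longrightarrow> dclass Q (DPar (DId \<Gamma>) (DId \<Delta>)) = dclass Q (DId (\<Gamma> @ \<Delta>))"
  by (rule dclass_eqI[OF deq.par_id])

lemma symmetric_monoidal_category_free: "symmetric_monoidal_category (free_markov Q)"
proof -
  let ?F = "free_markov Q"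
  interpret category ?F by (rule category_free)
  have iso: "iso_arrow ?F (dclass Q (DId \<Gamma>))" if "\<Gamma> \<in> lists (types Q)" for \<Gamma>
    using iso_id[of \<Gamma>] that by simp
  have F: "dclass Q (DId \<Gamma>) \<in> hom ?F \<Delta> \<Theta>" if "\<Gamma> \<in> lists (types Q)" "\<Gamma> = \<Delta>" "\<Gamma> = \<Theta>" for \<Gamma> \<Delta> \<Theta>
    using that by (auto intro: free_homI)
  show ?thesis
  proof
    fix f X Y g X' Y' assume "f \<in> hom ?F X Y" "g \<in> hom ?F X' Y'"
    thus "f \<otimes>\<^bsub>?F\<^esub> g \<in> hom ?F (X \<odot>\<^bsub>?F\<^esub> X') (Y \<odot>\<^bsub>?F\<^esub> Y')"
      by (auto elim!: free_homE intro!: free_homI)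
  next
    fix f X Y g Z f' X' Y' g' Z'
    assume "f \<in> hom ?F X Y" "g \<in> hom ?F Y Z" "f' \<in> hom ?F X' Y'" "g' \<in> hom ?F Y' Z'"
    thus "(g \<cdot>\<^bsub>?F\<^esub> f) \<otimes>\<^bsub>?F\<^esub> (g' \<cdot>\<^bsub>?F\<^esub> f') = (g \<otimes>\<^bsub>?F\<^esub> g') \<cdot>\<^bsub>?F\<^esub> (f \<otimes>\<^bsub>?F\<^esub> f')"
      by (elim free_homE) (clarsimp simp: dclass_eqI[OF deq.par_cmp])
  next
    fix f X X' g Y Y' h Z Z'
    assume "f \<in> hom ?F X X'" "g \<in> hom ?F Y Y'" "h \<in> hom ?F Z Z'"
    thus "assoc ?F X' Y' Z' \<cdot>\<^bsub>?F\<^esub> ((f \<otimes>\<^bsub>?F\<^esub> g) \<otimes>\<^bsub>?F\<^esub> h) = (f \<otimes>\<^bsub>?F\<^esub> (g \<otimes>\<^bsub>?F\<^esub> h)) \<cdot>\<^bsub>?F\<^esub> assoc ?F X Y Z"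
      by (elim free_homE) (clarsimp simp: dclass_eqI[OF deq.par_assoc])
  next
    fix f X Y assume "f \<in> hom ?F X Y"
    thus "lunit ?F Y \<cdot>\<^bsub>?F\<^esub> (Idn ?F (Unt ?F) \<otimes>\<^bsub>?F\<^esub> f) = f \<cdot>\<^bsub>?F\<^esub> lunit ?F X"
      "runit ?F Y \<cdot>\<^bsub>?F\<^esub> (f \<otimes>\<^bsub>?F\<^esub> Idn ?F (Unt ?F)) = f \<cdot>\<^bsub>?F\<^esub> runit ?F X"
      by (elim free_homE; clarsimp simp: dclass_eqI[OF deq.par_unit_left] dclass_eqI[OF deq.par_unit_right])+
  next
    fix X Y assume "X \<in> Ob ?F" "Y \<in> Ob ?F"
    thus "symm ?F X Y \<in> hom ?F (X \<odot>\<^bsub>?F\<^esub> Y) (Y \<odot>\<^bsub>?F\<^esub> X)"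
      by (auto intro!: free_homI)
  next
    fix f X X' g Y Y' assume "f \<in> hom ?F X X'" "g \<in> hom ?F Y Y'"
    thus "symm ?F X' Y' \<cdot>\<^bsub>?F\<^esub> (f \<otimes>\<^bsub>?F\<^esub> g) = (g \<otimes>\<^bsub>?F\<^esub> f) \<cdot>\<^bsub>?F\<^esub> symm ?F X Y"
      by (elim free_homE) (clarsimp simp: dclass_eqI[OF deq.swap_natural])
  next
    fix X Y assume "X \<in> Ob ?F" "Y \<in> Ob ?F"
    thus "symm ?F Y X \<cdot>\<^bsub>?F\<^esub> symm ?F X Y = Idn ?F (X \<odot>\<^bsub>?F\<^esub> Y)"
      by (simp add: dclass_eqI[OF deq.swap_swap])
  next
    fix X Y Z assume "X \<in> Ob ?F" "Y \<in> Ob ?F" "Z \<in> Ob ?F"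
    thus "assoc ?F Y Z X \<cdot>\<^bsub>?F\<^esub> symm ?F X (Y \<odot>\<^bsub>?F\<^esub> Z) \<cdot>\<^bsub>?F\<^esub> assoc ?F X Y Z
              = (Idn ?F Y \<otimes>\<^bsub>?F\<^esub> symm ?F X Z) \<cdot>\<^bsub>?F\<^esub> assoc ?F Y X Z \<cdot>\<^bsub>?F\<^esub> (symm ?F X Y \<otimes>\<^bsub>?F\<^esub> Idn ?F Z)"
      by (simp add: dclass_eqI[OF deq.swap_append])
  qed (auto intro!: F iso)
qed

lemma markov_category_free: "markov_category (free_markov Q)"
proof -
  let ?F = "free_markov Q"
  interpret symmetric_monoidal_category ?F by (rule symmetric_monoidal_category_free)
  show ?thesis
  proof
    fix X assume "X \<in> Ob ?F"
    thus "disc ?F X \<in> hom ?F X (Unt ?F)" "copy ?F X \<in> hom ?F X (X \<odot>\<^bsub>?F\<^esub> X)"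
      by (auto intro!: free_homI)
  next
    fix f X assume "f \<in> hom ?F X (Unt ?F)"
    thus "f = disc ?F X"
      by (elim free_homE) (clarsimp simp: dclass_eqI[OF deq.disc_terminal])
  next
    fix X assume "X \<in> Ob ?F"
    thus "assoc ?F X X X \<cdot>\<^bsub>?F\<^esub> (copy ?F X \<otimes>\<^bsub>?F\<^esub> Idn ?F X) \<cdot>\<^bsub>?F\<^esub> copy ?F X
        = (Idn ?F X \<otimes>\<^bsub>?F\<^esub> copy ?F X) \<cdot>\<^bsub>?F\<^esub> copy ?F X"
      "lunit ?F X \<cdot>\<^bsub>?F\<^esub> (disc ?F X \<otimes>\<^bsub>?F\<^esub> Idn ?F X) \<cdot>\<^bsub>?F\<^esub> copy ?F X = Idn ?F X"
      "runit ?F X \<cdot>\<^bsub>?F\<^esub> (Idn ?F X \<otimes>\<^bsub>?F\<^esub> disc ?F X) \<cdot>\<^bsub>?F\<^esub> copy ?F X = Idn ?F X"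
      "symm ?F X X \<cdot>\<^bsub>?F\<^esub> copy ?F X = copy ?F X"
      by (simp_all add: dclass_eqI[OF deq.copy_assoc] dclass_eqI[OF deq.copy_counit_left] dclass_eqI[OF deq.copy_counit_right] dclass_eqI[OF deq.copy_comm])
  next
    fix X Y assume XY: "X \<in> Ob ?F" "Y \<in> Ob ?F"
    have inv: "inv_arrow ?F (dclass Q (DId \<Gamma>)) = dclass Q (DId \<Gamma>)" if "\<Gamma> \<in> lists (types Q)" for \<Gamma>
      using inv_id[of \<Gamma>] that by simp
    have "interchange ?F X X Y Y = dclass Q (DPar (DId X) (DPar (DSwap X Y) (DId Y)))"
      using XY by (simp add: interchange_def Let_def inv)
    thus "copy ?F (X \<odot>\<^bsub>?F\<^esub> Y) = interchange ?F X X Y Y \<cdot>\<^bsub>?F\<^esub> (copy ?F X \<otimes>\<^bsub>?F\<^esub> copy ?F Y)"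
      using XY by (simp add: dclass_eqI[OF deq.copy_append])
  qed
qed

subsection \<open>Tracing output wires back to input wires\<close>

text \<open>\<open>None\<close> means that the wire comes out of a query.  Values at indices that are no outputs are junk.\<close>

primrec trace :: "('t, 'q) signature \<Rightarrow> ('t, 'q) diagram \<Rightarrow> nat \<Rightarrow> nat option" where
  "trace Q (DId \<Gamma>) i = Some i"
| "trace Q (DGen q) i = None"
| "trace Q (DCmp g f) i = Option.bind (trace Q g i) (trace Q f)"
| "trace Q (DPar f g) i =
     (if i < length (dtgt Q f) then trace Q f i
      else map_option (\<lambda>k. length (dsrc Q f) + k) (trace Q g (i - length (dtgt Q f))))"
| "trace Q (DSwap \<Gamma> \<Delta>) i = (if i < length \<Delta> then Some (length \<Gamma> + i) else Some (i - length \<Delta>))"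
| "trace Q (DCopy \<Gamma>) i = (if i < length \<Gamma> then Some i else Some (i - length \<Gamma>))"
| "trace Q (DDisc \<Gamma>) i = None"

lemma trace_typed:
  assumes "well_typed Q f" "i < length (dtgt Q f)" "trace Q f i = Some k"
  shows "k < length (dsrc Q f) \<and> dsrc Q f ! k = dtgt Q f ! i"
  using assms
proof (induction f arbitrary: i k)
  case (DCmp g f)
  then obtain j where j: "trace Q g i = Some j" "trace Q f j = Some k" by (auto simp: bind_eq_Some_conv)
  thus ?case using DCmp.IH(1)[of i j] DCmp.IH(2)[of j k] DCmp.prems by auto
next
  case (DPar f g)
  show ?case
  proof (cases "i < length (dtgt Q f)")
    case True
    thus ?thesis using DPar.IH(1)[of i k] DPar.prems by (auto simp: nth_append)
  next
    case False
    then obtain k' where "trace Q g (i - length (dtgt Q f)) = Some k'" "k = length (dsrc Q f) + k'"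
      using DPar.prems by auto
    thus ?thesis using False DPar.IH(2)[of "i - length (dtgt Q f)" k'] DPar.prems by (auto simp: nth_append)
  qed
qed (auto simp: nth_append split: if_splits)

text \<open>Every equation rewires without changing where a genuine output comes from. Beyond the
  outputs the values are junk, so \<open>trace_typed\<close> has to keep intermediate indices in
  range.\<close>

lemma trace_deq:
  assumes "deq Q f g" "i < length (dtgt Q f)"
  shows "trace Q f i = trace Q g i"
  using assms
proof (induction arbitrary: i rule: deq.induct)
  case (sym f g)
  thus ?case using deq_typed[of Q f g] by auto
next
  case (trans f g h)
  thus ?case using deq_typed[of Q f g] by auto
next
  case (cong_cmp f f' g g')
  thus ?case using deq_typed[OF cong_cmp(1)] deq_typed[OF cong_cmp(2)]
    by (cases "trace Q g i") (auto dest: trace_typed)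
next
  case (cong_par f f' g g')
  thus ?case using deq_typed[OF cong_par(1)] deq_typed[OF cong_par(2)] by auto
next
  case (cmp_assoc h g f)
  show ?case by (simp add: bind_assoc) (rule Option.bind_cong; simp)
next
  case (id_right f)
  thus ?case by (cases "trace Q f i") auto
next
  case (par_cmp g f g' f')
  thus ?case
    by (auto simp: map_option_bind bind_map_option comp_def option.map_comp dest: trace_typed intro!: Option.bind_cong
      split: if_splits)
next
  case (par_assoc f g h)
  thus ?case by (auto simp: option.map_comp comp_def add.assoc diff_diff_left intro!: option.map_cong)
next
  case (par_unit_left f)
  thus ?case by (simp add: option.map_ident_strong)
next
  case (swap_natural f g)
  have "trace Q g i \<noteq> None \<Longrightarrow> i < length (dtgt Q g) \<Longrightarrow> the (trace Q g i) < length (dsrc Q g)"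
    using trace_typed[of Q g i] swap_natural by auto
  moreover have "i - length (dtgt Q g) < length (dtgt Q f) \<Longrightarrow> trace Q f (i - length (dtgt Q g)) \<noteq> None \<Longrightarrow>
      the (trace Q f (i - length (dtgt Q g))) < length (dsrc Q f)"
    using trace_typed[of Q f "i - length (dtgt Q g)"] swap_natural by auto
  ultimately show ?case using swap_natural
    by (cases "trace Q g i"; cases "trace Q f (i - length (dtgt Q g))") auto
qed auto

subsection \<open>Interpretation of diagrams\<close>

text \<open>Only the condition \<open>generators d = {}\<close> matters: it says that
  \<open>d\<close> is built from identities, swaps, copies and discards.\<close>

primrec generators :: "('t, 'q) diagram \<Rightarrow> 'q set" where
  "generators (DId \<Gamma>) = {}"
| "generators (DGen q) = {q}"
| "generators (DCmp g f) = generators g \<union> generators f"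
| "generators (DPar f g) = generators f \<union> generators g"
| "generators (DSwap \<Gamma> \<Delta>) = {}"
| "generators (DCopy \<Gamma>) = {}"
| "generators (DDisc \<Gamma>) = {}"

lemma trace_structural:
  assumes "well_typed Q f" "generators f = {}" "i < length (dtgt Q f)"
  shows "trace Q f i \<noteq> None"
  using assms
proof (induction f arbitrary: i)
  case (DCmp g f)
  hence "trace Q g i \<noteq> None" by (intro DCmp.IH(1)) auto
  then obtain j where "trace Q g i = Some j" by auto
  thus ?case using DCmp trace_typed[of Q g i j] by auto
qed auto

lemma trace_cases:
  assumes "well_typed Q f" "generators f = {}" "i < length (dtgt Q f)"
  obtains k where "trace Q f i = Some k" "k < length (dsrc Q f)" "dsrc Q f ! k = dtgt Q f ! i"
  using trace_structural[OF assms] trace_typed[OF assms(1,3)] by auto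

text \<open>A signature may contain queries whose lists leave its types. No well-typed diagram
  mentions them, hence the premises of \<open>ch_hom\<close>.\<close>

locale query_model = markov_category C
  for C :: "('o, 'a) markov_data" (structure) +
  fixes Q :: "('t, 'q) signature" and ob :: "'t \<Rightarrow> 'o" and ch :: "'q \<Rightarrow> 'a"
  assumes ob_types: "ob ` types Q \<subseteq> Ob C"
    and ch_hom: "\<lbrakk>q \<in> queries Q; inp Q q \<in> lists (types Q); outp Q q \<in> lists (types Q)\<rbrakk>
      \<Longrightarrow> ch q \<in> hom C (tens C (map ob (inp Q q))) (tens C (map ob (outp Q q)))"
begin

abbreviation interp :: "('t, 'q) diagram \<Rightarrow> 'a" where "interp \<equiv> interpret_diagram C Q ob ch"

lemma lists_ob [simp]: "\<Gamma> \<in> lists (types Q) \<Longrightarrow> ob ` set \<Gamma> \<subseteq> Ob C"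
  using ob_types by auto

lemma interp_simps [simp]:
  assumes "well_typed Q d"
  shows "interp d \<in> Ar C" "Dom C (interp d) = tens C (map ob (dsrc Q d))" "Cod C (interp d) = tens C (map ob (dtgt Q d))"
proof -
  have "interp d \<in> Ar C \<and> Dom C (interp d) = tens C (map ob (dsrc Q d)) \<and> Cod C (interp d) = tens C (map ob (dtgt Q d))"
    using assms
  proof (induction d)
    case (DGen q)
    thus ?case using ch_hom[of q] by (simp add: hom_def)
  qed simp_all
  thus "interp d \<in> Ar C" "Dom C (interp d) = tens C (map ob (dsrc Q d))" "Cod C (interp d) = tens C (map ob (dtgt Q d))"
    by auto
qed

lemma interp_structural_det:
  assumes "well_typed Q d" "generators d = {}" shows "det (interp d)"
  using assms by (induction d) simp_all

text \<open>Soundness of tracing, also for diagrams with queries: projecting onto a traced wire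
  discards whatever the queries produced.\<close>

lemma proj_interp:
  assumes "well_typed Q d" "i < length (dtgt Q d)" "trace Q d i = Some k"
  shows "proj (map ob (dtgt Q d)) i \<cdot> interp d = proj (map ob (dsrc Q d)) k"
  using assms
proof (induction d arbitrary: i k)
  case (DId \<Gamma>)
  thus ?case by simp
next
  case (DCmp g f)
  then obtain j where j: "trace Q g i = Some j" "trace Q f j = Some k" by (auto simp: bind_eq_Some_conv)
  have wt: "well_typed Q g" "well_typed Q f" "dtgt Q f = dsrc Q g" and i: "i < length (dtgt Q g)"
    using DCmp.prems by auto
  have jl: "j < length (dtgt Q f)" using trace_typed[OF wt(1) i j(1)] wt(3) by simp
  have "proj (map ob (dtgt Q g)) i \<cdot> (interp g \<cdot> interp f) = proj (map ob (dsrc Q g)) j \<cdot> interp f"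
    by (rule cmp_reassoc[OF DCmp.IH(1)[OF wt(1) i j(1)]]) (use wt i in auto)
  also have "\<dots> = proj (map ob (dsrc Q f)) k" using DCmp.IH(2)[OF wt(2) jl j(2)] wt(3) by simp
  finally show ?case by simp
next
  case (DPar f g)
  note [simp] = proj_append_inv
  let ?as = "map ob (dsrc Q f)" and ?bs = "map ob (dsrc Q g)"
  have wt [simp]: "well_typed Q f" "well_typed Q g" using DPar.prems by auto
  show ?case
  proof (cases "i < length (dtgt Q f)")
    case True
    hence k: "trace Q f i = Some k" using DPar.prems by simp
    have kl: "k < length (dsrc Q f)" using trace_typed[OF wt(1) True k] by simp
    have f: "proj (map ob (dtgt Q f)) i \<cdot> (interp f \<cdot> x) = proj ?as k \<cdot> x"
      if "x \<in> Ar C" "Cod C x = tens C ?as" for x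
      by (rule cmp_reassoc[OF DPar.IH(1)[OF wt(1) True k]]) (use that True in auto)
    show ?thesis using True kl by (simp add: f)
  next
    case False
    then obtain j where j: "i = length (dtgt Q f) + j" by (metis le_add_diff_inverse not_less)
    then obtain k' where k: "trace Q g j = Some k'" "k = length (dsrc Q f) + k'"
      using DPar.prems by auto
    have jl: "j < length (dtgt Q g)" using DPar.prems j by simp
    have kl: "k' < length (dsrc Q g)" using trace_typed[OF wt(2) jl k(1)] by simp
    have g: "proj (map ob (dtgt Q g)) j \<cdot> (interp g \<cdot> x) = proj ?bs k' \<cdot> x"
      if "x \<in> Ar C" "Cod C x = tens C ?bs" for x
      by (rule cmp_reassoc[OF DPar.IH(2)[OF wt(2) jl k(1)]]) (use that jl in auto)
    show ?thesis using jl kl j k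
      proj_append_reassoc(2)[of "map ob (dtgt Q f)" "map ob (dtgt Q g)"
        "(interp f \<otimes> interp g) \<cdot> inv_arrow C (tens_append C ?as ?bs)" j] proj_append_inv(2)[of ?as ?bs k']
      by (simp add: g)
  qed
next
  case (DSwap \<Gamma> \<Delta>)
  show ?case
  proof (cases "i < length \<Delta>")
    case True
    thus ?thesis using DSwap proj_append_inv(2)[of "map ob \<Gamma>" "map ob \<Delta>" i] by simp
  next
    case False
    then obtain j where j: "i = length \<Delta> + j" by (metis le_add_diff_inverse not_less)
    thus ?thesis
      using DSwap proj_append_inv(1)[of "map ob \<Gamma>" "map ob \<Delta>" j]
        proj_append_reassoc(2)[of "map ob \<Delta>" "map ob \<Gamma>"
          "symm C (tens C (map ob \<Gamma>)) (tens C (map ob \<Delta>)) \<cdot> inv_arrow C (tens_append C (map ob \<Gamma>) (map ob \<Delta>))" j]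
      by simp
  qed
next
  case (DCopy \<Gamma>)
  show ?case
  proof (cases "i < length \<Gamma>")
    case True
    thus ?thesis using DCopy by simp
  next
    case False
    then obtain j where j: "i = length \<Gamma> + j" by (metis le_add_diff_inverse not_less)
    thus ?thesis
      using DCopy proj_append_reassoc(2)[of "map ob \<Gamma>" "map ob \<Gamma>" "copy C (tens C (map ob \<Gamma>))" j] by simp
  qed
qed auto

text \<open>Both interpretations are deterministic, hence fixed by their projections, hence by their
  traces, which \<open>trace_deq\<close> compares syntactically. This settles the axioms between
  pure wirings without any diagram chase.\<close>

lemma interp_structural_eq:
  assumes "deq Q d e" "generators d = {}" "generators e = {}"
  shows "interp d = interp e"
proof (rule det_ext[of _ _ "map ob (dtgt Q d)"])
  have wt [simp]: "well_typed Q d" "well_typed Q e" and st: "dsrc Q e = dsrc Q d" "dtgt Q e = dtgt Q d"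
    using deq_typed[OF assms(1)] by auto
  show "det (interp d)" "det (interp e)" using assms by (auto intro: interp_structural_det)
  show "Cod C (interp d) = tens C (map ob (dtgt Q d))" "Cod C (interp e) = tens C (map ob (dtgt Q d))"
    "Dom C (interp d) = Dom C (interp e)" "set (map ob (dtgt Q d)) \<subseteq> Ob C" by (simp_all add: st)
  fix i assume "i < length (map ob (dtgt Q d))"
  hence i: "i < length (dtgt Q d)" by simp
  then obtain k where k: "trace Q d i = Some k" using trace_cases[OF wt(1) assms(2)] by blast
  hence "trace Q e i = Some k" using trace_deq[OF assms(1) i] by simp
  thus "proj (map ob (dtgt Q d)) i \<cdot> interp d = proj (map ob (dtgt Q d)) i \<cdot> interp e"
    using proj_interp[OF wt(1) i k] proj_interp[OF wt(2), of i k] i st by simp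
qed

text \<open>The three diagrams may contain queries, so traces do not suffice. Conjugation by the two
  ways of assembling three tensor products reduces the claim to naturality of the
  associator.\<close>

lemma interp_par_assoc:
  assumes [simp]: "well_typed Q f" "well_typed Q g" "well_typed Q h"
  shows "interp (DPar (DPar f g) h) = interp (DPar f (DPar g h))"
proof -
  let ?s = "\<lambda>d. map ob (dsrc Q d)" and ?t = "\<lambda>d. map ob (dtgt Q d)"
  \<comment> \<open>\<open>?U\<close> and \<open>?V\<close> assemble three lists from the left and
    from the right; the parameter \<open>s\<close> is \<open>?s\<close> for the sources and
    \<open>?t\<close> for the targets.\<close>
  let ?U = "\<lambda>s. tens_append C (s f @ s g) (s h) \<cdot> (tens_append C (s f) (s g) \<otimes> Idn C (tens C (s h)))"
  let ?V = "\<lambda>s. tens_append C (s f) (s g @ s h) \<cdot> (Idn C (tens C (s f)) \<otimes> tens_append C (s g) (s h))"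
  have U: "?U s = ?V s \<cdot> assoc C (tens C (s f)) (tens C (s g)) (tens C (s h))"
    if "set (s f) \<subseteq> Ob C" "set (s g) \<subseteq> Ob C" "set (s h) \<subseteq> Ob C" for s
    using tens_append_assoc[of "s f" "s g" "s h"] that by simp
  have "interp (DPar (DPar f g) h) \<cdot> ?U ?s = ?U ?t \<cdot> ((interp f \<otimes> interp g) \<otimes> interp h)"
    by simp
  also have "\<dots> = ?V ?t \<cdot> (assoc C (tens C (?t f)) (tens C (?t g)) (tens C (?t h)) \<cdot> ((interp f \<otimes> interp g) \<otimes> interp h))"
    by (subst U) simp_all
  also have "\<dots> = ?V ?t \<cdot> ((interp f \<otimes> (interp g \<otimes> interp h)) \<cdot> assoc C (tens C (?s f)) (tens C (?s g)) (tens C (?s h)))"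
    by (subst natural_simps(4)) simp_all
  also have "\<dots> = interp (DPar f (DPar g h)) \<cdot> (?V ?s \<cdot> assoc C (tens C (?s f)) (tens C (?s g)) (tens C (?s h)))"
    by simp
  also have "\<dots> = interp (DPar f (DPar g h)) \<cdot> ?U ?s"
    by (subst U) simp_all
  finally show ?thesis
    by (intro iso_cancel_right[of "?U ?s" "interp (DPar (DPar f g) h)"]) simp_all
qed

text \<open>This makes the interpretation functor independent of representatives. Axioms about
  arbitrary diagrams are naturality or category laws; axioms between wirings fall to
  \<open>interp_structural_eq\<close> or to simplification.\<close>

lemma interp_deq: "deq Q d e \<Longrightarrow> interp d = interp e"
proof (induction rule: deq.induct)
  case (cong_par f f' g g')
  thus ?case using deq_typed[OF cong_par(1)] deq_typed[OF cong_par(2)] by simp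
next
  case (par_cmp g f g' f')
  thus ?case by simp
next
  case (par_assoc f g h)
  thus ?case by (rule interp_par_assoc)
next
  case (par_unit_left f)
  thus ?case by (simp add: natural_reassoc)
next
  case (par_unit_right f)
  thus ?case by (simp add: tens_append_Nil2 natural_reassoc)
next
  case (swap_natural f g)
  thus ?case by (simp add: natural_reassoc)
next
  case (disc_terminal f)
  thus ?case by (intro to_unit_unique) simp_all
next
  case (id_right f)
  thus ?case by simp
next
  case (id_left f)
  thus ?case by simp
next
  case (cmp_assoc h g f)
  thus ?case by simp
next
  case (cong_cmp f f' g g')
  thus ?case by simp
next
  case (par_id \<Gamma> \<Delta>)
  thus ?case by simp
next
  case (swap_swap \<Gamma> \<Delta>)
  thus ?case by (intro interp_structural_eq deq.swap_swap) auto
next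
  case (swap_append \<Gamma> \<Delta> \<Theta>)
  thus ?case by (intro interp_structural_eq deq.swap_append) auto
next
  case (copy_assoc \<Gamma>)
  thus ?case by (intro interp_structural_eq deq.copy_assoc) auto
next
  case (copy_counit_left \<Gamma>)
  thus ?case by (intro interp_structural_eq deq.copy_counit_left) auto
next
  case (copy_counit_right \<Gamma>)
  thus ?case by (intro interp_structural_eq deq.copy_counit_right) auto
next
  case (copy_comm \<Gamma>)
  thus ?case by (intro interp_structural_eq deq.copy_comm) auto
next
  case (copy_append \<Gamma> \<Delta>)
  thus ?case by (intro interp_structural_eq deq.copy_append) auto
qed auto

end

section \<open>Markov functors\<close>

locale functor_between = src: markov_category C + tgt: markov_category D + markov_functor C D F
  for C :: "('o, 'a) markov_data" and D :: "('p, 'b) markov_data" (structure) and F :: "('o, 'a, 'p, 'b) mfunctor"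
begin

lemma functor_simps [simp]:
  "X \<in> Ob C \<Longrightarrow> FOb F X \<in> Ob D"
  "f \<in> Ar C \<Longrightarrow> FAr F f \<in> Ar D"
  "f \<in> Ar C \<Longrightarrow> Dom D (FAr F f) = FOb F (Dom C f)"
  "f \<in> Ar C \<Longrightarrow> Cod D (FAr F f) = FOb F (Cod C f)"
  "X \<in> Ob C \<Longrightarrow> FAr F (Idn C X) = Idn D (FOb F X)"
  "FUnt F \<in> Ar D" "Dom D (FUnt F) = Unt D" "Cod D (FUnt F) = FOb F (Unt C)"
  "iso_arrow D (FUnt F)" "deterministic D (FUnt F)"
  using ob ar[of f "Dom C f" "Cod C f"] ar_id unt_hom unt_iso unt_det by (auto simp: hom_def)

lemma mul_simps [simp]:
  assumes "X \<in> Ob C" "Y \<in> Ob C"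
  shows "FMul F X Y \<in> Ar D" "Dom D (FMul F X Y) = TOb D (FOb F X) (FOb F Y)"
    "Cod D (FMul F X Y) = FOb F (TOb C X Y)" "iso_arrow D (FMul F X Y)" "deterministic D (FMul F X Y)"
  using mul_hom[OF assms] mul_iso[OF assms] mul_det[OF assms] by (auto simp: hom_def)

lemma functor_cmp:
  assumes "f \<in> Ar C" "g \<in> Ar C" "Dom C g = Cod C f"
  shows "FAr F (g \<cdot>\<^bsub>C\<^esub> f) = FAr F g \<cdot> FAr F f"
  using ar_cmp[of f "Dom C f" "Cod C f" g "Cod C g"] assms by (auto simp: hom_def)

lemma mul_natural_ar:
  assumes "f \<in> Ar C" "g \<in> Ar C"
  shows "FAr F (f \<otimes>\<^bsub>C\<^esub> g) \<cdot> FMul F (Dom C f) (Dom C g)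
    = FMul F (Cod C f) (Cod C g) \<cdot> (FAr F f \<otimes> FAr F g)"
  using mul_natural[of f "Dom C f" "Cod C f" g "Dom C g" "Cod C g"] assms by (auto simp: hom_def)

lemma functor_iso [simp]:
  assumes "iso_arrow C f" shows "iso_arrow D (FAr F f)"
  unfolding iso_arrow_def
  by (rule exI[of _ "FAr F (inv_arrow C f)"])
    (use assms in \<open>simp add: inverse_arrows_def hom_def flip: functor_cmp\<close>)

text \<open>A functor preserves copy only up to \<open>FMul\<close>; naturality carries
  \<open>FMul\<close> across \<open>f\<close>, and invertibility cancels it.\<close>

lemma functor_det [simp]:
  assumes "deterministic C f" shows "deterministic D (FAr F f)"
proof -
  note [simp] = src.det_ar[OF assms]
  let ?X = "Dom C f" and ?Y = "Cod C f"
  have "FMul F ?Y ?Y \<cdot> (copy D (FOb F ?Y) \<cdot> FAr F f) = FAr F (copy C ?Y \<cdot>\<^bsub>C\<^esub> f)"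
    using tgt.cmpA[of "FAr F f" "copy D (FOb F ?Y)" "FMul F ?Y ?Y"] by (simp add: functor_cmp ar_copy)
  also have "\<dots> = FAr F (f \<otimes>\<^bsub>C\<^esub> f) \<cdot> (FMul F ?X ?X \<cdot> copy D (FOb F ?X))"
    using src.det_copy[OF assms] by (simp add: functor_cmp ar_copy)
  also have "\<dots> = FMul F ?Y ?Y \<cdot> ((FAr F f \<otimes> FAr F f) \<cdot> copy D (FOb F ?X))"
    using tgt.cmp_reassoc[OF mul_natural_ar[of f f], of "copy D (FOb F ?X)"] by simp
  finally have "copy D (FOb F ?Y) \<cdot> FAr F f = (FAr F f \<otimes> FAr F f) \<cdot> copy D (FOb F ?X)"
    by (rule tgt.iso_cancel_left[rotated -1]) simp_all
  thus ?thesis by (intro tgt.detI) simp_all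
qed

end

lemma comp_functor_fields [simp]:
  "FOb (comp_functor D E G F) X = FOb G (FOb F X)"
  "FAr (comp_functor D E G F) f = FAr G (FAr F f)"
  "FMul (comp_functor D E G F) X Y = Cmp E (FAr G (FMul F X Y)) (FMul G (FOb F X) (FOb F Y))"
  "FUnt (comp_functor D E G F) = Cmp E (FAr G (FUnt F)) (FUnt G)"
  by (simp_all add: comp_functor_def)

lemma comp_markov_functor:
  fixes E :: "('r, 'c) markov_data" (structure)
  assumes "functor_between C D F" "functor_between D E G"
  shows "markov_functor C E (comp_functor D E G F)"
proof -
  interpret F: functor_between C D F by fact
  interpret G: functor_between D E G by fact
  \<comment> \<open>The structure map of \<open>G\<close> has to pass the \<open>G\<close>-image of
    a structure map of \<open>F\<close>. With this, the associativity and unit laws of the composite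
    reduce to those of \<open>F\<close> and \<open>G\<close>.\<close>
  have nat: "FAr G (f \<otimes>\<^bsub>D\<^esub> g) \<cdot> (FMul G X Y \<cdot> k) = FMul G X' Y' \<cdot> ((FAr G f \<otimes> FAr G g) \<cdot> k)"
    if "f \<in> Ar D" "g \<in> Ar D" "k \<in> Ar E" "Cod E k = FOb G X \<odot> FOb G Y" "Dom D f = X" "Dom D g = Y"
      "Cod D f = X'" "Cod D g = Y'"
    for f g k X Y X' Y'
    using G.tgt.cmp_reassoc[OF G.mul_natural_ar[of f g], of k] that by auto
  show ?thesis
  proof
    fix X assume "X \<in> Ob C"
    thus "FOb (comp_functor D E G F) X \<in> Ob E" by simp
  next
    fix f X Y assume "f \<in> hom C X Y"
    thus "FAr (comp_functor D E G F) f \<in> hom E (FOb (comp_functor D E G F) X) (FOb (comp_functor D E G F) Y)"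
      by (auto simp: hom_def)
  next
    fix f X Y g Z assume "f \<in> hom C X Y" "g \<in> hom C Y Z"
    thus "FAr (comp_functor D E G F) (g \<cdot>\<^bsub>C\<^esub> f) = FAr (comp_functor D E G F) g \<cdot> FAr (comp_functor D E G F) f"
      by (simp add: hom_def F.functor_cmp G.functor_cmp)
  next
    fix f X X' g Y Y' assume "f \<in> hom C X X'" "g \<in> hom C Y Y'"
    hence [simp]: "f \<in> Ar C" "g \<in> Ar C" and [symmetric, simp]: "Dom C f = X" "Cod C f = X'" "Dom C g = Y" "Cod C g = Y'"
      by (auto simp: hom_def)
    have "FAr G (FAr F (f \<otimes>\<^bsub>C\<^esub> g)) \<cdot> FAr G (FMul F X Y) = FAr G (FMul F X' Y') \<cdot> FAr G (FAr F f \<otimes>\<^bsub>D\<^esub> FAr F g)"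
      using F.mul_natural_ar[of f g] by (simp flip: G.functor_cmp)
    hence "FAr G (FAr F (f \<otimes>\<^bsub>C\<^esub> g)) \<cdot> (FAr G (FMul F X Y) \<cdot> FMul G (FOb F X) (FOb F Y))
      = (FAr G (FMul F X' Y') \<cdot> FAr G (FAr F f \<otimes>\<^bsub>D\<^esub> FAr F g)) \<cdot> FMul G (FOb F X) (FOb F Y)"
      by (rule G.tgt.cmp_reassoc) simp_all
    also have "\<dots> = FAr G (FMul F X' Y') \<cdot> (FMul G (FOb F X') (FOb F Y') \<cdot> (FAr G (FAr F f) \<otimes> FAr G (FAr F g)))"
      using G.mul_natural_ar[of "FAr F f" "FAr F g"] by simp
    finally show "FAr (comp_functor D E G F) (f \<otimes>\<^bsub>C\<^esub> g) \<cdot> FMul (comp_functor D E G F) X Y =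
       FMul (comp_functor D E G F) X' Y' \<cdot> (FAr (comp_functor D E G F) f \<otimes> FAr (comp_functor D E G F) g)"
      by simp
  next
    show "FUnt (comp_functor D E G F) \<in> hom E (Unt E) (FOb (comp_functor D E G F) (Unt C))"
      by (simp add: hom_def)
  next
    fix X Y Z assume [simp]: "X \<in> Ob C" "Y \<in> Ob C" "Z \<in> Ob C"
    let ?X = "FOb F X" and ?Y = "FOb F Y" and ?Z = "FOb F Z"
    let ?k = "FMul G (?X \<odot>\<^bsub>D\<^esub> ?Y) ?Z \<cdot> (FMul G ?X ?Y \<otimes> Idn E (FOb G ?Z))"
    have "FAr G (FAr F (assoc C X Y Z)) \<cdot> FAr G (FMul F (X \<odot>\<^bsub>C\<^esub> Y) Z) \<cdot> FMul G (FOb F (X \<odot>\<^bsub>C\<^esub> Y)) ?Z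
        \<cdot> (FAr G (FMul F X Y) \<otimes> Idn E (FOb G ?Z)) \<cdot> (FMul G ?X ?Y \<otimes> Idn E (FOb G ?Z))
      = FAr G (FAr F (assoc C X Y Z)) \<cdot> FAr G (FMul F (X \<odot>\<^bsub>C\<^esub> Y) Z)
        \<cdot> FAr G (FMul F X Y \<otimes>\<^bsub>D\<^esub> Idn D ?Z) \<cdot> ?k"
      using nat[of "FMul F X Y" "Idn D ?Z" "FMul G ?X ?Y \<otimes> Idn E (FOb G ?Z)"] by simp
    also have "\<dots> = FAr G (FAr F (assoc C X Y Z) \<cdot>\<^bsub>D\<^esub> FMul F (X \<odot>\<^bsub>C\<^esub> Y) Z \<cdot>\<^bsub>D\<^esub> (FMul F X Y \<otimes>\<^bsub>D\<^esub> Idn D ?Z)) \<cdot> ?k"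
      by (simp add: G.functor_cmp)
    also have "\<dots> = FAr G (FMul F X (Y \<odot>\<^bsub>C\<^esub> Z)) \<cdot> FAr G (Idn D ?X \<otimes>\<^bsub>D\<^esub> FMul F Y Z) \<cdot> (FAr G (assoc D ?X ?Y ?Z) \<cdot> ?k)"
      by (simp add: F.mul_assoc G.functor_cmp)
    also have "FAr G (assoc D ?X ?Y ?Z) \<cdot> ?k = FMul G ?X (?Y \<odot>\<^bsub>D\<^esub> ?Z) \<cdot> (Idn E (FOb G ?X) \<otimes> FMul G ?Y ?Z)
        \<cdot> assoc E (FOb G ?X) (FOb G ?Y) (FOb G ?Z)"
      by (rule G.mul_assoc) simp_all
    finally show "FAr (comp_functor D E G F) (assoc C X Y Z) \<cdot> FMul (comp_functor D E G F) (X \<odot>\<^bsub>C\<^esub> Y) Z \<cdot>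
          (FMul (comp_functor D E G F) X Y \<otimes> Idn E (FOb (comp_functor D E G F) Z)) =
         FMul (comp_functor D E G F) X (Y \<odot>\<^bsub>C\<^esub> Z) \<cdot>
          (Idn E (FOb (comp_functor D E G F) X) \<otimes> FMul (comp_functor D E G F) Y Z) \<cdot>
          assoc E (FOb (comp_functor D E G F) X) (FOb (comp_functor D E G F) Y) (FOb (comp_functor D E G F) Z)"
      by (simp add: nat)
  next
    fix X assume [simp]: "X \<in> Ob C"
    have "FAr G (FAr F (lunit C X)) \<cdot> FAr G (FMul F (Unt C) X) \<cdot> FMul G (FOb F (Unt C)) (FOb F X)
        \<cdot> (FAr G (FUnt F) \<otimes> Idn E (FOb G (FOb F X))) \<cdot> (FUnt G \<otimes> Idn E (FOb G (FOb F X)))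
      = FAr G (FAr F (lunit C X) \<cdot>\<^bsub>D\<^esub> FMul F (Unt C) X \<cdot>\<^bsub>D\<^esub> (FUnt F \<otimes>\<^bsub>D\<^esub> Idn D (FOb F X)))
        \<cdot> FMul G (Unt D) (FOb F X) \<cdot> (FUnt G \<otimes> Idn E (FOb G (FOb F X)))"
      using nat[of "FUnt F" "Idn D (FOb F X)" "FUnt G \<otimes> Idn E (FOb G (FOb F X))"] by (simp add: G.functor_cmp)
    also have "\<dots> = lunit E (FOb G (FOb F X))" by (simp add: F.mul_lunit G.mul_lunit)
    finally show "FAr (comp_functor D E G F) (lunit C X) \<cdot> FMul (comp_functor D E G F) (Unt C) X \<cdot>
          (FUnt (comp_functor D E G F) \<otimes> Idn E (FOb (comp_functor D E G F) X)) = lunit E (FOb (comp_functor D E G F) X)"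
      by simp
    have "FAr G (FAr F (runit C X)) \<cdot> FAr G (FMul F X (Unt C)) \<cdot> FMul G (FOb F X) (FOb F (Unt C))
        \<cdot> (Idn E (FOb G (FOb F X)) \<otimes> FAr G (FUnt F)) \<cdot> (Idn E (FOb G (FOb F X)) \<otimes> FUnt G)
      = FAr G (FAr F (runit C X) \<cdot>\<^bsub>D\<^esub> FMul F X (Unt C) \<cdot>\<^bsub>D\<^esub> (Idn D (FOb F X) \<otimes>\<^bsub>D\<^esub> FUnt F))
        \<cdot> FMul G (FOb F X) (Unt D) \<cdot> (Idn E (FOb G (FOb F X)) \<otimes> FUnt G)"
      using nat[of "Idn D (FOb F X)" "FUnt F" "Idn E (FOb G (FOb F X)) \<otimes> FUnt G"] by (simp add: G.functor_cmp)
    also have "\<dots> = runit E (FOb G (FOb F X))" by (simp add: F.mul_runit G.mul_runit)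
    finally show "FAr (comp_functor D E G F) (runit C X) \<cdot> FMul (comp_functor D E G F) X (Unt C) \<cdot>
          (Idn E (FOb (comp_functor D E G F) X) \<otimes> FUnt (comp_functor D E G F)) = runit E (FOb (comp_functor D E G F) X)"
      by simp
  next
    fix X Y assume [simp]: "X \<in> Ob C" "Y \<in> Ob C"
    let ?X = "FOb F X" and ?Y = "FOb F Y"
    have "FAr G (FAr F (symm C X Y)) \<cdot> FAr G (FMul F X Y) \<cdot> FMul G ?X ?Y
      = FAr G (FAr F (symm C X Y) \<cdot>\<^bsub>D\<^esub> FMul F X Y) \<cdot> FMul G ?X ?Y" by (simp add: G.functor_cmp)
    also have "\<dots> = FAr G (FMul F Y X) \<cdot> (FAr G (symm D ?X ?Y) \<cdot> FMul G ?X ?Y)"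
      by (simp add: F.mul_symm G.functor_cmp)
    finally show "FAr (comp_functor D E G F) (symm C X Y) \<cdot> FMul (comp_functor D E G F) X Y =
         FMul (comp_functor D E G F) Y X \<cdot> symm E (FOb (comp_functor D E G F) X) (FOb (comp_functor D E G F) Y)"
      by (simp add: G.mul_symm)
  qed (simp_all add: hom_def F.ar_copy G.ar_copy G.functor_cmp)
qed

subsection \<open>Extending components on types to a monoidal transformation\<close>

text \<open>Both clauses are forced: they are the monoidality conditions solved for the component,
  which the invertible structure maps of \<open>F\<close> permit.\<close>

primrec extend_components ::
  "('p, 'b) markov_data \<Rightarrow> ('t list, 'a, 'p, 'b) mfunctor \<Rightarrow> ('t list, 'a, 'p, 'b) mfunctor
    \<Rightarrow> ('t \<Rightarrow> 'b) \<Rightarrow> 't list \<Rightarrow> 'b" where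
  "extend_components D F G s [] = FUnt G \<cdot>\<^bsub>D\<^esub> inv_arrow D (FUnt F)"
| "extend_components D F G s (X # \<Gamma>) =
     FMul G [X] \<Gamma> \<cdot>\<^bsub>D\<^esub> (s X \<otimes>\<^bsub>D\<^esub> extend_components D F G s \<Gamma>) \<cdot>\<^bsub>D\<^esub> inv_arrow D (FMul F [X] \<Gamma>)"

locale functor_from_free = functor_between "free_markov Q" D F
  for Q :: "('t, 'q) signature" and D :: "('p, 'b) markov_data" (structure)
    and F :: "('t list, ('t, 'q) diagram set, 'p, 'b) mfunctor"
begin

lemma FAr_simps [simp]:
  assumes "well_typed Q d"
  shows "FAr F (dclass Q d) \<in> Ar D" "Dom D (FAr F (dclass Q d)) = FOb F (dsrc Q d)"
    "Cod D (FAr F (dclass Q d)) = FOb F (dtgt Q d)"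
  using assms functor_simps(2-4)[of "dclass Q d"] by auto

lemma FOb_simps [simp]: "\<Gamma> \<in> lists (types Q) \<Longrightarrow> FOb F \<Gamma> \<in> Ob D"
  using functor_simps(1)[of \<Gamma>] by simp

lemma FUnt_simps [simp]: "Cod D (FUnt F) = FOb F []"
  using functor_simps(8) by simp

lemma FMul_simps [simp]:
  assumes "\<Gamma> \<in> lists (types Q)" "\<Delta> \<in> lists (types Q)"
  shows "FMul F \<Gamma> \<Delta> \<in> Ar D" "Dom D (FMul F \<Gamma> \<Delta>) = TOb D (FOb F \<Gamma>) (FOb F \<Delta>)"
    "Cod D (FMul F \<Gamma> \<Delta>) = FOb F (\<Gamma> @ \<Delta>)" "iso_arrow D (FMul F \<Gamma> \<Delta>)" "deterministic D (FMul F \<Gamma> \<Delta>)"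
  using assms mul_simps[of \<Gamma> \<Delta>] by auto

lemma FAr_DId [simp]: "\<Gamma> \<in> lists (types Q) \<Longrightarrow> FAr F (dclass Q (DId \<Gamma>)) = Idn D (FOb F \<Gamma>)"
  using functor_simps(5)[of \<Gamma>] by simp

lemma FAr_DCmp [simp]:
  "well_typed Q (DCmp g f) \<Longrightarrow> FAr F (dclass Q (DCmp g f)) = FAr F (dclass Q g) \<cdot> FAr F (dclass Q f)"
  using functor_cmp[of "dclass Q f" "dclass Q g"] by simp

lemma FAr_DPar:
  assumes "well_typed Q f" "well_typed Q g"
  shows "FAr F (dclass Q (DPar f g)) \<cdot> FMul F (dsrc Q f) (dsrc Q g)
    = FMul F (dtgt Q f) (dtgt Q g) \<cdot> (FAr F (dclass Q f) \<otimes> FAr F (dclass Q g))"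
  using mul_natural_ar[of "dclass Q f" "dclass Q g"] assms by simp

lemma FAr_DSwap:
  assumes "\<Gamma> \<in> lists (types Q)" "\<Delta> \<in> lists (types Q)"
  shows "FAr F (dclass Q (DSwap \<Gamma> \<Delta>)) \<cdot> FMul F \<Gamma> \<Delta> = FMul F \<Delta> \<Gamma> \<cdot> symm D (FOb F \<Gamma>) (FOb F \<Delta>)"
  using mul_symm[of \<Gamma> \<Delta>] assms by simp

lemma FAr_DCopy:
  "\<Gamma> \<in> lists (types Q) \<Longrightarrow> FAr F (dclass Q (DCopy \<Gamma>)) = FMul F \<Gamma> \<Gamma> \<cdot> copy D (FOb F \<Gamma>)"
  using ar_copy[of \<Gamma>] by simp

lemma FMul_assoc:
  assumes [simp]: "\<Gamma> \<in> lists (types Q)" "\<Delta> \<in> lists (types Q)" "\<Theta> \<in> lists (types Q)"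
  shows "FMul F (\<Gamma> @ \<Delta>) \<Theta> \<cdot> (FMul F \<Gamma> \<Delta> \<otimes> Idn D (FOb F \<Theta>))
    = FMul F \<Gamma> (\<Delta> @ \<Theta>) \<cdot> (Idn D (FOb F \<Gamma>) \<otimes> FMul F \<Delta> \<Theta>)
        \<cdot> assoc D (FOb F \<Gamma>) (FOb F \<Delta>) (FOb F \<Theta>)"
  using mul_assoc[of \<Gamma> \<Delta> \<Theta>] by simp

lemma FMul_unit:
  assumes [simp]: "\<Gamma> \<in> lists (types Q)"
  shows "FMul F [] \<Gamma> \<cdot> (FUnt F \<otimes> Idn D (FOb F \<Gamma>)) = lunit D (FOb F \<Gamma>)"
    "FMul F \<Gamma> [] \<cdot> (Idn D (FOb F \<Gamma>) \<otimes> FUnt F) = runit D (FOb F \<Gamma>)"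
  using mul_lunit[of \<Gamma>] mul_runit[of \<Gamma>] by simp_all

end

locale parallel_functors = F: functor_from_free Q D F + G: functor_from_free Q D G
  for Q :: "('t, 'q) signature" and D :: "('p, 'b) markov_data" (structure)
    and F G :: "('t list, ('t, 'q) diagram set, 'p, 'b) mfunctor"
begin

lemma transformation_eq_extend:
  assumes "markov_transformation (free_markov Q) D F G \<tau>" "\<Gamma> \<in> lists (types Q)"
  shows "\<tau> \<Gamma> = extend_components D F G (\<lambda>X. \<tau> [X]) \<Gamma>"
proof -
  interpret T: markov_transformation "free_markov Q" D F G \<tau> by fact
  have [simp]: "\<tau> \<Delta> \<in> Ar D" "Dom D (\<tau> \<Delta>) = FOb F \<Delta>" "Cod D (\<tau> \<Delta>) = FOb G \<Delta>" if "\<Delta> \<in> lists (types Q)" for \<Delta>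
    using T.component_hom[of \<Delta>] that by (auto simp: hom_def)
  show ?thesis
    using assms(2)
  proof (induction \<Gamma>)
    case Nil
    show ?case
      by (rule F.tgt.iso_cancel_right[of "FUnt F"]) (use T.monoidal_unt in simp_all)
  next
    case (Cons X \<Gamma>)
    hence [simp]: "X \<in> types Q" "\<Gamma> \<in> lists (types Q)" by auto
    have "\<tau> (X # \<Gamma>) = \<tau> (X # \<Gamma>) \<cdot> (FMul F [X] \<Gamma> \<cdot> inv_arrow D (FMul F [X] \<Gamma>))" by simp
    also have "\<dots> = (FMul G [X] \<Gamma> \<cdot> (\<tau> [X] \<otimes> \<tau> \<Gamma>)) \<cdot> inv_arrow D (FMul F [X] \<Gamma>)"
      using T.monoidal_mul[of "[X]" \<Gamma>] by (intro F.tgt.cmp_reassoc) simp_all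
    also have "\<dots> = FMul G [X] \<Gamma> \<cdot> (\<tau> [X] \<otimes> \<tau> \<Gamma>) \<cdot> inv_arrow D (FMul F [X] \<Gamma>)" by simp
    finally show ?case using Cons.IH by (simp only: extend_components.simps)
  qed
qed

context
  fixes s :: "'t \<Rightarrow> 'b"
  assumes s_hom: "X \<in> types Q \<Longrightarrow> s X \<in> hom D (FOb F [X]) (FOb G [X])"
    and s_det: "X \<in> types Q \<Longrightarrow> deterministic D (s X)"
begin

abbreviation "ext \<equiv> extend_components D F G s"

lemma s_simps [simp]:
  assumes "X \<in> types Q" shows "s X \<in> Ar D" "Dom D (s X) = FOb F [X]" "Cod D (s X) = FOb G [X]" "deterministic D (s X)"
  using s_hom[OF assms] s_det[OF assms] by (auto simp: hom_def)

lemma ext_simps [simp]: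
  assumes "\<Gamma> \<in> lists (types Q)"
  shows "ext \<Gamma> \<in> Ar D" "Dom D (ext \<Gamma>) = FOb F \<Gamma>" "Cod D (ext \<Gamma>) = FOb G \<Gamma>" "deterministic D (ext \<Gamma>)"
proof -
  have "ext \<Gamma> \<in> Ar D \<and> Dom D (ext \<Gamma>) = FOb F \<Gamma> \<and> Cod D (ext \<Gamma>) = FOb G \<Gamma> \<and> deterministic D (ext \<Gamma>)"
    using assms by (induction \<Gamma>) simp_all
  thus "ext \<Gamma> \<in> Ar D" "Dom D (ext \<Gamma>) = FOb F \<Gamma>" "Cod D (ext \<Gamma>) = FOb G \<Gamma>" "deterministic D (ext \<Gamma>)" by auto
qed

lemma ext_iso:
  assumes "\<And>X. X \<in> types Q \<Longrightarrow> iso_arrow D (s X)" "\<Gamma> \<in> lists (types Q)"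
  shows "iso_arrow D (ext \<Gamma>)"
  using assms(2) by (induction \<Gamma>) (simp_all add: assms(1))

text \<open>Not immediate, since the recursion ends in a component at \<open>[]\<close>; the right
  unit laws of \<open>F\<close> and \<open>G\<close> remove it.\<close>

lemma ext_single [simp]:
  assumes [simp]: "X \<in> types Q" shows "ext [X] = s X"
proof -
  have "ext [X] \<cdot> runit D (FOb F [X]) = ext [X] \<cdot> (FMul F [X] [] \<cdot> (Idn D (FOb F [X]) \<otimes> FUnt F))"
    by (subst F.FMul_unit) simp_all
  also have "\<dots> = FMul G [X] [] \<cdot> (s X \<otimes> FUnt G)" by simp
  also have "\<dots> = FMul G [X] [] \<cdot> ((Idn D (FOb G [X]) \<otimes> FUnt G) \<cdot> (s X \<otimes> Idn D (Unt D)))" by simp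
  also have "\<dots> = runit D (FOb G [X]) \<cdot> (s X \<otimes> Idn D (Unt D))"
    by (rule F.tgt.cmp_reassoc[OF G.FMul_unit(2)]) simp_all
  also have "\<dots> = s X \<cdot> runit D (FOb F [X])" by (simp add: F.tgt.natural_simps)
  finally show ?thesis
    by (rule F.tgt.iso_cancel_right[rotated -1]) (simp_all del: extend_components.simps)
qed

text \<open>The recursion is the case of a singleton on the left; associativity of the structure
  maps propagates it along the list. In both cases the comparison takes place after precomposition
  with an isomorphism \<open>?e\<close>.\<close>

lemma ext_mul:
  assumes "\<Gamma> \<in> lists (types Q)" "\<Delta> \<in> lists (types Q)"
  shows "ext (\<Gamma> @ \<Delta>) \<cdot> FMul F \<Gamma> \<Delta> = FMul G \<Gamma> \<Delta> \<cdot> (ext \<Gamma> \<otimes> ext \<Delta>)"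
  using assms
proof (induction \<Gamma>)
  case Nil
  hence [simp]: "\<Delta> \<in> lists (types Q)" by simp
  let ?e = "FUnt F \<otimes> Idn D (FOb F \<Delta>)"
  have "(ext \<Delta> \<cdot> FMul F [] \<Delta>) \<cdot> ?e = ext \<Delta> \<cdot> lunit D (FOb F \<Delta>)" by (simp add: F.FMul_unit)
  also have "\<dots> = lunit D (FOb G \<Delta>) \<cdot> (Idn D (Unt D) \<otimes> ext \<Delta>)" by (simp add: F.tgt.natural_simps)
  also have "\<dots> = FMul G [] \<Delta> \<cdot> ((FUnt G \<otimes> Idn D (FOb G \<Delta>)) \<cdot> (Idn D (Unt D) \<otimes> ext \<Delta>))"
    by (rule F.tgt.cmp_reassoc[OF G.FMul_unit(1), symmetric]) simp_all
  also have "\<dots> = (FMul G [] \<Delta> \<cdot> (ext [] \<otimes> ext \<Delta>)) \<cdot> ?e" by simp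
  finally have "ext \<Delta> \<cdot> FMul F [] \<Delta> = FMul G [] \<Delta> \<cdot> (ext [] \<otimes> ext \<Delta>)"
    by (rule F.tgt.iso_cancel_right[rotated -1]) simp_all
  thus ?case by simp
next
  case (Cons X \<Gamma>)
  hence [simp]: "X \<in> types Q" "\<Gamma> \<in> lists (types Q)" "\<Delta> \<in> lists (types Q)" by auto
  let ?e = "FMul F [X] \<Gamma> \<otimes> Idn D (FOb F \<Delta>)"
  have "(ext (X # \<Gamma> @ \<Delta>) \<cdot> FMul F (X # \<Gamma>) \<Delta>) \<cdot> ?e
      = ext (X # \<Gamma> @ \<Delta>) \<cdot> (FMul F ([X] @ \<Gamma>) \<Delta> \<cdot> ?e)"
    by (simp del: extend_components.simps)
  also have "\<dots> = ext (X # \<Gamma> @ \<Delta>) \<cdot> (FMul F [X] (\<Gamma> @ \<Delta>) \<cdot> (Idn D (FOb F [X]) \<otimes> FMul F \<Gamma> \<Delta>)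
        \<cdot> assoc D (FOb F [X]) (FOb F \<Gamma>) (FOb F \<Delta>))"
    by (subst F.FMul_assoc) simp_all
  also have "\<dots> = FMul G [X] (\<Gamma> @ \<Delta>) \<cdot> (s X \<otimes> (ext (\<Gamma> @ \<Delta>) \<cdot> FMul F \<Gamma> \<Delta>))
        \<cdot> assoc D (FOb F [X]) (FOb F \<Gamma>) (FOb F \<Delta>)"
    by simp
  also have "\<dots> = FMul G [X] (\<Gamma> @ \<Delta>) \<cdot> (Idn D (FOb G [X]) \<otimes> FMul G \<Gamma> \<Delta>) \<cdot> ((s X \<otimes> (ext \<Gamma> \<otimes> ext \<Delta>))
        \<cdot> assoc D (FOb F [X]) (FOb F \<Gamma>) (FOb F \<Delta>))"
    unfolding Cons.IH[OF \<open>\<Delta> \<in> _\<close>] by simp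
  also have "(s X \<otimes> (ext \<Gamma> \<otimes> ext \<Delta>)) \<cdot> assoc D (FOb F [X]) (FOb F \<Gamma>) (FOb F \<Delta>)
      = assoc D (FOb G [X]) (FOb G \<Gamma>) (FOb G \<Delta>) \<cdot> ((s X \<otimes> ext \<Gamma>) \<otimes> ext \<Delta>)"
    by (subst F.tgt.natural_simps(4)) simp_all
  also have "FMul G [X] (\<Gamma> @ \<Delta>) \<cdot> (Idn D (FOb G [X]) \<otimes> FMul G \<Gamma> \<Delta>) \<cdot> assoc D (FOb G [X]) (FOb G \<Gamma>) (FOb G \<Delta>)
        \<cdot> ((s X \<otimes> ext \<Gamma>) \<otimes> ext \<Delta>)
      = (FMul G [X] (\<Gamma> @ \<Delta>) \<cdot> (Idn D (FOb G [X]) \<otimes> FMul G \<Gamma> \<Delta>) \<cdot> assoc D (FOb G [X]) (FOb G \<Gamma>) (FOb G \<Delta>))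
        \<cdot> ((s X \<otimes> ext \<Gamma>) \<otimes> ext \<Delta>)" by simp
  also have "\<dots> = (FMul G ([X] @ \<Gamma>) \<Delta> \<cdot> (FMul G [X] \<Gamma> \<otimes> Idn D (FOb G \<Delta>))) \<cdot> ((s X \<otimes> ext \<Gamma>) \<otimes> ext \<Delta>)"
    by (subst G.FMul_assoc) simp_all
  also have "\<dots> = (FMul G (X # \<Gamma>) \<Delta> \<cdot> (ext (X # \<Gamma>) \<otimes> ext \<Delta>)) \<cdot> ?e" by simp
  finally have "ext (X # \<Gamma> @ \<Delta>) \<cdot> FMul F (X # \<Gamma>) \<Delta> = FMul G (X # \<Gamma>) \<Delta> \<cdot> (ext (X # \<Gamma>) \<otimes> ext \<Delta>)"
    by (rule F.tgt.iso_cancel_right[rotated -1]) (simp_all del: extend_components.simps)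
  thus ?case by (simp del: extend_components.simps)
qed

text \<open>Structure maps take care of parallel composition and swaps, determinism of the
  components takes care of copies, and discards agree because the image of \<open>[]\<close> is
  terminal. That leaves the queries.\<close>

lemma ext_natural:
  assumes gen: "\<And>q. q \<in> queries Q \<Longrightarrow> inp Q q \<in> lists (types Q) \<Longrightarrow> outp Q q \<in> lists (types Q) \<Longrightarrow>
      ext (outp Q q) \<cdot> FAr F (dclass Q (DGen q)) = FAr G (dclass Q (DGen q)) \<cdot> ext (inp Q q)"
    and "well_typed Q d"
  shows "ext (dtgt Q d) \<cdot> FAr F (dclass Q d) = FAr G (dclass Q d) \<cdot> ext (dsrc Q d)"
  using assms(2)
proof (induction d)
  case (DGen q)
  thus ?case using gen[of q] by simp
next
  case (DCmp g f)
  hence [simp]: "well_typed Q g" "well_typed Q f" "dtgt Q f = dsrc Q g" by auto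
  have "ext (dtgt Q g) \<cdot> (FAr F (dclass Q g) \<cdot> FAr F (dclass Q f)) = FAr G (dclass Q g) \<cdot> (ext (dsrc Q g) \<cdot> FAr F (dclass Q f))"
    using F.tgt.cmp_reassoc[OF DCmp.IH(1), of "FAr F (dclass Q f)"] by simp
  also have "\<dots> = FAr G (dclass Q g) \<cdot> (FAr G (dclass Q f) \<cdot> ext (dsrc Q f))"
    using DCmp.IH(2) by simp
  finally show ?case by simp
next
  case (DPar f g)
  hence [simp]: "well_typed Q f" "well_typed Q g" by auto
  let ?e = "FMul F (dsrc Q f) (dsrc Q g)"
  have "(ext (dtgt Q f @ dtgt Q g) \<cdot> FAr F (dclass Q (DPar f g))) \<cdot> ?e
      = ext (dtgt Q f @ dtgt Q g) \<cdot> (FMul F (dtgt Q f) (dtgt Q g) \<cdot> (FAr F (dclass Q f) \<otimes> FAr F (dclass Q g)))"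
    by (simp add: F.FAr_DPar)
  also have "\<dots> = (FMul G (dtgt Q f) (dtgt Q g) \<cdot> (ext (dtgt Q f) \<otimes> ext (dtgt Q g)))
      \<cdot> (FAr F (dclass Q f) \<otimes> FAr F (dclass Q g))"
    by (rule F.tgt.cmp_reassoc[OF ext_mul]) simp_all
  also have "\<dots> = FMul G (dtgt Q f) (dtgt Q g) \<cdot> ((FAr G (dclass Q f) \<otimes> FAr G (dclass Q g)) \<cdot> (ext (dsrc Q f) \<otimes> ext (dsrc Q g)))"
    using DPar.IH by simp
  also have "\<dots> = (FAr G (dclass Q (DPar f g)) \<cdot> FMul G (dsrc Q f) (dsrc Q g)) \<cdot> (ext (dsrc Q f) \<otimes> ext (dsrc Q g))"
    by (subst G.FAr_DPar) (simp_all del: F.tgt.tensor_cmp_simp)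
  also have "\<dots> = (FAr G (dclass Q (DPar f g)) \<cdot> ext (dsrc Q f @ dsrc Q g)) \<cdot> ?e"
    by (simp add: ext_mul)
  finally show ?case
    unfolding dsrc.simps dtgt.simps by (rule F.tgt.iso_cancel_right[rotated -1]) simp_all
next
  case (DSwap \<Gamma> \<Delta>)
  hence [simp]: "\<Gamma> \<in> lists (types Q)" "\<Delta> \<in> lists (types Q)" by auto
  let ?e = "FMul F \<Gamma> \<Delta>" and ?d = "dclass Q (DSwap \<Gamma> \<Delta>)"
  have "(ext (\<Delta> @ \<Gamma>) \<cdot> FAr F ?d) \<cdot> ?e = ext (\<Delta> @ \<Gamma>) \<cdot> (FMul F \<Delta> \<Gamma> \<cdot> symm D (FOb F \<Gamma>) (FOb F \<Delta>))"
    by (simp add: F.FAr_DSwap)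
  also have "\<dots> = (FMul G \<Delta> \<Gamma> \<cdot> (ext \<Delta> \<otimes> ext \<Gamma>)) \<cdot> symm D (FOb F \<Gamma>) (FOb F \<Delta>)"
    by (rule F.tgt.cmp_reassoc[OF ext_mul]) simp_all
  also have "\<dots> = FMul G \<Delta> \<Gamma> \<cdot> (symm D (FOb G \<Gamma>) (FOb G \<Delta>) \<cdot> (ext \<Gamma> \<otimes> ext \<Delta>))"
    by (simp add: F.tgt.natural_simps(3))
  also have "\<dots> = (FAr G ?d \<cdot> FMul G \<Gamma> \<Delta>) \<cdot> (ext \<Gamma> \<otimes> ext \<Delta>)"
    by (subst G.FAr_DSwap) simp_all
  also have "\<dots> = (FAr G ?d \<cdot> ext (\<Gamma> @ \<Delta>)) \<cdot> ?e"
    by (simp add: ext_mul)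
  finally show ?case
    unfolding dsrc.simps dtgt.simps by (rule F.tgt.iso_cancel_right[rotated -1]) simp_all
next
  case (DCopy \<Gamma>)
  hence [simp]: "\<Gamma> \<in> lists (types Q)" by auto
  have "ext (\<Gamma> @ \<Gamma>) \<cdot> (FMul F \<Gamma> \<Gamma> \<cdot> copy D (FOb F \<Gamma>)) = (FMul G \<Gamma> \<Gamma> \<cdot> (ext \<Gamma> \<otimes> ext \<Gamma>)) \<cdot> copy D (FOb F \<Gamma>)"
    by (rule F.tgt.cmp_reassoc[OF ext_mul]) simp_all
  also have "\<dots> = (FMul G \<Gamma> \<Gamma> \<cdot> copy D (FOb G \<Gamma>)) \<cdot> ext \<Gamma>"
    by (simp add: F.tgt.det_copy)
  finally show ?case by (simp add: F.FAr_DCopy G.FAr_DCopy)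
next
  case (DDisc \<Gamma>)
  thus ?case by (intro F.tgt.to_iso_unit_unique[of "FUnt G"]) simp_all
qed simp_all

lemma ext_transformation:
  assumes gen: "\<And>q. q \<in> queries Q \<Longrightarrow> inp Q q \<in> lists (types Q) \<Longrightarrow> outp Q q \<in> lists (types Q) \<Longrightarrow>
      ext (outp Q q) \<cdot> FAr F (dclass Q (DGen q)) = FAr G (dclass Q (DGen q)) \<cdot> ext (inp Q q)"
  shows "markov_transformation (free_markov Q) D F G ext"
proof
  fix X Y assume "X \<in> Ob (free_markov Q)" "Y \<in> Ob (free_markov Q)"
  thus "ext (X \<odot>\<^bsub>free_markov Q\<^esub> Y) \<cdot> FMul F X Y = FMul G X Y \<cdot> (ext X \<otimes> ext Y)" by (simp add: ext_mul)
next
  fix f X Y assume "f \<in> hom (free_markov Q) X Y"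
  thus "ext Y \<cdot> FAr F f = FAr G f \<cdot> ext X"
    by (elim free_homE) (use ext_natural[OF gen] in auto)
qed (auto simp: hom_def)

end

end

section \<open>Interpretation functors and wire permutations\<close>

context query_model begin

abbreviation model :: "('t list, ('t, 'q) diagram set, 'o, 'a) mfunctor" where
  "model \<equiv> interpretation_functor C Q ob ch"

lemma model_fields [simp]:
  "FOb model \<Gamma> = tens C (map ob \<Gamma>)"
  "FMul model \<Gamma> \<Delta> = tens_append C (map ob \<Gamma>) (map ob \<Delta>)"
  "FUnt model = Idn C (Unt C)"
  by (simp_all add: interpretation_functor_def)

lemma FAr_model [simp]: "well_typed Q d \<Longrightarrow> FAr model (dclass Q d) = interp d"
  using interp_deq[OF drep_dclass[of Q d]] by (simp add: interpretation_functor_def)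

lemma markov_functor_interpretation: "markov_functor (free_markov Q) C model"
proof
  fix f X Y assume "f \<in> hom (free_markov Q) X Y"
  thus "FAr model f \<in> hom C (FOb model X) (FOb model Y)"
    by (elim free_homE) (auto simp: hom_def)
next
  fix f X Y g Z assume "f \<in> hom (free_markov Q) X Y" "g \<in> hom (free_markov Q) Y Z"
  thus "FAr model (g \<cdot>\<^bsub>free_markov Q\<^esub> f) = FAr model g \<cdot> FAr model f"
    by (elim free_homE) simp
next
  fix f X X' g Y Y' assume "f \<in> hom (free_markov Q) X X'" "g \<in> hom (free_markov Q) Y Y'"
  thus "FAr model (f \<otimes>\<^bsub>free_markov Q\<^esub> g) \<cdot> FMul model X Y = FMul model X' Y' \<cdot> (FAr model f \<otimes> FAr model g)"
    by (elim free_homE) auto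
next
  fix X Y Z assume "X \<in> Ob (free_markov Q)" "Y \<in> Ob (free_markov Q)" "Z \<in> Ob (free_markov Q)"
  thus "FAr model (assoc (free_markov Q) X Y Z) \<cdot> FMul model (X \<odot>\<^bsub>free_markov Q\<^esub> Y) Z \<cdot> (FMul model X Y \<otimes> Idn C (FOb model Z))
      = FMul model X (Y \<odot>\<^bsub>free_markov Q\<^esub> Z) \<cdot> (Idn C (FOb model X) \<otimes> FMul model Y Z)
         \<cdot> assoc C (FOb model X) (FOb model Y) (FOb model Z)"
    using tens_append_assoc[of "map ob X" "map ob Y" "map ob Z"] by simp
qed (auto simp: hom_def tens_append_Nil2)

lemma functor_from_free_interpretation: "functor_from_free Q C model"
  by (intro functor_from_free.intro functor_between.intro markov_category_free markov_category_axioms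
      markov_functor_interpretation)

text \<open>Queries inside \<open>d\<close> do no harm if the interpretation is deterministic and no
  output comes out of one. In a distinct source list the traced position is the one that
  \<open>index_of\<close> finds.\<close>

lemma interp_select:
  assumes wt: "well_typed Q d" and "det (interp d)" "distinct (dsrc Q d)"
    and tr: "\<And>i. i < length (dtgt Q d) \<Longrightarrow> trace Q d i \<noteq> None"
  shows "interp d = wire_select C ob (dsrc Q d) (dtgt Q d)"
proof (rule select_eqI)
  fix i assume i: "i < length (dtgt Q d)"
  then obtain k where k: "trace Q d i = Some k" using tr by auto
  hence kl: "k < length (dsrc Q d)" "dsrc Q d ! k = dtgt Q d ! i" using trace_typed[OF wt i] by auto
  have "dtgt Q d ! i \<in> set (dsrc Q d)" using kl nth_mem by metis
  moreover have "index_of (dsrc Q d) (dtgt Q d ! i) = k" using kl assms(3) index_of_nth by metis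
  ultimately show "proj (map ob (dtgt Q d)) i \<cdot> interp d = wire_proj C ob (dsrc Q d) (dtgt Q d ! i)"
    using proj_interp[OF wt i k] wt by (simp add: wire_proj_eq)
next
  show "set (dtgt Q d) \<subseteq> set (dsrc Q d)"
    using tr trace_typed[OF wt] by (metis in_set_conv_nth not_None_eq nth_mem subsetI)
qed (use assms in simp_all)

end

text \<open>A diagram composed with an inverse has the trace of an identity. So no output can come
  out of a query, and the two traces are mutually inverse bijections that respect types.\<close>

lemma free_iso_trace:
  assumes wt: "well_typed Q d" and iso: "iso_arrow (free_markov Q) (dclass Q d)"
  shows "mset (dsrc Q d) = mset (dtgt Q d)" "i < length (dtgt Q d) \<Longrightarrow> trace Q d i \<noteq> None"
proof -
  let ?n = "length (dsrc Q d)" and ?m = "length (dtgt Q d)"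
  obtain K where "inverse_arrows (free_markov Q) (dclass Q d) K" using iso by (auto simp: iso_arrow_def)
  then obtain e where e: "well_typed Q e" "dsrc Q e = dtgt Q d" "dtgt Q e = dsrc Q d"
    and "dclass Q (DCmp e d) = dclass Q (DId (dsrc Q d))" "dclass Q (DCmp d e) = dclass Q (DId (dtgt Q d))"
    using wt by (auto simp: inverse_arrows_def elim!: free_homE)
  hence ed: "deq Q (DCmp e d) (DId (dsrc Q d))" and de: "deq Q (DCmp d e) (DId (dtgt Q d))"
    using wt by (simp_all add: dclass_eq_iff)
  have te: "\<exists>k. trace Q e i = Some k \<and> trace Q d k = Some i \<and> k < ?m \<and> dtgt Q d ! k = dsrc Q d ! i" if "i < ?n" for i
    using trace_deq[OF ed, of i] that e trace_typed[OF e(1), of i] by (auto simp: bind_eq_Some_conv)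
  have td: "\<exists>k. trace Q d i = Some k \<and> trace Q e k = Some i \<and> k < ?n \<and> dsrc Q d ! k = dtgt Q d ! i" if "i < ?m" for i
    using trace_deq[OF de, of i] that e trace_typed[OF wt, of i] by (auto simp: bind_eq_Some_conv)
  show "trace Q d i \<noteq> None" if "i < ?m" for i using td[OF that] by auto
  define t where "t i = the (trace Q d i)" for i
  have t: "t i < ?n" "dsrc Q d ! t i = dtgt Q d ! i" "trace Q e (t i) = Some i" if "i < ?m" for i
    using td[OF that] by (auto simp: t_def)
  have bij: "bij_betw t {..<?m} {..<?n}"
  proof (rule bij_betwI')
    fix i j assume ij: "i \<in> {..<?m}" "j \<in> {..<?m}"
    hence "t i = t j \<Longrightarrow> Some i = Some j" using t(3)[of i] t(3)[of j] by (metis lessThan_iff)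
    thus "(t i = t j) = (i = j)" by blast
  next
    fix k assume "k \<in> {..<?n}"
    then obtain i where "trace Q d i = Some k" "i < ?m" using te[of k] by blast
    thus "\<exists>i \<in> {..<?m}. k = t i" by (intro bexI[of _ i]) (simp_all add: t_def)
  next
    fix i assume "i \<in> {..<?m}"
    thus "t i \<in> {..<?n}" using t(1)[of i] by blast
  qed
  \<comment> \<open>A list is turned into a family over its positions, to which the bijection of
    positions can be applied.\<close>
  have list: "mset xs = image_mset (nth xs) (mset_set {..<length xs})" for xs :: "'a list"
  proof -
    have "mset xs = mset (map (nth xs) [0..<length xs])" by (simp only: map_nth)
    also have "\<dots> = image_mset (nth xs) (mset_set {..<length xs})" by (simp only: mset_map mset_upt atLeast0LessThan)
    finally show ?thesis .
  qed
  have "mset (dtgt Q d) = image_mset (\<lambda>i. dsrc Q d ! t i) (mset_set {..<?m})"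
    using list[of "dtgt Q d"] t(2) by (auto intro: image_mset_cong)
  also have "\<dots> = image_mset (nth (dsrc Q d)) (image_mset t (mset_set {..<?m}))"
    by (simp add: image_mset.compositionality comp_def)
  also have "image_mset t (mset_set {..<?m}) = mset_set {..<?n}"
    using bij by (simp add: image_mset_mset_set bij_betw_def)
  finally show "mset (dsrc Q d) = mset (dtgt Q d)" unfolding list[of "dsrc Q d"] by simp
qed

lemma free_iso_mset:
  assumes "K \<in> hom (free_markov Q) \<Gamma> \<Delta>" "iso_arrow (free_markov Q) K"
  shows "mset \<Gamma> = mset \<Delta>"
  using assms free_iso_trace(1) by (auto elim!: free_homE)

text \<open>The representative may contain queries, so determinism of its interpretation is not read
  off the diagram but transported by the functor.\<close>

lemma (in query_model) model_det_iso:
  assumes "K \<in> hom (free_markov Q) \<Gamma> \<Delta>" "iso_arrow (free_markov Q) K" "deterministic (free_markov Q) K" "distinct \<Gamma>"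
  shows "FAr model K = wire_select C ob \<Gamma> \<Delta>"
proof -
  interpret F: functor_from_free Q C model by (rule functor_from_free_interpretation)
  obtain d where d: "well_typed Q d" "dsrc Q d = \<Gamma>" "dtgt Q d = \<Delta>" "K = dclass Q d"
    using assms(1) by (rule free_homE)
  have "det (interp d)" using F.functor_det[OF assms(3)] d by simp
  thus ?thesis using interp_select[OF d(1)] free_iso_trace(2)[OF d(1)] assms d by auto
qed

section \<open>The free Markov category as a model of its own signature\<close>

abbreviation free_select :: "('t, 'q) signature \<Rightarrow> 't list \<Rightarrow> 't list \<Rightarrow> ('t, 'q) diagram set" where
  "free_select Q \<equiv> wire_select (free_markov Q) (\<lambda>x. [x])"

lemma tens_free [simp]: "tens (free_markov Q) As = concat As"
proof (induction As)
  case (Cons A As)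
  thus ?case by (cases As) auto
qed simp

lemma tens_append_free:
  assumes "set As \<subseteq> lists (types Q)" "set Bs \<subseteq> lists (types Q)"
  shows "tens_append (free_markov Q) As Bs = dclass Q (DId (concat As @ concat Bs))"
  using assms(1)
proof (induction As)
  case Nil
  thus ?case by simp
next
  case (Cons A As)
  interpret markov_category "free_markov Q" by (rule markov_category_free)
  have A: "A \<in> lists (types Q)" "concat As \<in> lists (types Q)" "concat Bs \<in> lists (types Q)"
    using Cons.prems assms(2) by fastforce+
  have inv: "inv_arrow (free_markov Q) (dclass Q (DId \<Gamma>)) = dclass Q (DId \<Gamma>)" if "\<Gamma> \<in> lists (types Q)" for \<Gamma>
    using inv_id[of \<Gamma>] that by simp
  have cons: "tens_cons (free_markov Q) A Xs = dclass Q (DId (A @ concat Xs))" for Xs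
    using tens_free[of Q "A # Xs"] by (auto simp: tens_cons_def)
  show ?case using Cons A by (simp add: cons inv)
qed

lemma query_model_free: "query_model (free_markov Q) Q (\<lambda>x. [x]) (\<lambda>q. dclass Q (DGen q))"
proof -
  interpret markov_category "free_markov Q" by (rule markov_category_free)
  show ?thesis by standard (auto intro!: free_homI)
qed

text \<open>The tautological model: interpretation is the quotient map. Results about every model
  thereby become equations in the free category.\<close>

lemma interpret_free:
  assumes "well_typed Q d"
  shows "interpret_diagram (free_markov Q) Q (\<lambda>x. [x]) (\<lambda>q. dclass Q (DGen q)) d = dclass Q d"
proof -
  interpret query_model "free_markov Q" Q "\<lambda>x. [x]" "\<lambda>q. dclass Q (DGen q)" by (rule query_model_free)
  have inv: "inv_arrow (free_markov Q) (dclass Q (DId \<Gamma>)) = dclass Q (DId \<Gamma>)" if "\<Gamma> \<in> lists (types Q)" for \<Gamma>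
    using inv_id[of \<Gamma>] that by simp
  have app: "tens_append (free_markov Q) (map (\<lambda>x. [x]) \<Gamma>) (map (\<lambda>x. [x]) \<Delta>) = dclass Q (DId (\<Gamma> @ \<Delta>))"
    if "\<Gamma> \<in> lists (types Q)" "\<Delta> \<in> lists (types Q)" for \<Gamma> \<Delta>
    using that by (subst tens_append_free) auto
  show ?thesis
    using assms by (induction d) (simp_all add: app inv)
qed

lemma free_det_iso:
  assumes "K \<in> hom (free_markov Q) \<Gamma> \<Delta>" "iso_arrow (free_markov Q) K" "deterministic (free_markov Q) K" "distinct \<Gamma>"
  shows "K = free_select Q \<Gamma> \<Delta>"
proof -
  interpret query_model "free_markov Q" Q "\<lambda>x. [x]" "\<lambda>q. dclass Q (DGen q)" by (rule query_model_free)
  obtain d where "well_typed Q d" "K = dclass Q d" using assms(1) by (rule free_homE)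
  thus ?thesis using model_det_iso[OF assms] by (simp add: interpret_free)
qed

lemma free_select_props:
  assumes "\<Gamma> \<in> lists (types Q)" "distinct \<Gamma>" "mset \<Delta> = mset \<Gamma>"
  shows "free_select Q \<Gamma> \<Delta> \<in> hom (free_markov Q) \<Gamma> \<Delta>" "iso_arrow (free_markov Q) (free_select Q \<Gamma> \<Delta>)"
    "deterministic (free_markov Q) (free_select Q \<Gamma> \<Delta>)"
proof -
  interpret query_model "free_markov Q" Q "\<lambda>x. [x]" "\<lambda>q. dclass Q (DGen q)" by (rule query_model_free)
  have \<Delta>: "set \<Delta> = set \<Gamma>" "distinct \<Delta>" using assms by (metis mset_eq_setD, metis mset_eq_imp_distinct_iff)
  have ob: "(\<lambda>x. [x]) ` set \<Gamma> \<subseteq> Ob (free_markov Q)" using assms(1) by auto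
  show "free_select Q \<Gamma> \<Delta> \<in> hom (free_markov Q) \<Gamma> \<Delta>"
    using wire_select_simps[of \<Delta> \<Gamma> "\<lambda>x. [x]"] ob \<Delta> unfolding hom_def by (simp del: free_fields)
  show "iso_arrow (free_markov Q) (free_select Q \<Gamma> \<Delta>)"
    by (rule select_iso) (use ob \<Delta> assms in auto)
  show "deterministic (free_markov Q) (free_select Q \<Gamma> \<Delta>)"
    by (rule wire_select_simps(4)) (use ob \<Delta> in auto)
qed

section \<open>Queries up to reordering of wires\<close>

lemma wire_permutation_structural: "wire_permutation p \<Longrightarrow> generators p = {}"
  by (induction p) auto

lemma wire_permutation_mset: "wire_permutation p \<Longrightarrow> well_typed Q p \<Longrightarrow> mset (dsrc Q p) = mset (dtgt Q p)"
  by (induction p) auto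

lemma wire_permutation_select:
  assumes "wire_permutation p" "well_typed Q p" "distinct (dsrc Q p)"
  shows "dclass Q p = free_select Q (dsrc Q p) (dtgt Q p)"
proof -
  interpret query_model "free_markov Q" Q "\<lambda>x. [x]" "\<lambda>q. dclass Q (DGen q)" by (rule query_model_free)
  have g: "generators p = {}" by (rule wire_permutation_structural[OF assms(1)])
  show ?thesis
    using interp_select[OF assms(2) interp_structural_det[OF assms(2) g] assms(3) trace_structural[OF assms(2) g]]
      interpret_free[OF assms(2)] by simp
qed

lemma ex_wire_permutation:
  assumes "mset \<Gamma> = mset \<Delta>" "\<Gamma> \<in> lists (types Q)"
  shows "\<exists>p. wire_permutation p \<and> well_typed Q p \<and> dsrc Q p = \<Gamma> \<and> dtgt Q p = \<Delta>"
  using assms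
proof (induction \<Gamma> arbitrary: \<Delta>)
  case Nil
  thus ?case by (intro exI[of _ "DId []"]) simp
next
  case (Cons x \<Gamma>)
  have "x \<in> set \<Delta>" using Cons.prems(1) by (metis list.set_intros(1) mset_eq_setD)
  then obtain D E where \<Delta>: "\<Delta> = D @ x # E" by (meson split_list)
  hence m: "mset \<Gamma> = mset (D @ E)" using Cons.prems by simp
  then obtain p where p: "wire_permutation p" "well_typed Q p" "dsrc Q p = \<Gamma>" "dtgt Q p = D @ E"
    using Cons.IH[OF m] Cons.prems(2) by auto
  have "D @ E \<in> lists (types Q)" using p well_typed_lists(2)[OF p(2)] by simp
  \<comment> \<open>The tail is permuted next to the wire \<open>x\<close>, and then
    \<open>x\<close> crosses the block \<open>D\<close>.\<close>
  thus ?case using p Cons.prems \<Delta>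
    by (intro exI[of _ "DCmp (DPar (DSwap [x] D) (DId E)) (DPar (DId [x]) p)"]) auto
qed

text \<open>With distinct lists a reordering depends only on its two ends, so the unknown
  permutations of \<open>is_query\<close> become the canonical \<open>free_select\<close>.\<close>

lemma is_queryE:
  assumes "is_query Q K" "K \<in> hom (free_markov Q) \<Gamma> \<Delta>"
    and dist: "\<And>q. q \<in> queries Q \<Longrightarrow> distinct (inp Q q) \<and> distinct (outp Q q)"
  obtains q where "q \<in> queries Q" "inp Q q \<in> lists (types Q)" "outp Q q \<in> lists (types Q)"
    "mset \<Gamma> = mset (inp Q q)" "mset \<Delta> = mset (outp Q q)"
    "K = free_select Q (outp Q q) \<Delta> \<cdot>\<^bsub>free_markov Q\<^esub> dclass Q (DGen q) \<cdot>\<^bsub>free_markov Q\<^esub> free_select Q \<Gamma> (inp Q q)"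
proof -
  obtain q p p' where p: "wire_permutation p" "wire_permutation p'" and wt: "well_typed Q (DCmp p' (DCmp (DGen q) p))"
    and K: "K = dclass Q (DCmp p' (DCmp (DGen q) p))"
    using assms(1) by (auto simp: is_query_def)
  have \<Gamma>: "dsrc Q p = \<Gamma>" "dtgt Q p' = \<Delta>" using assms(2) wt unfolding K hom_def by simp_all
  have m: "mset \<Gamma> = mset (inp Q q)" "mset \<Delta> = mset (outp Q q)"
    using wire_permutation_mset[OF p(1), of Q] wire_permutation_mset[OF p(2), of Q] wt \<Gamma> by auto
  have "distinct \<Gamma>" "distinct (outp Q q)" using dist[of q] m(1) wt by (auto dest: mset_eq_imp_distinct_iff)
  hence "dclass Q p = free_select Q \<Gamma> (inp Q q)" "dclass Q p' = free_select Q (outp Q q) \<Delta>"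
    using wire_permutation_select[OF p(1), of Q] wire_permutation_select[OF p(2), of Q] wt \<Gamma> by auto
  moreover have "K = dclass Q p' \<cdot>\<^bsub>free_markov Q\<^esub> dclass Q (DGen q) \<cdot>\<^bsub>free_markov Q\<^esub> dclass Q p"
    using K wt by simp
  ultimately show thesis using that[of q] m wt by simp
qed

lemma is_queryI:
  assumes q: "q \<in> queries Q" "inp Q q \<in> lists (types Q)" "outp Q q \<in> lists (types Q)"
    and m: "mset \<Gamma> = mset (inp Q q)" "mset \<Delta> = mset (outp Q q)"
    and dist: "distinct (inp Q q)" "distinct (outp Q q)"
  shows "is_query Q (free_select Q (outp Q q) \<Delta> \<cdot>\<^bsub>free_markov Q\<^esub> dclass Q (DGen q) \<cdot>\<^bsub>free_markov Q\<^esub> free_select Q \<Gamma> (inp Q q))"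
proof -
  have \<Gamma>: "\<Gamma> \<in> lists (types Q)" "distinct \<Gamma>"
    using q(2) mset_eq_setD[OF m(1)] dist(1) mset_eq_imp_distinct_iff[OF m(1)] by auto
  obtain p where p: "wire_permutation p" "well_typed Q p" "dsrc Q p = \<Gamma>" "dtgt Q p = inp Q q"
    using ex_wire_permutation[OF m(1) \<Gamma>(1)] by blast
  obtain p' where p': "wire_permutation p'" "well_typed Q p'" "dsrc Q p' = outp Q q" "dtgt Q p' = \<Delta>"
    using ex_wire_permutation[OF m(2)[symmetric] q(3)] by blast
  have "free_select Q \<Gamma> (inp Q q) = dclass Q p" "free_select Q (outp Q q) \<Delta> = dclass Q p'"
    using wire_permutation_select[OF p(1,2)] wire_permutation_select[OF p'(1,2)] p p' \<Gamma> dist by auto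
  thus ?thesis using p p' q unfolding is_query_def by (intro exI[of _ q] exI[of _ p] exI[of _ p']) simp
qed


section \<open>Channels of causal models\<close>

locale causal_model_in = markov_category C + is_causal_model C M
  for C :: "('o, 'a) markov_data" (structure) and M :: "('v, 'o, 'a) causal_model"
begin

abbreviation wires :: "'v list \<Rightarrow> 'o" where "wires ws \<equiv> tens C (map (vob M) ws)"
abbreviation sel :: "'v list \<Rightarrow> 'v list \<Rightarrow> 'a" where "sel \<equiv> wire_select C (vob M)"

lemma set_listing [simp]: "set (listing M A) = A \<inter> verts M"
  by (auto simp: listing_def verts_def)

lemma distinct_listing [simp]: "distinct (listing M A)"
  using distinct_vlist by (simp add: listing_def)

lemma parents_verts: "parents M X \<subseteq> verts M"
  using edges_verts by (auto simp: parents_def)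

lemma parents_Int_verts [simp]: "parents M X \<inter> verts M = parents M X"
  using parents_verts by auto

lemma vob_wires [simp]: "set ws \<subseteq> verts M \<Longrightarrow> vob M ` set ws \<subseteq> Ob C"
  using vob_ob by auto

lemma nin_verts: "nin M \<subseteq> verts M"
  by (auto simp: nin_def)

text \<open>Justifies the choice in the definition: a finite acyclic relation is well-founded, and a
  minimal remaining vertex can always go first.\<close>

lemma topological_order:
  "distinct (topological_order M)" "set (topological_order M) = verts M"
  "sorted_wrt (\<lambda>X Y. (Y, X) \<notin> edges M) (topological_order M)"
proof -
  have fin: "finite (verts M)" by (simp add: verts_def)
  hence wf: "wf (edges M)"
    using edges_verts acyclic_edges by (metis finite_acyclic_wf finite_cartesian_product finite_subset)
  have "\<exists>ts. distinct ts \<and> set ts = A \<and> sorted_wrt (\<lambda>X Y. (Y, X) \<notin> edges M) ts" if "finite A" for A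
    using that
  proof (induction A rule: finite_psubset_induct)
    case (psubset A)
    show ?case
    proof (cases "A = {}")
      case False
      then obtain X where X: "X \<in> A" "\<And>Y. (Y, X) \<in> edges M \<Longrightarrow> Y \<notin> A"
        using wf by (metis ex_in_conv wfE_min)
      then obtain ts where "distinct ts" "set ts = A - {X}" "sorted_wrt (\<lambda>X Y. (Y, X) \<notin> edges M) ts"
        using psubset.IH[of "A - {X}"] by auto
      thus ?thesis using X by (intro exI[of _ "X # ts"]) auto
    qed simp
  qed
  hence "\<exists>ts. distinct ts \<and> set ts = verts M \<and> sorted_wrt (\<lambda>X Y. (Y, X) \<notin> edges M) ts" using fin .
  from someI_ex[OF this]
  show "distinct (topological_order M)" "set (topological_order M) = verts M"
    "sorted_wrt (\<lambda>X Y. (Y, X) \<notin> edges M) (topological_order M)"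
    by (auto simp: topological_order_def)
qed

text \<open>The invariant of \<open>run_mechs\<close> with wires \<open>ws\<close> present and
  mechanisms \<open>ts\<close> pending. Sortedness and acyclicity ensure that the parents of the
  next variable are already among \<open>ws\<close>.\<close>

definition runnable :: "'v list \<Rightarrow> 'v list \<Rightarrow> 'v list \<Rightarrow> bool" where
  "runnable ws ts os \<longleftrightarrow> distinct ws \<and> set ws \<subseteq> verts M \<and> set ts \<subseteq> nin M \<and> distinct ts \<and> set ws \<inter> set ts = {}
    \<and> set os \<subseteq> set ws \<union> set ts \<and> sorted_wrt (\<lambda>X Y. (Y, X) \<notin> edges M) ts
    \<and> (\<forall>X \<in> set ts. parents M X \<subseteq> set ws \<union> set ts)"

lemma runnable_Cons:
  assumes "runnable ws (X # ts) os"
  shows "X \<in> nin M" "X \<notin> set ws" "X \<in> verts M" "parents M X \<subseteq> set ws" "runnable (X # ws) ts os" "set ws \<subseteq> verts M"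
    "distinct ws"
proof -
  have "(X, X) \<notin> edges M" using acyclic_edges by (auto simp: acyclic_def)
  thus "parents M X \<subseteq> set ws" using assms by (auto simp: runnable_def parents_def)
  show "X \<in> nin M" "X \<notin> set ws" "X \<in> verts M" "runnable (X # ws) ts os" "set ws \<subseteq> verts M" "distinct ws"
    using assms nin_verts by (auto simp: runnable_def)
qed

lemma runnable_outs: "runnable ws ts os \<Longrightarrow> set os \<subseteq> verts M"
  unfolding runnable_def using nin_verts by blast

lemma mech_simps [simp]:
  assumes "X \<in> nin M"
  shows "mech M X \<in> Ar C" "Dom C (mech M X) = tens C (map (vob M) (listing M (parents M X)))" "Cod C (mech M X) = vob M X"
  using mech_hom[OF assms] by (auto simp: hom_def)

lemma add_mech_simps:
  assumes "X \<in> nin M" "parents M X \<subseteq> set ws" "set ws \<subseteq> verts M"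
  shows "add_mech C M ws X \<in> Ar C" "Dom C (add_mech C M ws X) = wires ws"
    "Cod C (add_mech C M ws X) = wires (X # ws)"
proof -
  have [simp]: "vob M X \<in> Ob C" using assms nin_verts vob_ob by auto
  show "add_mech C M ws X \<in> Ar C" "Dom C (add_mech C M ws X) = wires ws"
    "Cod C (add_mech C M ws X) = wires (X # ws)"
    using assms by (simp_all add: add_mech_def)
qed

lemma run_simps:
  assumes "runnable ws ts os"
  shows "run_mechs C M ws ts os \<in> Ar C \<and> Dom C (run_mechs C M ws ts os) = wires ws
    \<and> Cod C (run_mechs C M ws ts os) = wires os"
  using assms
proof (induction ts arbitrary: ws)
  case Nil
  thus ?case by (simp add: runnable_def)
next
  case (Cons X ts)
  thus ?case using runnable_Cons[OF Cons.prems] Cons.IH[of "X # ws"] by (simp add: add_mech_simps)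
qed

text \<open>Both sides are deterministic and are compared wire by wire;
  \<open>X \<notin> set ws\<close> prevents an old wire from being confused with the new
  one.\<close>

lemma select_cons:
  assumes "X \<notin> set ws" "set ws \<subseteq> set ws'" "set ws' \<subseteq> verts M" "X \<in> verts M"
  shows "sel (X # ws') (X # ws) \<cdot> tens_cons C (vob M X) (map (vob M) ws')
    = tens_cons C (vob M X) (map (vob M) ws) \<cdot> (Idn C (vob M X) \<otimes> sel ws' ws)"
proof (rule det_ext[of _ _ "map (vob M) (X # ws)"])
  note [simp del] = wire_select.simps
  have [simp]: "vob M X \<in> Ob C" "set ws \<subseteq> verts M" using assms vob_ob by auto
  have "set (X # ws) \<subseteq> set (X # ws')" "vob M ` set (X # ws') \<subseteq> Ob C" using assms vob_ob by auto
  note [simp] = wire_select_simps[OF this, simplified]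
  show "det (sel (X # ws') (X # ws) \<cdot> tens_cons C (vob M X) (map (vob M) ws'))"
    "det (tens_cons C (vob M X) (map (vob M) ws) \<cdot> (Idn C (vob M X) \<otimes> sel ws' ws))"
    "Cod C (sel (X # ws') (X # ws) \<cdot> tens_cons C (vob M X) (map (vob M) ws')) = wires (X # ws)"
    "Cod C (tens_cons C (vob M X) (map (vob M) ws) \<cdot> (Idn C (vob M X) \<otimes> sel ws' ws)) = wires (X # ws)"
    "Dom C (sel (X # ws') (X # ws) \<cdot> tens_cons C (vob M X) (map (vob M) ws'))
      = Dom C (tens_cons C (vob M X) (map (vob M) ws) \<cdot> (Idn C (vob M X) \<otimes> sel ws' ws))"
    "set (map (vob M) (X # ws)) \<subseteq> Ob C"
    using assms by simp_all
  fix i assume i: "i < length (map (vob M) (X # ws))"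
  have 1: "proj (map (vob M) (X # ws)) i \<cdot> (sel (X # ws') (X # ws) \<cdot> tens_cons C (vob M X) (map (vob M) ws'))
    = wire_proj C (vob M) (X # ws') ((X # ws) ! i) \<cdot> tens_cons C (vob M X) (map (vob M) ws')"
    by (rule cmp_reassoc[OF proj_select]) (use assms i in \<open>simp_all add: subset_insertI2\<close>)
  show "proj (map (vob M) (X # ws)) i \<cdot> (sel (X # ws') (X # ws) \<cdot> tens_cons C (vob M X) (map (vob M) ws'))
    = proj (map (vob M) (X # ws)) i \<cdot> (tens_cons C (vob M X) (map (vob M) ws) \<cdot> (Idn C (vob M X) \<otimes> sel ws' ws))"
  proof (cases i)
    case 0
    thus ?thesis unfolding 1 using assms by simp
  next
    case (Suc j)
    hence j: "j < length ws" using i by simp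
    hence "ws ! j \<in> set ws'" "X \<noteq> ws ! j" using assms by auto
    moreover have "proj (map (vob M) ws) j \<cdot> (sel ws' ws \<cdot> k) = wire_proj C (vob M) ws' (ws ! j) \<cdot> k"
      if "k \<in> Ar C" "Cod C k = wires ws'" for k
      by (rule cmp_reassoc[OF proj_select]) (use assms j that in simp_all)
    ultimately show ?thesis unfolding 1 using assms Suc j by simp
  qed
qed

lemma select_tail:
  assumes "X \<notin> set ws" "distinct ws" "set ws \<subseteq> verts M" "X \<in> verts M"
  shows "sel (X # ws) ws \<cdot> tens_cons C (vob M X) (map (vob M) ws) = pr2 (vob M X) (wires ws)"
proof (rule det_ext_wire)
  have [simp]: "vob M X \<in> Ob C" using assms vob_ob by auto
  have "set ws \<subseteq> set (X # ws)" "vob M ` set (X # ws) \<subseteq> Ob C" using assms vob_ob by auto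
  note [simp] = wire_select_simps[OF this, simplified]
  show "det (sel (X # ws) ws \<cdot> tens_cons C (vob M X) (map (vob M) ws))"
    "det (pr2 (vob M X) (wires ws))"
    "Cod C (sel (X # ws) ws \<cdot> tens_cons C (vob M X) (map (vob M) ws)) = wires ws"
    "Cod C (pr2 (vob M X) (wires ws)) = wires ws"
    "Dom C (sel (X # ws) ws \<cdot> tens_cons C (vob M X) (map (vob M) ws)) = Dom C (pr2 (vob M X) (wires ws))"
    "vob M ` set ws \<subseteq> Ob C" "distinct ws"
    using assms by simp_all
  fix z assume z: "z \<in> set ws"
  hence "X \<noteq> z" using assms by auto
  thus "wire_proj C (vob M) ws z \<cdot> (sel (X # ws) ws \<cdot> tens_cons C (vob M X) (map (vob M) ws))
    = wire_proj C (vob M) ws z \<cdot> pr2 (vob M X) (wires ws)"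
    using z assms by (subst wire_proj_select_reassoc) auto
qed

text \<open>A selection is deterministic and so passes the copy inside \<open>add_mech\<close>; in
  the branch of the mechanism it merges with the selection of the parents.\<close>

lemma add_mech_select:
  assumes "X \<in> nin M" "X \<notin> set ws" "parents M X \<subseteq> set ws" "set ws \<subseteq> set ws'" "set ws' \<subseteq> verts M"
  shows "add_mech C M ws X \<cdot> sel ws' ws = sel (X # ws') (X # ws) \<cdot> add_mech C M ws' X"
proof -
  note [simp del] = wire_select.simps
  have [simp]: "vob M X \<in> Ob C" "set ws \<subseteq> verts M" "X \<in> verts M" using assms vob_ob nin_verts by auto
  have ws': "parents M X \<subseteq> set ws'" using assms by auto
  let ?s = "sel" and ?pa = "listing M (parents M X)"
  have "add_mech C M ws X \<cdot> ?s ws' ws = tens_cons C (vob M X) (map (vob M) ws)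
      \<cdot> ((mech M X \<cdot> ?s ws' ?pa) \<otimes> ?s ws' ws) \<cdot> copy C (wires ws')"
    using assms ws' by (simp add: add_mech_def det_copy)
  also have "\<dots> = (tens_cons C (vob M X) (map (vob M) ws) \<cdot> (Idn C (vob M X) \<otimes> ?s ws' ws))
      \<cdot> (((mech M X \<cdot> ?s ws' ?pa) \<otimes> Idn C (wires ws')) \<cdot> copy C (wires ws'))"
    using assms ws' by simp
  also have "\<dots> = (?s (X # ws') (X # ws) \<cdot> tens_cons C (vob M X) (map (vob M) ws'))
      \<cdot> (((mech M X \<cdot> ?s ws' ?pa) \<otimes> Idn C (wires ws')) \<cdot> copy C (wires ws'))"
    using assms by (subst select_cons) auto
  also have "\<dots> = ?s (X # ws') (X # ws) \<cdot> add_mech C M ws' X"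
  proof -
    have "set (X # ws) \<subseteq> set (X # ws')" "vob M ` set (X # ws') \<subseteq> Ob C" using assms vob_ob by auto
    note wire_select_simps[OF this]
    thus ?thesis using assms ws' unfolding add_mech_def by (intro cmpA) simp_all
  qed
  finally show ?thesis .
qed

text \<open>The selection is pushed through one mechanism at a time until the final output selection
  absorbs it. This serves both to reorder inputs and to ignore surplus wires.\<close>

lemma run_select_in:
  assumes "runnable ws ts os" "set ws \<subseteq> set ws'" "set ws' \<subseteq> verts M" "set ws' \<inter> set ts = {}"
  shows "run_mechs C M ws ts os \<cdot> sel ws' ws = run_mechs C M ws' ts os"
  using assms
proof (induction ts arbitrary: ws ws')
  case Nil
  thus ?case by (simp add: runnable_def)
next
  case (Cons X ts)
  note r = runnable_Cons[OF Cons.prems(1)]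
  note [simp del] = wire_select.simps
  have vX: "vob M X \<in> Ob C" using r vob_ob by auto
  have "run_mechs C M ws (X # ts) os \<cdot> sel ws' ws
    = run_mechs C M (X # ws) ts os \<cdot> (add_mech C M ws X \<cdot> sel ws' ws)"
    using r run_simps[OF r(5)] Cons.prems by (simp add: add_mech_simps)
  also have "\<dots> = run_mechs C M (X # ws) ts os \<cdot> (sel (X # ws') (X # ws) \<cdot> add_mech C M ws' X)"
    using r Cons.prems by (simp add: add_mech_select)
  also have "\<dots> = run_mechs C M (X # ws') ts os \<cdot> add_mech C M ws' X"
  proof (rule cmp_reassoc[OF Cons.IH])
    show "runnable (X # ws) ts os" by (rule r(5))
    show "set (X # ws) \<subseteq> set (X # ws')" "set (X # ws') \<subseteq> verts M" "set (X # ws') \<inter> set ts = {}"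
      using Cons.prems r by (auto simp: runnable_def)
    have "parents M X \<subseteq> set ws'" using r Cons.prems by auto
    note a = add_mech_simps[OF r(1) this Cons.prems(3)]
    have "set (X # ws) \<subseteq> set (X # ws')" "vob M ` set (X # ws') \<subseteq> Ob C" using Cons.prems vX by auto
    note s = wire_select_simps[OF this]
    show "add_mech C M ws' X \<in> Ar C" by (rule a)
    show "sel (X # ws') (X # ws) \<in> Ar C" "run_mechs C M (X # ws) ts os \<in> Ar C"
      "Dom C (sel (X # ws') (X # ws)) = Cod C (add_mech C M ws' X)"
      "Dom C (run_mechs C M (X # ws) ts os) = Cod C (sel (X # ws') (X # ws))"
      using a s run_simps[OF r(5)] Cons.prems vX by auto
  qed
  finally show ?case by simp
qed

lemma run_select_out:
  assumes "runnable ws ts os" "set os' \<subseteq> set os"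
  shows "sel os os' \<cdot> run_mechs C M ws ts os = run_mechs C M ws ts os'"
  using assms
proof (induction ts arbitrary: ws)
  case Nil
  thus ?case by (simp add: runnable_def)
next
  case (Cons X ts)
  note r = runnable_Cons[OF Cons.prems(1)]
  have os: "set os \<subseteq> verts M" by (rule runnable_outs[OF Cons.prems(1)])
  have "sel os os' \<cdot> (run_mechs C M (X # ws) ts os \<cdot> add_mech C M ws X)
    = run_mechs C M (X # ws) ts os' \<cdot> add_mech C M ws X"
    by (rule cmp_reassoc[OF Cons.IH[OF r(5)]]) (use r run_simps[OF r(5)] Cons.prems os in \<open>simp_all add: add_mech_simps\<close>)
  thus ?case by simp
qed

text \<open>A variable failing \<open>P\<close> is neither output nor read by a mechanism that is
  kept. So its wire is discarded, and discarding the output of a channel undoes the copy that fed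
  it.\<close>

lemma run_filter:
  assumes "runnable ws ts os"
    and "\<And>X. X \<in> set ts \<Longrightarrow> \<not> P X \<Longrightarrow> X \<notin> set os"
    and "\<And>X Y. X \<in> set ts \<Longrightarrow> Y \<in> set ts \<Longrightarrow> X \<in> parents M Y \<Longrightarrow> P Y \<Longrightarrow> P X"
  shows "run_mechs C M ws (filter P ts) os = run_mechs C M ws ts os"
  using assms
proof (induction ts arbitrary: ws)
  case (Cons X ts)
  note r = runnable_Cons[OF Cons.prems(1)]
  have IH: "run_mechs C M (X # ws) (filter P ts) os = run_mechs C M (X # ws) ts os"
    by (rule Cons.IH[OF r(5)]) (use Cons.prems(2,3) in auto)
  show ?case
  proof (cases "P X")
    case False
    \<comment> \<open>The kept mechanisms must be runnable without the wire of the skipped variable;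
      this is where closure of \<open>P\<close> under parents enters.\<close>
    have nP: "runnable ws (filter P ts) os"
      unfolding runnable_def
    proof (intro conjI ballI)
      have R: "distinct ws" "set ws \<subseteq> verts M" "set (X # ts) \<subseteq> nin M" "distinct (X # ts)" "set ws \<inter> set (X # ts) = {}"
        "set os \<subseteq> set ws \<union> set (X # ts)" "sorted_wrt (\<lambda>X Y. (Y, X) \<notin> edges M) (X # ts)"
        "\<And>Y. Y \<in> set (X # ts) \<Longrightarrow> parents M Y \<subseteq> set ws \<union> set (X # ts)"
        using Cons.prems(1) unfolding runnable_def by blast+
      show "distinct ws" "set ws \<subseteq> verts M" by (rule R)+
      show "set (filter P ts) \<subseteq> nin M" "set ws \<inter> set (filter P ts) = {}" "distinct (filter P ts)"
        using R(3-5) by auto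
      show "sorted_wrt (\<lambda>X Y. (Y, X) \<notin> edges M) (filter P ts)" using R(7) by (simp add: sorted_wrt_filter)
      show "set os \<subseteq> set ws \<union> set (filter P ts)"
      proof
        fix Y assume Y: "Y \<in> set os"
        hence "P Y" if "Y \<in> set (X # ts)" using Cons.prems(2)[OF that] by blast
        thus "Y \<in> set ws \<union> set (filter P ts)" using Y R(6) False by fastforce
      qed
      fix Y assume "Y \<in> set (filter P ts)"
      hence Y: "Y \<in> set (X # ts)" "P Y" by auto
      show "parents M Y \<subseteq> set ws \<union> set (filter P ts)"
      proof
        fix Z assume Z: "Z \<in> parents M Y"
        hence "P Z" if "Z \<in> set (X # ts)" using Cons.prems(3)[OF that Y(1) _ Y(2)] by blast
        thus "Z \<in> set ws \<union> set (filter P ts)" using Z R(8)[OF Y(1)] False by fastforce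
      qed
    qed
    have vX: "vob M X \<in> Ob C" using r vob_ob by auto
    let ?c = "copy C (wires ws)" and ?s = "sel (X # ws) ws"
    let ?m = "mech M X \<cdot> sel ws (listing M (parents M X))"
    have "set ws \<subseteq> set (X # ws)" "vob M ` set (X # ws) \<subseteq> Ob C" using r vob_ob by auto
    note s = wire_select_simps[OF this]
    have "?s \<cdot> add_mech C M ws X = pr2 (vob M X) (wires ws) \<cdot> ((?m \<otimes> Idn C (wires ws)) \<cdot> ?c)"
      unfolding add_mech_def by (rule cmp_reassoc[OF select_tail]) (use r vX s in simp_all)
    also have "\<dots> = Idn C (wires ws)" using r vX by simp
    finally have tail: "?s \<cdot> add_mech C M ws X = Idn C (wires ws)" .
    \<comment> \<open>By the induction hypothesis only kept mechanisms run after \<open>X\<close>,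
      so the rest of the run factors through dropping the new wire.\<close>
    have "run_mechs C M ws (X # ts) os = (run_mechs C M ws (filter P ts) os \<cdot> ?s) \<cdot> add_mech C M ws X"
    proof -
      have "set ws \<subseteq> set (X # ws)" "set (X # ws) \<subseteq> verts M" "set (X # ws) \<inter> set (filter P ts) = {}"
        using r Cons.prems(1) unfolding runnable_def by auto
      from run_select_in[OF nP this] show ?thesis by (simp add: IH)
    qed
    also have "\<dots> = run_mechs C M ws (filter P ts) os \<cdot> (?s \<cdot> add_mech C M ws X)"
      using run_simps[OF nP] r s by (intro cmpA) (simp_all add: add_mech_simps)
    also have "\<dots> = run_mechs C M ws (filter P ts) os" using run_simps[OF nP] tail by simp
    finally show ?thesis using False by simp
  qed (simp add: IH)
qed simp

section \<open>Channels and their dependence on the listing of inputs and outputs\<close>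

lemma channel_runnable:
  assumes "set is = ins M" "distinct is" "set os \<subseteq> verts M"
  shows "runnable is (filter (\<lambda>X. X \<in> nin M \<and> (\<exists>Y \<in> set os. (X, Y) \<in> (edges M)\<^sup>*)) (topological_order M)) os"
proof -
  \<comment> \<open>Ancestors of the outputs are closed under parents, apart from inputs, whose
    wires are present from the start.\<close>
  have "Y \<in> ins M \<or> Y \<in> nin M \<and> (\<exists>Z \<in> set os. (Y, Z) \<in> (edges M)\<^sup>*)"
    if "Y \<in> parents M X" "Z \<in> set os" "(X, Z) \<in> (edges M)\<^sup>*" for X Y Z
  proof -
    have "(Y, X) \<in> edges M" "Y \<in> verts M" using that(1) parents_verts[of X] by (auto simp: parents_def)
    thus ?thesis using converse_rtrancl_into_rtrancl[OF _ that(3), of Y] that(2) by (auto simp: nin_def)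
  qed
  thus ?thesis
    using assms topological_order ins_verts unfolding runnable_def
    by (auto simp: sorted_wrt_filter nin_def)
qed

lemma channel_simps:
  assumes "set is = ins M" "distinct is" "set os \<subseteq> verts M"
  shows "channel C M is os \<in> Ar C" "Dom C (channel C M is os) = wires is"
    "Cod C (channel C M is os) = wires os"
  using run_simps[OF channel_runnable[OF assms]] by (auto simp: channel_def)

text \<open>The ancestors to be run depend on the requested outputs but are filtered from one
  topological order, so \<open>run_filter\<close> reduces the list for \<open>os\<close> to that for
  \<open>os'\<close>. The selections are absorbed at either end of the run.\<close>

lemma channel_select:
  assumes "set is = ins M" "distinct is" "set is' = ins M" "set os \<subseteq> verts M" "set os' \<subseteq> set os"
  shows "sel os os' \<cdot> channel C M is os \<cdot> sel is' is = channel C M is' os'"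
proof -
  let ?P = "\<lambda>os X. X \<in> nin M \<and> (\<exists>Y \<in> set os. (X, Y) \<in> (edges M)\<^sup>*)"
  let ?ts = "filter (?P os) (topological_order M)" and ?ts' = "filter (?P os') (topological_order M)"
  have r: "runnable is ?ts os" and r': "runnable is ?ts' os'"
    using channel_runnable[OF assms(1,2)] assms(4,5) by auto
  have ro: "runnable is ?ts os'" using r assms(5) by (auto simp: runnable_def)
  have "filter (?P os') ?ts = ?ts'"
    using assms(5) by (auto simp: filter_filter intro!: filter_cong)
  hence "run_mechs C M is ?ts' os' = run_mechs C M is (filter (?P os') ?ts) os'" by simp
  also have "\<dots> = run_mechs C M is ?ts os'"
    by (rule run_filter[OF ro]) (auto simp: parents_def intro: converse_rtrancl_into_rtrancl)
  finally have "sel os os' \<cdot> channel C M is os = run_mechs C M is ?ts' os'"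
    using run_select_out[OF r assms(5)] by (simp add: channel_def)
  moreover have "run_mechs C M is ?ts' os' \<cdot> sel is' is = channel C M is' os'"
    unfolding channel_def
    by (rule run_select_in[OF r']) (use assms ins_verts in \<open>auto simp: nin_def\<close>)
  moreover have "(sel os os' \<cdot> channel C M is os) \<cdot> sel is' is
    = sel os os' \<cdot> channel C M is os \<cdot> sel is' is"
  proof -
    have "vob M ` ins M \<subseteq> Ob C" using ins_verts vob_ob by auto
    thus ?thesis using assms channel_simps[OF assms(1,2,4)] by (intro cmpA) simp_all
  qed
  ultimately show ?thesis by simp
qed

end

lemma intervene_fields [simp]:
  "vlist (intervene M S) = vlist M" "ins (intervene M S) = ins M \<union> S" "vob (intervene M S) = vob M"
  "verts (intervene M S) = verts M" "listing (intervene M S) A = listing M A" "mech (intervene M S) = mech M"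
  "outs (intervene M S) = outs M"
  by (simp_all add: intervene_def verts_def listing_def)

lemma (in causal_model_in) causal_model_intervene:
  assumes "S \<subseteq> nin M" shows "causal_model_in C (intervene M S)"
proof -
  have e: "edges (intervene M S) = {(Y, X) \<in> edges M. X \<notin> S}" by (simp add: intervene_def)
  have pa: "parents (intervene M S) X = (if X \<in> S then {} else parents M X)" for X
    by (auto simp: parents_def e)
  show ?thesis
  proof
    show "acyclic (edges (intervene M S))" using acyclic_edges by (rule acyclic_subset) (auto simp: e)
    show "edges (intervene M S) \<subseteq> verts (intervene M S) \<times> verts (intervene M S)"
      using edges_verts by (auto simp: e)
    fix X assume "X \<in> nin (intervene M S)"
    hence "X \<in> nin M" "X \<notin> S" by (auto simp: nin_def)
    thus "mech (intervene M S) X \<in> hom C (tens C (map (vob (intervene M S)) (listing (intervene M S) (parents (intervene M S) X))))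
        (vob (intervene M S) X)"
      using mech_hom by (simp add: pa)
  qed (use assms distinct_vlist ins_verts ins_parentless outs_verts vob_ob nin_verts in \<open>auto simp: pa\<close>)
qed

section \<open>Monoidal transformations\<close>

lemma identity_transformation:
  assumes "functor_between C D F"
  shows "markov_transformation C D F F (\<lambda>X. Idn D (FOb F X))"
proof -
  interpret functor_between C D F by fact
  show ?thesis by standard (auto simp: hom_def)
qed

locale transformation_between = F: functor_between C D F + G: functor_between C D G
    + markov_transformation C D F G \<alpha>
  for C :: "('o, 'a) markov_data" and D :: "('p, 'b) markov_data" (structure) and F G \<alpha>
begin

lemma component_simps [simp]:
  assumes "X \<in> Ob C"
  shows "\<alpha> X \<in> Ar D" "Dom D (\<alpha> X) = FOb F X" "Cod D (\<alpha> X) = FOb G X" "deterministic D (\<alpha> X)"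
  using component_hom[OF assms] component_det[OF assms] by (auto simp: hom_def)

text \<open>Makes isomorphism of abstractions symmetric. Naturality and compatibility with tensor
  products are checked after composing with an invertible component.\<close>

lemma inverse_transformation:
  assumes iso: "\<And>X. X \<in> Ob C \<Longrightarrow> iso_arrow D (\<alpha> X)"
  shows "markov_transformation C D G F (\<lambda>X. inv_arrow D (\<alpha> X))"
proof
  fix f X Y assume f: "f \<in> hom C X Y"
  hence [simp]: "f \<in> Ar C" "Dom C f = X" "Cod C f = Y" by (auto simp: hom_def)
  have [simp]: "X \<in> Ob C" "Y \<in> Ob C" using f F.src.ob_simps[of f] by auto
  have "\<alpha> Y \<cdot> (inv_arrow D (\<alpha> Y) \<cdot> FAr G f) = (\<alpha> Y \<cdot> FAr F f) \<cdot> inv_arrow D (\<alpha> X)"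
    unfolding natural[OF f] using iso by simp
  also have "\<dots> = \<alpha> Y \<cdot> (FAr F f \<cdot> inv_arrow D (\<alpha> X))" using iso by simp
  finally show "inv_arrow D (\<alpha> Y) \<cdot> FAr G f = FAr F f \<cdot> inv_arrow D (\<alpha> X)"
    by (rule F.tgt.iso_cancel_left[rotated -1]) (simp_all add: iso)
next
  fix X Y assume [simp]: "X \<in> Ob C" "Y \<in> Ob C"
  let ?i = "inv_arrow D"
  have "\<alpha> (X \<odot>\<^bsub>C\<^esub> Y) \<cdot> (?i (\<alpha> (X \<odot>\<^bsub>C\<^esub> Y)) \<cdot> FMul G X Y)
    = (FMul G X Y \<cdot> (\<alpha> X \<otimes> \<alpha> Y)) \<cdot> (?i (\<alpha> X) \<otimes> ?i (\<alpha> Y))"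
    using iso by simp
  also have "\<dots> = (\<alpha> (X \<odot>\<^bsub>C\<^esub> Y) \<cdot> FMul F X Y) \<cdot> (?i (\<alpha> X) \<otimes> ?i (\<alpha> Y))"
    by (subst monoidal_mul) simp_all
  also have "\<dots> = \<alpha> (X \<odot>\<^bsub>C\<^esub> Y) \<cdot> (FMul F X Y \<cdot> (?i (\<alpha> X) \<otimes> ?i (\<alpha> Y)))"
    using iso by simp
  finally show "?i (\<alpha> (X \<odot>\<^bsub>C\<^esub> Y)) \<cdot> FMul G X Y = FMul F X Y \<cdot> (?i (\<alpha> X) \<otimes> ?i (\<alpha> Y))"
    by (rule F.tgt.iso_cancel_left[rotated -1]) (simp_all add: iso)
next
  have "inv_arrow D (\<alpha> (Unt C)) \<cdot> FUnt G = inv_arrow D (\<alpha> (Unt C)) \<cdot> (\<alpha> (Unt C) \<cdot> FUnt F)"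
    by (simp only: monoidal_unt)
  thus "inv_arrow D (\<alpha> (Unt C)) \<cdot> FUnt G = FUnt F" using iso by simp
qed (use iso in \<open>auto simp: hom_def\<close>)

lemma comp_transformation:
  assumes "transformation_between C D G H \<beta>"
  shows "markov_transformation C D F H (\<lambda>X. \<beta> X \<cdot> \<alpha> X)"
proof -
  interpret B: transformation_between C D G H \<beta> by fact
  show ?thesis
  proof
    fix f X Y assume f: "f \<in> hom C X Y"
    hence [simp]: "f \<in> Ar C" "Dom C f = X" "Cod C f = Y" by (auto simp: hom_def)
    have [simp]: "X \<in> Ob C" "Y \<in> Ob C" using f F.src.ob_simps[of f] by auto
    have "(\<beta> Y \<cdot> \<alpha> Y) \<cdot> FAr F f = \<beta> Y \<cdot> (FAr G f \<cdot> \<alpha> X)"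
      using natural[OF f] by simp
    also have "\<dots> = (FAr H f \<cdot> \<beta> X) \<cdot> \<alpha> X"
      by (rule F.tgt.cmp_reassoc[OF B.natural[OF f]]) simp_all
    finally show "(\<beta> Y \<cdot> \<alpha> Y) \<cdot> FAr F f = FAr H f \<cdot> (\<beta> X \<cdot> \<alpha> X)" by simp
  next
    fix X Y assume X [simp]: "X \<in> Ob C" and Y [simp]: "Y \<in> Ob C"
    have "(\<beta> (X \<odot>\<^bsub>C\<^esub> Y) \<cdot> \<alpha> (X \<odot>\<^bsub>C\<^esub> Y)) \<cdot> FMul F X Y = \<beta> (X \<odot>\<^bsub>C\<^esub> Y) \<cdot> (FMul G X Y \<cdot> (\<alpha> X \<otimes> \<alpha> Y))"
      using monoidal_mul[OF X Y] by simp
    also have "\<dots> = (FMul H X Y \<cdot> (\<beta> X \<otimes> \<beta> Y)) \<cdot> (\<alpha> X \<otimes> \<alpha> Y)"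
      by (rule F.tgt.cmp_reassoc[OF B.monoidal_mul[OF X Y]]) simp_all
    finally show "(\<beta> (X \<odot>\<^bsub>C\<^esub> Y) \<cdot> \<alpha> (X \<odot>\<^bsub>C\<^esub> Y)) \<cdot> FMul F X Y
        = FMul H X Y \<cdot> ((\<beta> X \<cdot> \<alpha> X) \<otimes> (\<beta> Y \<cdot> \<alpha> Y))" by simp
  next
    show "(\<beta> (Unt C) \<cdot> \<alpha> (Unt C)) \<cdot> FUnt F = FUnt H"
      using monoidal_unt B.monoidal_unt by simp
  qed (auto simp: hom_def)
qed

text \<open>Later it carries an isomorphism between functors of free categories into
  \<open>C\<close>, where the components of \<tau> live.\<close>

lemma whisker_transformation:
  assumes "functor_between D E W"
  shows "markov_transformation C E (comp_functor D E W F) (comp_functor D E W G) (\<lambda>X. FAr W (\<alpha> X))"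
proof -
  interpret W: functor_between D E W by fact
  show ?thesis
  proof
    fix f X Y assume f: "f \<in> hom C X Y"
    hence [simp]: "f \<in> Ar C" "Dom C f = X" "Cod C f = Y" by (auto simp: hom_def)
    have [simp]: "X \<in> Ob C" "Y \<in> Ob C" using f F.src.ob_simps[of f] by auto
    show "FAr W (\<alpha> Y) \<cdot>\<^bsub>E\<^esub> FAr (comp_functor D E W F) f = FAr (comp_functor D E W G) f \<cdot>\<^bsub>E\<^esub> FAr W (\<alpha> X)"
      using natural[OF f] by (simp flip: W.functor_cmp)
  next
    fix X Y assume X [simp]: "X \<in> Ob C" and Y [simp]: "Y \<in> Ob C"
    have "FAr W (\<alpha> (X \<odot>\<^bsub>C\<^esub> Y)) \<cdot>\<^bsub>E\<^esub> (FAr W (FMul F X Y) \<cdot>\<^bsub>E\<^esub> FMul W (FOb F X) (FOb F Y))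
      = FAr W (\<alpha> (X \<odot>\<^bsub>C\<^esub> Y) \<cdot> FMul F X Y) \<cdot>\<^bsub>E\<^esub> FMul W (FOb F X) (FOb F Y)" by (simp add: W.functor_cmp)
    also have "\<dots> = FAr W (FMul G X Y) \<cdot>\<^bsub>E\<^esub> (FAr W (\<alpha> X \<otimes> \<alpha> Y) \<cdot>\<^bsub>E\<^esub> FMul W (FOb F X) (FOb F Y))"
      by (simp add: monoidal_mul W.functor_cmp)
    also have "FAr W (\<alpha> X \<otimes> \<alpha> Y) \<cdot>\<^bsub>E\<^esub> FMul W (FOb F X) (FOb F Y)
      = FMul W (FOb G X) (FOb G Y) \<cdot>\<^bsub>E\<^esub> (FAr W (\<alpha> X) \<otimes>\<^bsub>E\<^esub> FAr W (\<alpha> Y))"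
      using W.mul_natural_ar[of "\<alpha> X" "\<alpha> Y"] by simp
    finally show "FAr W (\<alpha> (X \<odot>\<^bsub>C\<^esub> Y)) \<cdot>\<^bsub>E\<^esub> FMul (comp_functor D E W F) X Y
      = FMul (comp_functor D E W G) X Y \<cdot>\<^bsub>E\<^esub> (FAr W (\<alpha> X) \<otimes>\<^bsub>E\<^esub> FAr W (\<alpha> Y))" by simp
  next
    have "FAr W (\<alpha> (Unt C)) \<cdot>\<^bsub>E\<^esub> (FAr W (FUnt F) \<cdot>\<^bsub>E\<^esub> FUnt W) = FAr W (\<alpha> (Unt C) \<cdot> FUnt F) \<cdot>\<^bsub>E\<^esub> FUnt W"
      by (simp add: W.functor_cmp)
    thus "FAr W (\<alpha> (Unt C)) \<cdot>\<^bsub>E\<^esub> FUnt (comp_functor D E W F) = FUnt (comp_functor D E W G)"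
      by (simp add: monoidal_unt)
  qed (auto simp: hom_def)
qed

end

lemma extend_components_cong:
  "(\<And>X. X \<in> set \<Gamma> \<Longrightarrow> s X = s' X) \<Longrightarrow> extend_components D F G s \<Gamma> = extend_components D F G s' \<Gamma>"
  by (induction \<Gamma>) auto


section \<open>Models of interventional queries\<close>

lemma do_signature_fields [simp]:
  "types (do_signature M) = verts M"
  "queries (do_signature M) = {(S, O'). S \<subseteq> nin M \<and> O' \<subseteq> outs M}"
  "inp (do_signature M) (S, O') = listing M (ins M) @ listing M S"
  "outp (do_signature M) (S, O') = listing M O'"
  by (simp_all add: do_signature_def)

context causal_model_in begin

abbreviation do_channel :: "'v set \<times> 'v set \<Rightarrow> 'a" where
  "do_channel \<equiv> \<lambda>(S, O'). channel C (intervene M S) (listing M (ins M) @ listing M S) (listing M O')"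

lemma set_inputs: "S \<subseteq> nin M \<Longrightarrow> set (listing M (ins M) @ listing M S) = ins M \<union> S"
  using ins_verts nin_verts by auto

lemma distinct_inputs: "S \<subseteq> nin M \<Longrightarrow> distinct (listing M (ins M) @ listing M S)"
  by (auto simp: nin_def)

lemma intervened_channel_select:
  assumes "S \<subseteq> nin M" "set is = ins M \<union> S" "distinct is" "set is' = ins M \<union> S" "set os \<subseteq> verts M" "set os' \<subseteq> set os"
  shows "sel os os' \<cdot> channel C (intervene M S) is os \<cdot> sel is' is
    = channel C (intervene M S) is' os'"
proof -
  interpret I: causal_model_in C "intervene M S" by (rule causal_model_intervene[OF assms(1)])
  show ?thesis using I.channel_select[of "is" is' os os'] assms by simp
qed

lemma intervened_channel_simps:
  assumes "S \<subseteq> nin M" "set is = ins M \<union> S" "distinct is" "set os \<subseteq> verts M"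
  shows "channel C (intervene M S) is os \<in> Ar C" "Dom C (channel C (intervene M S) is os) = wires is"
    "Cod C (channel C (intervene M S) is os) = wires os"
proof -
  interpret I: causal_model_in C "intervene M S" by (rule causal_model_intervene[OF assms(1)])
  show "channel C (intervene M S) is os \<in> Ar C" "Dom C (channel C (intervene M S) is os) = wires is"
    "Cod C (channel C (intervene M S) is os) = wires os"
    using I.channel_simps[of "is" os] assms by auto
qed

lemma do_query_model: "query_model C (do_signature M) (vob M) do_channel"
proof
  show "vob M ` types (do_signature M) \<subseteq> Ob C" using vob_ob by auto
next
  fix q assume "q \<in> queries (do_signature M)"
  then obtain S O' where q: "q = (S, O')" "S \<subseteq> nin M" "O' \<subseteq> outs M" by auto
  show "do_channel q \<in> hom C (tens C (map (vob M) (inp (do_signature M) q))) (tens C (map (vob M) (outp (do_signature M) q)))"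
    using intervened_channel_simps[OF q(2) set_inputs[OF q(2)] distinct_inputs[OF q(2)], of "listing M O'"] q
    by (simp add: hom_def)
qed

sublocale do_q: query_model C "do_signature M" "vob M" do_channel
  by (rule do_query_model)

lemma do_model_eq: "do_model C M = interpretation_functor C (do_signature M) (vob M) do_channel"
  by (simp add: do_model_def)

lemma functor_from_free_do_model: "functor_from_free (do_signature M) C (do_model C M)"
  unfolding do_model_eq by (rule do_q.functor_from_free_interpretation)

lemma do_model_fields [simp]:
  "FOb (do_model C M) \<Gamma> = tens C (map (vob M) \<Gamma>)"
  "FMul (do_model C M) \<Gamma> \<Delta> = tens_append C (map (vob M) \<Gamma>) (map (vob M) \<Delta>)"
  "FUnt (do_model C M) = Idn C (Unt C)"
  by (simp_all add: do_model_eq)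

lemma do_model_gen:
  assumes "S \<subseteq> nin M" "O' \<subseteq> outs M"
  shows "FAr (do_model C M) (dclass (do_signature M) (DGen (S, O')))
    = channel C (intervene M S) (listing M (ins M) @ listing M S) (listing M O')"
proof -
  have "well_typed (do_signature M) (DGen (S, O'))" using assms by (auto simp: do_signature_def)
  thus ?thesis by (simp add: do_model_eq)
qed

lemma do_model_det_iso:
  assumes "K \<in> hom (free_markov (do_signature M)) \<Gamma> \<Delta>" "iso_arrow (free_markov (do_signature M)) K"
    "deterministic (free_markov (do_signature M)) K" "distinct \<Gamma>"
  shows "FAr (do_model C M) K = sel \<Gamma> \<Delta>"
  unfolding do_model_eq by (rule do_q.model_det_iso[OF assms])

end

section \<open>Constructive abstractions as downward abstractions\<close>

locale causal_pair = L: causal_model_in C L + H: causal_model_in C H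
  for C :: "('o, 'a) markov_data" (structure)
    and L :: "('l, 'o, 'a) causal_model" and H :: "('h, 'o, 'a) causal_model"
begin

abbreviation "QL \<equiv> do_signature L"
abbreviation "QH \<equiv> do_signature H"
abbreviation "FL \<equiv> do_model C L"
abbreviation "FH \<equiv> do_model C H"

abbreviation "FreeL \<equiv> free_markov QL"
abbreviation "FreeH \<equiv> free_markov QH"
abbreviation cmp_low (infixr "\<bullet>" 55) where "g \<bullet> f \<equiv> g \<cdot>\<^bsub>FreeL\<^esub> f"

abbreviation low :: "('h \<Rightarrow> 'l set) \<Rightarrow> 'h list \<Rightarrow> 'l list" where
  "low pi \<Gamma> \<equiv> concat (map (\<lambda>X. listing L (pi X)) \<Gamma>)"

abbreviation ins_list :: "'h set \<Rightarrow> 'h list" where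
  "ins_list S \<equiv> listing H (ins H) @ listing H S"

text \<open>The low-level lists concatenate the images of single variables, whereas a query of
  \<open>do_signature L\<close> follows the vertex listing of \<open>L\<close>; the two
  \<open>free_select\<close> translate between these orders.\<close>

definition canon_gen :: "('h \<Rightarrow> 'l set) \<Rightarrow> 'h set \<times> 'h set \<Rightarrow> ('l, 'l set \<times> 'l set) diagram set" where
  "canon_gen pi = (\<lambda>(S, O').
     free_select QL (listing L (\<Union> (pi ` O'))) (low pi (listing H O'))
       \<bullet> dclass QL (DGen (\<Union> (pi ` S), \<Union> (pi ` O')))
       \<bullet> free_select QL (low pi (ins_list S)) (listing L (ins L) @ listing L (\<Union> (pi ` S))))"

definition canon_functor ::
  "('h \<Rightarrow> 'l set) \<Rightarrow> ('h list, ('h, 'h set \<times> 'h set) diagram set, 'l list, ('l, 'l set \<times> 'l set) diagram set) mfunctor" where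
  "canon_functor pi = interpretation_functor FreeL QH (\<lambda>X. listing L (pi X)) (canon_gen pi)"

sublocale free_L: markov_category FreeL by (rule markov_category_free)

declare free_L.cmpA [simp del]

sublocale FL: functor_from_free QL C FL by (rule L.functor_from_free_do_model)
sublocale FH: functor_from_free QH C FH by (rule H.functor_from_free_do_model)

end

text \<open>The part of \<open>variable_alignment\<close> that concerns sets alone. It suffices for
  the canonical functor, and it can be extracted from a downward abstraction before its channels are
  studied.\<close>

locale aligned_sets = causal_pair C L H
  for C :: "('o, 'a) markov_data" (structure)
    and L :: "('l, 'o, 'a) causal_model" and H :: "('h, 'o, 'a) causal_model" +
  fixes pi :: "'h \<Rightarrow> 'l set"
  assumes pi_verts: "X \<in> verts H \<Longrightarrow> pi X \<subseteq> verts L"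
    and pi_disjoint: "\<lbrakk>X \<in> verts H; Y \<in> verts H; X \<noteq> Y\<rbrakk> \<Longrightarrow> pi X \<inter> pi Y = {}"
    and pi_ins: "\<Union> (pi ` ins H) = ins L"
    and pi_outs: "\<Union> (pi ` outs H) \<subseteq> outs L"
begin

lemma set_low: "set \<Gamma> \<subseteq> verts H \<Longrightarrow> set (low pi \<Gamma>) = \<Union> (pi ` set \<Gamma>)"
  using pi_verts by fastforce

lemma low_lists [simp]: "low pi \<Gamma> \<in> lists (verts L)"
  by auto

lemma distinct_low: "distinct \<Gamma> \<Longrightarrow> set \<Gamma> \<subseteq> verts H \<Longrightarrow> distinct (low pi \<Gamma>)"
proof (induction \<Gamma>)
  case (Cons X \<Gamma>)
  have "pi X \<inter> \<Union> (pi ` set \<Gamma>) = {}" using Cons.prems pi_disjoint by fastforce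
  thus ?case using Cons set_low[of \<Gamma>] pi_verts[of X] by auto
qed simp

text \<open>The inputs of \<open>L\<close> are used up by the images of the inputs of
  \<open>H\<close>, and images are disjoint. This makes interventions on images legitimate.\<close>

lemma img_nin: assumes "S \<subseteq> nin H" shows "\<Union> (pi ` S) \<subseteq> nin L"
proof
  fix x assume "x \<in> \<Union> (pi ` S)"
  then obtain X where X: "X \<in> S" "x \<in> pi X" by auto
  hence XH: "X \<in> verts H" "X \<notin> ins H" using assms by (auto simp: nin_def)
  have "x \<notin> ins L"
  proof
    assume "x \<in> ins L"
    then obtain Y where Y: "Y \<in> ins H" "x \<in> pi Y" using pi_ins by auto
    thus False using pi_disjoint[of X Y] XH X H.ins_verts by auto
  qed
  thus "x \<in> nin L" using pi_verts[OF XH(1)] X by (auto simp: nin_def)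
qed

lemma img_outs: "O' \<subseteq> outs H \<Longrightarrow> \<Union> (pi ` O') \<subseteq> outs L"
  using pi_outs by blast

lemma set_ins_low:
  assumes "S \<subseteq> nin H" shows "set (low pi (ins_list S)) = ins L \<union> \<Union> (pi ` S)"
proof -
  have v: "set (ins_list S) \<subseteq> verts H" by auto
  show ?thesis unfolding set_low[OF v] H.set_inputs[OF assms] using pi_ins by auto
qed

lemma set_out_low: "O' \<subseteq> outs H \<Longrightarrow> set (low pi (listing H O')) = \<Union> (pi ` O')"
  using set_low[of "listing H O'"] H.outs_verts by (simp add: Int_absorb2)

lemma distinct_ins_low: "S \<subseteq> nin H \<Longrightarrow> distinct (low pi (ins_list S))"
  by (rule distinct_low[OF H.distinct_inputs]) auto

lemma mset_ins_low:
  assumes "S \<subseteq> nin H"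
  shows "mset (low pi (ins_list S)) = mset (listing L (ins L) @ listing L (\<Union> (pi ` S)))"
  using distinct_ins_low[OF assms] L.distinct_inputs[OF img_nin[OF assms]] set_ins_low[OF assms]
    L.set_inputs[OF img_nin[OF assms]] set_eq_iff_mset_eq_distinct by metis

lemma mset_out_low:
  assumes "O' \<subseteq> outs H" shows "mset (low pi (listing H O')) = mset (listing L (\<Union> (pi ` O')))"
proof -
  have "distinct (low pi (listing H O'))" by (rule distinct_low) auto
  moreover have "set (listing L (\<Union> (pi ` O'))) = set (low pi (listing H O'))"
    unfolding set_out_low[OF assms] using img_outs[OF assms] L.outs_verts by auto
  ultimately show ?thesis using set_eq_iff_mset_eq_distinct L.distinct_listing by metis
qed

lemma gen_typed:
  assumes "S \<subseteq> nin H" "O' \<subseteq> outs H"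
  shows "well_typed QL (DGen (\<Union> (pi ` S), \<Union> (pi ` O')))"
  using img_nin[OF assms(1)] img_outs[OF assms(2)] by auto

lemma canon_selects:
  assumes "S \<subseteq> nin H" "O' \<subseteq> outs H"
  defines "p \<equiv> free_select QL (low pi (ins_list S)) (listing L (ins L) @ listing L (\<Union> (pi ` S)))"
    and "p' \<equiv> free_select QL (listing L (\<Union> (pi ` O'))) (low pi (listing H O'))"
  shows "p \<in> hom FreeL (low pi (ins_list S)) (listing L (ins L) @ listing L (\<Union> (pi ` S)))"
    "iso_arrow FreeL p" "deterministic FreeL p"
    "p' \<in> hom FreeL (listing L (\<Union> (pi ` O'))) (low pi (listing H O'))"
    "iso_arrow FreeL p'" "deterministic FreeL p'"
proof -
  have lists: "low pi (ins_list S) \<in> lists (types QL)" "listing L (\<Union> (pi ` O')) \<in> lists (types QL)" by auto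
  show "p \<in> hom FreeL (low pi (ins_list S)) (listing L (ins L) @ listing L (\<Union> (pi ` S)))"
    "iso_arrow FreeL p" "deterministic FreeL p"
    unfolding p_def
    by (rule free_select_props[OF lists(1) distinct_ins_low[OF assms(1)] mset_ins_low[OF assms(1), symmetric]])+
  show "p' \<in> hom FreeL (listing L (\<Union> (pi ` O'))) (low pi (listing H O'))"
    "iso_arrow FreeL p'" "deterministic FreeL p'"
    unfolding p'_def
    by (rule free_select_props[OF lists(2) L.distinct_listing mset_out_low[OF assms(2)]])+
qed

lemma gen_hom:
  assumes "S \<subseteq> nin H" "O' \<subseteq> outs H"
  shows "dclass QL (DGen (\<Union> (pi ` S), \<Union> (pi ` O'))) \<in> hom FreeL
    (listing L (ins L) @ listing L (\<Union> (pi ` S))) (listing L (\<Union> (pi ` O')))"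
  by (rule free_homI[OF gen_typed[OF assms]]) simp_all

lemma canon_gen_hom:
  assumes "S \<subseteq> nin H" "O' \<subseteq> outs H"
  shows "canon_gen pi (S, O') \<in> hom FreeL (low pi (ins_list S)) (low pi (listing H O'))"
  unfolding canon_gen_def prod.case
  by (rule free_L.cmp_hom[OF free_L.cmp_hom[OF canon_selects(1)[OF assms] gen_hom[OF assms]] canon_selects(4)[OF assms]])

lemma canon_query_model: "query_model FreeL QH (\<lambda>X. listing L (pi X)) (canon_gen pi)"
proof
  fix q assume "q \<in> queries QH"
  then obtain S O' where q: "q = (S, O')" "S \<subseteq> nin H" "O' \<subseteq> outs H" by auto
  show "canon_gen pi q \<in> hom FreeL (tens FreeL (map (\<lambda>X. listing L (pi X)) (inp QH q)))
      (tens FreeL (map (\<lambda>X. listing L (pi X)) (outp QH q)))"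
    using canon_gen_hom[OF q(2,3)] q(1) by simp
qed auto

lemma canon_from_free: "functor_from_free QH FreeL (canon_functor pi)"
  unfolding canon_functor_def by (rule query_model.functor_from_free_interpretation[OF canon_query_model])

lemma canon_FOb [simp]: "FOb (canon_functor pi) \<Gamma> = low pi \<Gamma>"
  by (simp add: canon_functor_def query_model.model_fields[OF canon_query_model])

lemma canon_FAr_gen:
  assumes "S \<subseteq> nin H" "O' \<subseteq> outs H"
  shows "FAr (canon_functor pi) (dclass QH (DGen (S, O'))) = canon_gen pi (S, O')"
proof -
  have "well_typed QH (DGen (S, O'))" using assms by auto
  thus ?thesis by (simp add: canon_functor_def query_model.FAr_model[OF canon_query_model])
qed

abbreviation "K \<equiv> comp_functor FreeL C FL (canon_functor pi)"

lemma K_from_free: "functor_from_free QH C K"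
proof -
  have "functor_between FreeH FreeL (canon_functor pi)"
    using canon_from_free by (simp add: functor_from_free_def)
  hence "markov_functor FreeH C K"
    by (rule comp_markov_functor) (rule FL.functor_between_axioms)
  thus ?thesis
    by (intro functor_from_free.intro functor_between.intro markov_category_free L.markov_category_axioms)
qed

lemma K_FMul:
  assumes "\<Gamma> \<in> lists (verts H)" "\<Delta> \<in> lists (verts H)"
  shows "FMul K \<Gamma> \<Delta> = tens_append C (map (vob L) (low pi \<Gamma>)) (map (vob L) (low pi \<Delta>))"
proof -
  have "tens_append FreeL (map (\<lambda>X. listing L (pi X)) \<Gamma>) (map (\<lambda>X. listing L (pi X)) \<Delta>)
      = dclass QL (DId (low pi \<Gamma> @ low pi \<Delta>))"
    by (subst tens_append_free) auto
  hence m: "FMul (canon_functor pi) \<Gamma> \<Delta> = dclass QL (DId (low pi \<Gamma> @ low pi \<Delta>))"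
    by (simp add: canon_functor_def query_model.model_fields[OF canon_query_model])
  have l: "low pi \<Gamma> @ low pi \<Delta> \<in> lists (types QL)" by auto
  have s: "set (map (vob L) (low pi \<Gamma>)) \<subseteq> Ob C" for \<Gamma> using L.vob_ob by auto
  show ?thesis using L.tens_append_simps[OF s[of \<Gamma>] s[of \<Delta>]] by (simp add: m FL.FAr_DId[OF l])
qed

lemma K_FUnt: "FUnt K = Idn C (Unt C)"
proof -
  have "FUnt (canon_functor pi) = dclass QL (DId [])"
    by (simp add: canon_functor_def query_model.model_fields[OF canon_query_model])
  thus ?thesis by simp
qed

text \<open>The two reorderings in \<open>canon_gen\<close> become wire selections in
  \<open>C\<close>, and the channel absorbs both. For all outputs, what remains is the low-level
  channel as it appears in the constructive equation.\<close>

lemma K_gen: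
  assumes "S \<subseteq> nin H" "O' \<subseteq> outs H"
  shows "FAr K (dclass QH (DGen (S, O')))
    = channel C (intervene L (\<Union> (pi ` S))) (low pi (ins_list S)) (low pi (listing H O'))"
proof -
  note s = canon_selects[OF assms]
  note S = img_nin[OF assms(1)]
  let ?p = "free_select QL (low pi (ins_list S)) (listing L (ins L) @ listing L (\<Union> (pi ` S)))"
    and ?p' = "free_select QL (listing L (\<Union> (pi ` O'))) (low pi (listing H O'))"
    and ?g = "dclass QL (DGen (\<Union> (pi ` S), \<Union> (pi ` O')))"
  have "FAr K (dclass QH (DGen (S, O'))) = FAr FL (?p' \<bullet> (?g \<bullet> ?p))"
    by (simp only: comp_functor_fields canon_FAr_gen[OF assms]) (simp only: canon_gen_def prod.case)
  also have "\<dots> = FAr FL ?p' \<cdot> (FAr FL ?g \<cdot> FAr FL ?p)"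
    using FL.ar_cmp[OF free_L.cmp_hom[OF s(1) gen_hom[OF assms]] s(4)] FL.ar_cmp[OF s(1) gen_hom[OF assms]] by simp
  also have "FAr FL ?p = L.sel (low pi (ins_list S)) (listing L (ins L) @ listing L (\<Union> (pi ` S)))"
    by (rule L.do_model_det_iso[OF s(1-3) distinct_ins_low[OF assms(1)]])
  also have "FAr FL ?p' = L.sel (listing L (\<Union> (pi ` O'))) (low pi (listing H O'))"
    by (rule L.do_model_det_iso[OF s(4-6) L.distinct_listing])
  also have "FAr FL ?g = channel C (intervene L (\<Union> (pi ` S))) (listing L (ins L) @ listing L (\<Union> (pi ` S)))
      (listing L (\<Union> (pi ` O')))"
    by (rule L.do_model_gen[OF S img_outs[OF assms(2)]])
  also have "L.sel (listing L (\<Union> (pi ` O'))) (low pi (listing H O'))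
      \<cdot> (channel C (intervene L (\<Union> (pi ` S))) (listing L (ins L) @ listing L (\<Union> (pi ` S))) (listing L (\<Union> (pi ` O')))
      \<cdot> L.sel (low pi (ins_list S)) (listing L (ins L) @ listing L (\<Union> (pi ` S))))
    = channel C (intervene L (\<Union> (pi ` S))) (low pi (ins_list S)) (low pi (listing H O'))"
  proof (rule L.intervened_channel_select[OF S L.set_inputs[OF S] L.distinct_inputs[OF S] set_ins_low[OF assms(1)]])
    show "set (low pi (listing H O')) \<subseteq> set (listing L (\<Union> (pi ` O')))"
      using mset_eq_setD[OF mset_out_low[OF assms(2)]] by simp
  qed auto
  finally show ?thesis .
qed

text \<open>The structure maps of \<open>K\<close> and \<open>FH\<close> are
  \<open>tens_append\<close>, so the two recursions agree clause by clause. This makes the general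
  results on extensions available for \<open>tensor_alignment\<close>.\<close>

lemma tensor_alignment_eq_extend:
  assumes "\<Gamma> \<in> lists (verts H)"
  shows "tensor_alignment C L H pi tau \<Gamma> = extend_components C K FH tau \<Gamma>"
  using assms
proof (induction \<Gamma>)
  case Nil
  show ?case using L.unit_ob by (simp add: K_FUnt del: comp_functor_fields)
next
  case (Cons X \<Gamma>)
  have "vob H X \<in> Ob C" "set (map (vob H) \<Gamma>) \<subseteq> Ob C" using Cons H.vob_ob by auto
  hence "FMul FH [X] \<Gamma> = tens_cons C (vob H X) (map (vob H) \<Gamma>)"
    using L.tens_append_single[of "vob H X" "map (vob H) \<Gamma>"] by (simp del: tens_append.simps)
  moreover have "FMul K [X] \<Gamma> = tens_append C (map (vob L) (listing L (pi X))) (map (vob L) (low pi \<Gamma>))"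
    using K_FMul[of "[X]" \<Gamma>] Cons by simp
  ultimately show ?case using Cons by (simp del: comp_functor_fields H.do_model_fields)
qed

lemma parallel_K: "parallel_functors QH C K FH"
  by (intro parallel_functors.intro K_from_free H.functor_from_free_do_model)

end

section \<open>Tensor products of the aligning channels\<close>

context aligned_sets begin

context
  fixes tau :: "'h \<Rightarrow> 'a"
  assumes tau_hom: "X \<in> verts H \<Longrightarrow> tau X \<in> hom C (tens C (map (vob L) (listing L (pi X)))) (vob H X)"
    and tau_det: "X \<in> verts H \<Longrightarrow> deterministic C (tau X)"
begin

abbreviation "TA \<equiv> tensor_alignment C L H pi tau"

lemma tau_simps:
  assumes "X \<in> verts H"
  shows "tau X \<in> Ar C" "Dom C (tau X) = tens C (map (vob L) (listing L (pi X)))" "Cod C (tau X) = vob H X"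
    "deterministic C (tau X)"
  using tau_hom[OF assms] tau_det[OF assms] by (auto simp: hom_def)

lemma tau_components:
  "X \<in> types QH \<Longrightarrow> tau X \<in> hom C (FOb K [X]) (FOb FH [X])"
  "X \<in> types QH \<Longrightarrow> deterministic C (tau X)"
  using tau_hom tau_det by simp_all

lemma TA_simps:
  assumes "set \<Gamma> \<subseteq> verts H"
  shows "TA \<Gamma> \<in> Ar C" "Dom C (TA \<Gamma>) = L.wires (low pi \<Gamma>)" "Cod C (TA \<Gamma>) = H.wires \<Gamma>"
    "deterministic C (TA \<Gamma>)"
proof -
  have \<Gamma>: "\<Gamma> \<in> lists (types QH)" using assms by auto
  hence "TA \<Gamma> = extend_components C K FH tau \<Gamma>" by (intro tensor_alignment_eq_extend) simp
  thus "TA \<Gamma> \<in> Ar C" "Dom C (TA \<Gamma>) = L.wires (low pi \<Gamma>)" "Cod C (TA \<Gamma>) = H.wires \<Gamma>"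
    "deterministic C (TA \<Gamma>)"
    using parallel_functors.ext_simps[OF parallel_K tau_components \<Gamma>] by simp_all
qed

lemma TA_single:
  assumes "X \<in> verts H" shows "TA [X] = tau X"
  using parallel_functors.ext_single[OF parallel_K tau_components, of X] tensor_alignment_eq_extend[of "[X]" tau] assms
  by (simp del: tensor_alignment.simps extend_components.simps)

lemma pr_append_select:
  assumes "set xs \<subseteq> verts L" "set ys \<subseteq> verts L" "distinct (xs @ ys)"
  shows "L.pr1 (L.wires xs) (L.wires ys) \<cdot> inv_arrow C (tens_append C (map (vob L) xs) (map (vob L) ys))
      = L.sel (xs @ ys) xs"
    "L.pr2 (L.wires xs) (L.wires ys) \<cdot> inv_arrow C (tens_append C (map (vob L) xs) (map (vob L) ys))
      = L.sel (xs @ ys) ys"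
proof -
  let ?A = "map (vob L) xs" and ?B = "map (vob L) ys"
  have A [simp]: "set ?A \<subseteq> Ob C" "set ?B \<subseteq> Ob C" using assms L.vob_ob by auto
  have ob: "vob L ` set (xs @ ys) \<subseteq> Ob C" using assms L.vob_ob by auto
  note ta [simp] = L.tens_append_simps[OF A]
  note [simp] = L.tens_ob[OF A(1)] L.tens_ob[OF A(2)]
  show "L.pr1 (tens C ?A) (tens C ?B) \<cdot> inv_arrow C (tens_append C ?A ?B) = L.sel (xs @ ys) xs"
  proof (rule L.select_eqI)
    fix i assume i: "i < length xs"
    have "index_of (xs @ ys) (xs ! i) = i" using i assms(3) by (simp add: index_of_append)
    thus "L.proj ?A i \<cdot> (L.pr1 (tens C ?A) (tens C ?B) \<cdot> inv_arrow C (tens_append C ?A ?B))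
        = wire_proj C (vob L) (xs @ ys) (xs ! i)"
      using L.proj_append_inv(1)[OF A, of i] L.wire_proj_eq[OF _ ob, of "xs ! i"] i by simp
  qed (use ob in simp_all)
  show "L.pr2 (tens C ?A) (tens C ?B) \<cdot> inv_arrow C (tens_append C ?A ?B) = L.sel (xs @ ys) ys"
  proof (rule L.select_eqI)
    fix i assume i: "i < length ys"
    hence "ys ! i \<notin> set xs" using assms(3) by auto
    hence "index_of (xs @ ys) (ys ! i) = length xs + i" using i assms(3) by (simp add: index_of_append)
    thus "L.proj ?B i \<cdot> (L.pr2 (tens C ?A) (tens C ?B) \<cdot> inv_arrow C (tens_append C ?A ?B))
        = wire_proj C (vob L) (xs @ ys) (ys ! i)"
      using L.proj_append_inv(2)[OF A, of i] L.wire_proj_eq[OF _ ob, of "ys ! i"] i by simp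
  qed (use ob in simp_all)
qed

text \<open>Every other factor is discarded together with its wires; distinctness of
  \<open>low pi \<Gamma>\<close> identifies the surviving wires by name.\<close>

lemma TA_proj:
  assumes "distinct \<Gamma>" "set \<Gamma> \<subseteq> verts H" "z \<in> set \<Gamma>"
  shows "wire_proj C (vob H) \<Gamma> z \<cdot> TA \<Gamma> = tau z \<cdot> L.sel (low pi \<Gamma>) (listing L (pi z))"
  using assms
proof (induction \<Gamma>)
  case (Cons X \<Gamma>)
  let ?xs = "listing L (pi X)" and ?ys = "low pi \<Gamma>"
  let ?A = "map (vob L) ?xs" and ?B = "map (vob L) ?ys"
  let ?i = "inv_arrow C (tens_append C ?A ?B)"
  have X: "X \<in> verts H" "X \<notin> set \<Gamma>" "distinct \<Gamma>" "set \<Gamma> \<subseteq> verts H" using Cons.prems by auto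
  have d: "distinct (?xs @ ?ys)" using distinct_low[OF Cons.prems(1,2)] by simp
  have v: "set ?xs \<subseteq> verts L" "set ?ys \<subseteq> verts L" using low_lists[of \<Gamma>] by auto
  note sel = pr_append_select[OF v d]
  have A: "set ?A \<subseteq> Ob C" "set ?B \<subseteq> Ob C" using v L.vob_ob by auto
  note [simp] = L.tens_append_simps[OF A] L.tens_ob[OF A(1)] L.tens_ob[OF A(2)]
    tau_simps[OF X(1)] TA_simps(1-3)[OF X(4)] H.vob_ob[OF X(1)] X(4)
  have TA: "TA (X # \<Gamma>) = tens_cons C (vob H X) (map (vob H) \<Gamma>) \<cdot> ((tau X \<otimes> TA \<Gamma>) \<cdot> ?i)" by simp
  show ?case
  proof (cases "z = X")
    case True
    have "wire_proj C (vob H) (X # \<Gamma>) X \<cdot> TA (X # \<Gamma>) = tau X \<cdot> (L.pr1 (tens C ?A) (tens C ?B) \<cdot> ?i)"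
      unfolding TA by simp
    thus ?thesis unfolding sel True by simp
  next
    case False
    hence z: "z \<in> set \<Gamma>" using Cons.prems by auto
    hence zv: "z \<in> verts H" using X(4) by blast
    have zs: "set (listing L (pi z)) \<subseteq> set ?ys" using z by auto
    have ob: "vob L ` set (?xs @ ?ys) \<subseteq> Ob C" using v L.vob_ob by auto
    have "wire_proj C (vob H) (X # \<Gamma>) z \<cdot> TA (X # \<Gamma>)
        = wire_proj C (vob H) \<Gamma> z \<cdot> (TA \<Gamma> \<cdot> (L.pr2 (tens C ?A) (tens C ?B) \<cdot> ?i))"
      unfolding TA using False z by simp
    also have "\<dots> = (tau z \<cdot> L.sel ?ys (listing L (pi z))) \<cdot> (L.pr2 (tens C ?A) (tens C ?B) \<cdot> ?i)"
      by (rule L.cmp_reassoc[OF Cons.IH[OF X(3,4) z]]) (use z zv in simp_all)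
    also have "\<dots> = (tau z \<cdot> L.sel ?ys (listing L (pi z))) \<cdot> L.sel (?xs @ ?ys) ?ys"
      unfolding sel ..
    also have "\<dots> = tau z \<cdot> (L.sel ?ys (listing L (pi z)) \<cdot> L.sel (?xs @ ?ys) ?ys)"
    proof (rule L.cmpA)
      note t = tau_simps[OF zv]
      have obys: "vob L ` set ?ys \<subseteq> Ob C" using ob by auto
      have sub: "set ?ys \<subseteq> set (?xs @ ?ys)" by auto
      note s1 = L.wire_select_simps[OF zs obys] and s2 = L.wire_select_simps[OF sub ob]
      show "L.sel (?xs @ ?ys) ?ys \<in> Ar C" by (rule s2)
      show "L.sel ?ys (listing L (pi z)) \<in> Ar C" by (rule s1)
      show "tau z \<in> Ar C" by (rule t)
      show "Dom C (L.sel ?ys (listing L (pi z))) = Cod C (L.sel (?xs @ ?ys) ?ys)"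
        unfolding s1 s2 ..
      show "Dom C (tau z) = Cod C (L.sel ?ys (listing L (pi z)))" unfolding s1 t ..
    qed
    also have "\<dots> = tau z \<cdot> L.sel (?xs @ ?ys) (listing L (pi z))"
      by (subst L.select_select[OF zs _ ob]) auto
    finally show ?thesis by simp
  qed
qed simp

text \<open>Both sides are deterministic because every \<open>tau X\<close> is, so
  \<open>TA_proj\<close> decides the equation one high-level wire at a time.\<close>

lemma TA_select:
  assumes "distinct \<Gamma>" "distinct \<Delta>" "set \<Gamma> \<subseteq> verts H" "set \<Delta> \<subseteq> set \<Gamma>"
  shows "TA \<Delta> \<cdot> L.sel (low pi \<Gamma>) (low pi \<Delta>) = H.sel \<Gamma> \<Delta> \<cdot> TA \<Gamma>"
proof -
  have \<Delta>: "set \<Delta> \<subseteq> verts H" using assms by auto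
  note ta\<Gamma> = TA_simps[OF assms(3)] and ta\<Delta> = TA_simps[OF \<Delta>]
  have sub: "set (low pi \<Delta>) \<subseteq> set (low pi \<Gamma>)" using set_low assms(3,4) \<Delta> by auto
  have ob: "vob L ` set (low pi \<Gamma>) \<subseteq> Ob C" "vob H ` set \<Gamma> \<subseteq> Ob C" "vob H ` set \<Delta> \<subseteq> Ob C"
    using L.vob_ob H.vob_ob assms(3) \<Delta> by auto
  note sL = L.wire_select_simps[OF sub ob(1)] and sH = L.wire_select_simps[OF assms(4) ob(2)]
  show ?thesis
  proof (rule L.det_ext_wire[OF _ _ _ _ _ ob(3) assms(2)])
    show "deterministic C (TA \<Delta> \<cdot> L.sel (low pi \<Gamma>) (low pi \<Delta>))"
      by (rule L.det_cmp) (simp_all only: sL ta\<Delta>)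
    show "deterministic C (H.sel \<Gamma> \<Delta> \<cdot> TA \<Gamma>)"
      by (rule L.det_cmp) (simp_all only: sH ta\<Gamma>)
    show "Cod C (TA \<Delta> \<cdot> L.sel (low pi \<Gamma>) (low pi \<Delta>)) = H.wires \<Delta>"
      by (subst L.cmp_simps(3)) (simp_all only: sL ta\<Delta>)
    show "Cod C (H.sel \<Gamma> \<Delta> \<cdot> TA \<Gamma>) = H.wires \<Delta>"
      by (subst L.cmp_simps(3)) (simp_all only: sH ta\<Gamma>)
    show "Dom C (TA \<Delta> \<cdot> L.sel (low pi \<Gamma>) (low pi \<Delta>)) = Dom C (H.sel \<Gamma> \<Delta> \<cdot> TA \<Gamma>)"
      by (subst (1 2) L.cmp_simps(2)) (simp_all only: sH ta\<Gamma> sL ta\<Delta>)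
    fix z assume z: "z \<in> set \<Delta>"
    hence zv: "z \<in> verts H" "z \<in> set \<Gamma>" using \<Delta> assms(4) by auto
    have zs: "set (listing L (pi z)) \<subseteq> set (low pi \<Delta>)" using z by auto
    have ob\<Delta>: "vob L ` set (low pi \<Delta>) \<subseteq> Ob C" using L.vob_ob by auto
    note s = L.wire_select_simps[OF zs ob\<Delta>] and wp = L.wire_proj_simps[OF z ob(3)]
    have "wire_proj C (vob H) \<Delta> z \<cdot> (TA \<Delta> \<cdot> L.sel (low pi \<Gamma>) (low pi \<Delta>))
        = (tau z \<cdot> L.sel (low pi \<Delta>) (listing L (pi z))) \<cdot> L.sel (low pi \<Gamma>) (low pi \<Delta>)"
      by (rule L.cmp_reassoc[OF TA_proj[OF assms(2) \<Delta> z]]) (simp_all only: sL ta\<Delta> wp)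
    also have "\<dots> = tau z \<cdot> (L.sel (low pi \<Delta>) (listing L (pi z)) \<cdot> L.sel (low pi \<Gamma>) (low pi \<Delta>))"
      by (rule L.cmpA) (simp_all only: sL s tau_simps[OF zv(1)])
    also have "\<dots> = tau z \<cdot> L.sel (low pi \<Gamma>) (listing L (pi z))"
      by (simp only: L.select_select[OF zs sub ob(1)])
    also have "\<dots> = wire_proj C (vob H) \<Gamma> z \<cdot> TA \<Gamma>" by (rule TA_proj[OF assms(1,3) zv(2), symmetric])
    also have "\<dots> = wire_proj C (vob H) \<Delta> z \<cdot> (H.sel \<Gamma> \<Delta> \<cdot> TA \<Gamma>)"
      by (rule L.wire_proj_select_reassoc[OF assms(4) ob(2) z ta\<Gamma>(1,3), symmetric])
    finally show "wire_proj C (vob H) \<Delta> z \<cdot> (TA \<Delta> \<cdot> L.sel (low pi \<Gamma>) (low pi \<Delta>))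
        = wire_proj C (vob H) \<Delta> z \<cdot> (H.sel \<Gamma> \<Delta> \<cdot> TA \<Gamma>)" .
  qed
qed

text \<open>The selection of \<open>O'\<close> among the high-level outputs crosses
  \<open>TA\<close> by \<open>TA_select\<close> and is then absorbed by the low-level channel, so
  the equation \<open>eq\<close> for all outputs is enough.\<close>

lemma TA_gen_natural:
  assumes S: "S \<subseteq> nin H" and O': "O' \<subseteq> outs H"
    and eq: "TA (listing H (outs H)) \<cdot> channel C (intervene L (\<Union> (pi ` S))) (low pi (ins_list S)) (low pi (listing H (outs H)))
      = channel C (intervene H S) (ins_list S) (listing H (outs H)) \<cdot> TA (ins_list S)"
  shows "TA (listing H O') \<cdot> FAr K (dclass QH (DGen (S, O'))) = FAr FH (dclass QH (DGen (S, O'))) \<cdot> TA (ins_list S)"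
proof -
  let ?is = "ins_list S" and ?os = "listing H (outs H)" and ?os' = "listing H O'"
  let ?cL = "channel C (intervene L (\<Union> (pi ` S))) (low pi ?is)" and ?cH = "channel C (intervene H S) ?is"
  have v: "set ?is \<subseteq> verts H" "set ?os \<subseteq> verts H" "set ?os' \<subseteq> verts H" "set ?os' \<subseteq> set ?os"
    using O' H.outs_verts by auto
  have lv: "set (low pi \<Gamma>) \<subseteq> verts L" for \<Gamma> by auto
  have sub: "set (low pi ?os') \<subseteq> set (low pi ?os)" unfolding set_low[OF v(2)] set_low[OF v(3)] using v(4) by auto
  have ob: "vob L ` set (low pi \<Gamma>) \<subseteq> Ob C" for \<Gamma> using L.vob_ob by auto
  have obH: "vob H ` set ?os \<subseteq> Ob C" using H.vob_ob v(2) by auto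
  note ta = TA_simps[OF v(1)] TA_simps[OF v(2)] TA_simps[OF v(3)]
  note cL = L.intervened_channel_simps[OF img_nin[OF S] set_ins_low[OF S] distinct_ins_low[OF S] lv]
  note cH = H.intervened_channel_simps[OF S H.set_inputs[OF S] H.distinct_inputs[OF S] v(2)]
  note s = L.wire_select_simps[OF sub ob] and sH = L.wire_select_simps[OF v(4) obH]
  have margL: "L.sel (low pi ?os) (low pi ?os') \<cdot> ?cL (low pi ?os) = ?cL (low pi ?os')"
    using L.intervened_channel_select[OF img_nin[OF S] set_ins_low[OF S] distinct_ins_low[OF S] set_ins_low[OF S] lv sub]
      L.select_id[OF ob distinct_ins_low[OF S]] cL by simp
  have obi: "vob H ` set ?is \<subseteq> Ob C" using H.vob_ob v(1) by auto
  have margH: "H.sel ?os ?os' \<cdot> ?cH ?os = ?cH ?os'"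
    using H.intervened_channel_select[OF S H.set_inputs[OF S] H.distinct_inputs[OF S] H.set_inputs[OF S] v(2,4)]
      L.select_id[OF obi H.distinct_inputs[OF S]] cH by simp
  have "TA ?os' \<cdot> ?cL (low pi ?os') = TA ?os' \<cdot> (L.sel (low pi ?os) (low pi ?os') \<cdot> ?cL (low pi ?os))"
    by (simp only: margL)
  also have "\<dots> = (H.sel ?os ?os' \<cdot> TA ?os) \<cdot> ?cL (low pi ?os)"
    by (rule L.cmp_reassoc[OF TA_select[OF H.distinct_listing H.distinct_listing v(2,4)]]) (simp_all only: ta s cL)
  also have "\<dots> = H.sel ?os ?os' \<cdot> (TA ?os \<cdot> ?cL (low pi ?os))"
    by (rule L.cmpA) (simp_all only: ta sH cL)
  also have "\<dots> = H.sel ?os ?os' \<cdot> (?cH ?os \<cdot> TA ?is)" by (simp only: eq)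
  also have "\<dots> = ?cH ?os' \<cdot> TA ?is"
    by (rule L.cmp_reassoc[OF margH]) (simp_all only: ta sH cH)
  finally show ?thesis by (simp only: K_gen[OF S O'] H.do_model_gen[OF S O'])
qed

end

end

section \<open>From constructive to downward abstractions\<close>

context causal_pair begin

lemma aligned_sets: "variable_alignment C L H pi tau \<Longrightarrow> aligned_sets C L H pi"
  by unfold_locales (auto simp: variable_alignment_def)

lemma constructive_equation:
  assumes "constructive_abstraction C L H pi tau" "S \<subseteq> nin H"
  shows "tensor_alignment C L H pi tau (listing H (outs H))
      \<cdot> channel C (intervene L (\<Union> (pi ` S))) (low pi (ins_list S)) (low pi (listing H (outs H)))
    = channel C (intervene H S) (ins_list S) (listing H (outs H)) \<cdot> tensor_alignment C L H pi tau (ins_list S)"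
  using assms unfolding constructive_abstraction_def Let_def by blast

lemma canon_abstraction:
  assumes ca: "constructive_abstraction C L H pi tau"
  shows "(canon_functor pi, tensor_alignment C L H pi tau) \<in> do_abstractions C L H"
proof -
  interpret VA: variable_alignment C L H pi tau using ca by (simp add: constructive_abstraction_def)
  interpret A: aligned_sets C L H pi by (rule aligned_sets[OF VA.variable_alignment_axioms])
  interpret CF: functor_from_free QH FreeL "canon_functor pi" by (rule A.canon_from_free)
  let ?TA = "tensor_alignment C L H pi tau"
  note comps = A.tau_components[OF VA.align_hom VA.align_det]
  have ext: "?TA \<Gamma> = extend_components C A.K FH tau \<Gamma>" if "\<Gamma> \<in> lists (verts H)" for \<Gamma>
    by (rule A.tensor_alignment_eq_extend[OF that])
  have "markov_transformation FreeH C A.K FH (extend_components C A.K FH tau)"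
  proof (rule parallel_functors.ext_transformation[OF A.parallel_K comps])
    fix q assume "q \<in> queries QH"
    then obtain S O' where q: "q = (S, O')" "S \<subseteq> nin H" "O' \<subseteq> outs H" by auto
    have l: "listing H O' \<in> lists (verts H)" "ins_list S \<in> lists (verts H)" by auto
    show "extend_components C A.K FH tau (outp QH q) \<cdot> FAr A.K (dclass QH (DGen q))
        = FAr FH (dclass QH (DGen q)) \<cdot> extend_components C A.K FH tau (inp QH q)"
      unfolding q(1) do_signature_fields ext[OF l(1), symmetric] ext[OF l(2), symmetric]
      by (rule A.TA_gen_natural[OF VA.align_hom VA.align_det q(2,3) constructive_equation[OF ca q(2)]])
  qed
  \<comment> \<open>The two families are known to agree only on lists of variables of
    \<open>H\<close>, so the laws are transferred object by object.\<close>
  hence trans: "markov_transformation FreeH C A.K FH ?TA"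
  proof -
    assume "markov_transformation FreeH C A.K FH (extend_components C A.K FH tau)"
    then interpret T: markov_transformation FreeH C A.K FH "extend_components C A.K FH tau" .
    show ?thesis
    proof
      fix X assume X: "X \<in> Ob FreeH"
      thus "?TA X \<in> hom C (FOb A.K X) (FOb FH X)" "deterministic C (?TA X)"
        using T.component_hom[OF X] T.component_det[OF X] ext[of X] by simp_all
    next
      fix f X Y assume f: "f \<in> hom FreeH X Y"
      then obtain d where "well_typed QH d" "dsrc QH d = X" "dtgt QH d = Y" by (rule free_homE)
      hence "X \<in> lists (verts H)" "Y \<in> lists (verts H)" using well_typed_lists[of QH d] by simp_all
      thus "?TA Y \<cdot> FAr A.K f = FAr FH f \<cdot> ?TA X"
        using T.natural[OF f] ext[of X] ext[of Y] by simp
    next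
      fix X Y assume X: "X \<in> Ob FreeH" and Y: "Y \<in> Ob FreeH"
      have XY: "X \<in> lists (verts H)" "Y \<in> lists (verts H)" "X @ Y \<in> lists (verts H)" using X Y by simp_all
      show "?TA (X \<odot>\<^bsub>FreeH\<^esub> Y) \<cdot> FMul A.K X Y = FMul FH X Y \<cdot> (?TA X \<otimes> ?TA Y)"
        using T.monoidal_mul[OF X Y] unfolding ext[OF XY(1)] ext[OF XY(2)] using ext[OF XY(3)] by simp
    next
      show "?TA (Unt FreeH) \<cdot> FUnt A.K = FUnt FH"
        using T.monoidal_unt ext[of "[]"] by simp
    qed
  qed
  have query: "is_query QL (FAr (canon_functor pi) (dclass QH (DGen q)))" if "q \<in> queries QH" for q
  proof -
    obtain S O' where q: "q = (S, O')" "S \<subseteq> nin H" "O' \<subseteq> outs H" using \<open>q \<in> queries QH\<close> by auto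
    let ?q = "(\<Union> (pi ` S), \<Union> (pi ` O'))"
    have "?q \<in> queries QL" using A.img_nin[OF q(2)] A.img_outs[OF q(3)] by simp
    moreover have "inp QL ?q \<in> lists (types QL)" "outp QL ?q \<in> lists (types QL)" by auto
    moreover have "mset (low pi (ins_list S)) = mset (inp QL ?q)" using A.mset_ins_low[OF q(2)] by simp
    moreover have "mset (low pi (listing H O')) = mset (outp QL ?q)" using A.mset_out_low[OF q(3)] by simp
    moreover have "distinct (inp QL ?q)" using L.distinct_inputs[OF A.img_nin[OF q(2)]] by simp
    moreover have "distinct (outp QL ?q)" by simp
    ultimately have "is_query QL (free_select QL (outp QL ?q) (low pi (listing H O')) \<bullet>
        dclass QL (DGen ?q) \<bullet> free_select QL (low pi (ins_list S)) (inp QL ?q))"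
      by (rule is_queryI)
    thus ?thesis unfolding q(1) A.canon_FAr_gen[OF q(2,3)] unfolding canon_gen_def prod.case do_signature_fields .
  qed
  have "downward_abstraction C QL FL QH FH (canon_functor pi) ?TA"
    unfolding downward_abstraction_def
    using FL.markov_functor_axioms FH.markov_functor_axioms CF.markov_functor_axioms query trans VA.align_tensor_epic
    by simp
  moreover have "(\<Union>X \<in> ins H. set (FOb (canon_functor pi) [X])) = ins L"
  proof -
    have "set (FOb (canon_functor pi) [X]) = pi X" if "X \<in> ins H" for X
      using that H.ins_verts A.pi_verts[of X] by auto
    thus ?thesis using A.pi_ins by simp
  qed
  ultimately show ?thesis by (simp add: do_abstractions_def)
qed

text \<open>The canonical functor lists \<open>pi X\<close> in the chosen order, so the permutation
  that restriction inserts is an identity.\<close>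

lemma restrict_canon:
  assumes ca: "constructive_abstraction C L H pi tau" and "pi \<in> extensional (verts H)" "tau \<in> extensional (verts H)"
  shows "restrict_to_variables C L H (canon_functor pi, tensor_alignment C L H pi tau) = (pi, tau)"
proof -
  interpret VA: variable_alignment C L H pi tau using ca by (simp add: constructive_abstraction_def)
  interpret A: aligned_sets C L H pi by (rule aligned_sets[OF VA.variable_alignment_axioms])
  have set: "set (FOb (canon_functor pi) [X]) = pi X" if "X \<in> verts H" for X
    using A.pi_verts[OF that] by auto
  have "tensor_alignment C L H pi tau [X] \<cdot> L.sel (listing L (set (FOb (canon_functor pi) [X]))) (FOb (canon_functor pi) [X]) = tau X"
    if X: "X \<in> verts H" for X
  proof -
    have ob: "vob L ` set (listing L (pi X)) \<subseteq> Ob C" using L.vob_ob by auto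
    have "FOb (canon_functor pi) [X] = listing L (pi X)" by simp
    thus ?thesis
      using A.TA_single[OF VA.align_hom VA.align_det X] set[OF X] L.select_id[OF ob L.distinct_listing]
        A.tau_simps[OF VA.align_hom VA.align_det X] by (simp del: tensor_alignment.simps)
  qed
  thus ?thesis using assms(2,3) set unfolding restrict_to_variables_def prod.case
    by (auto intro!: extensionalityI[of _ "verts H"])
qed

end

section \<open>From downward to constructive abstractions\<close>

lemma disjoint_of_distinct_concat:
  assumes "distinct (concat (map f xs))" "X \<in> set xs" "Y \<in> set xs" "X \<noteq> Y"
  shows "set (f X) \<inter> set (f Y) = {}"
  using assms by (induction xs) auto

lemma distinct_of_distinct_concat: "distinct (concat (map f xs)) \<Longrightarrow> X \<in> set xs \<Longrightarrow> distinct (f X)"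
  by (induction xs) auto

locale do_abstraction = causal_pair C L H
  for C :: "('o, 'a) markov_data" (structure)
    and L :: "('l, 'o, 'a) causal_model" and H :: "('h, 'o, 'a) causal_model" +
  fixes P :: "('h list, ('h, 'h set \<times> 'h set) diagram set, 'l list, ('l, 'l set \<times> 'l set) diagram set) mfunctor"
    and T :: "'h list \<Rightarrow> 'a"
  assumes mem: "(P, T) \<in> do_abstractions C L H"
begin

abbreviation "pi \<equiv> fst (restrict_to_variables C L H (P, T))"
abbreviation "tau \<equiv> snd (restrict_to_variables C L H (P, T))"

lemma pi_eq: "X \<in> verts H \<Longrightarrow> pi X = set (FOb P [X])"
  and tau_eq: "X \<in> verts H \<Longrightarrow> tau X = T [X] \<cdot> L.sel (listing L (set (FOb P [X]))) (FOb P [X])"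
  by (simp_all add: restrict_to_variables_def)

lemma downward: "downward_abstraction C QL FL QH FH P T" and ins_img: "(\<Union>X \<in> ins H. set (FOb P [X])) = ins L"
  using mem by (simp_all add: do_abstractions_def)

lemma P_from_free: "functor_from_free QH FreeL P"
  using downward unfolding downward_abstraction_def
  by (intro functor_from_free.intro functor_between.intro markov_category_free) blast

lemma P_between: "functor_between FreeH FreeL P"
  using P_from_free by (simp add: functor_from_free_def)

lemma P_FOb: "\<Gamma> \<in> lists (verts H) \<Longrightarrow> FOb P \<Gamma> \<in> lists (verts L)"
  using functor_from_free.FOb_simps[OF P_from_free, of \<Gamma>] by simp

text \<open>\<open>FMul P\<close> and \<open>FUnt P\<close> are isomorphisms of the free category
  and thus only permute wires. So strong monoidality fixes \<open>FOb P \<Gamma>\<close> up to order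
  by its values on single variables.\<close>

lemma P_mset: "\<Gamma> \<in> lists (verts H) \<Longrightarrow> mset (FOb P \<Gamma>) = mset (concat (map (\<lambda>X. FOb P [X]) \<Gamma>))"
proof (induction \<Gamma>)
  case Nil
  interpret functor_from_free QH FreeL P by (rule P_from_free)
  have "mset [] = mset (FOb P [])"
    by (rule free_iso_mset[of "FUnt P" QL]) (use unt_hom unt_iso in simp_all)
  thus ?case by simp
next
  case (Cons X \<Gamma>)
  interpret functor_from_free QH FreeL P by (rule P_from_free)
  have "mset (FOb P [X] @ FOb P \<Gamma>) = mset (FOb P ([X] @ \<Gamma>))"
    by (rule free_iso_mset[of "FMul P [X] \<Gamma>" QL]) (use mul_hom[of "[X]" \<Gamma>] mul_iso[of "[X]" \<Gamma>] Cons in simp_all)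
  thus ?case using Cons by simp
qed

lemma P_queryE:
  assumes "S \<subseteq> nin H" "O' \<subseteq> outs H"
  obtains S' O'' where "S' \<subseteq> nin L" "O'' \<subseteq> outs L"
    "mset (FOb P (ins_list S)) = mset (listing L (ins L) @ listing L S')"
    "mset (FOb P (listing H O')) = mset (listing L O'')"
    "FAr P (dclass QH (DGen (S, O'))) = free_select QL (listing L O'') (FOb P (listing H O'))
      \<bullet> dclass QL (DGen (S', O''))
      \<bullet> free_select QL (FOb P (ins_list S)) (listing L (ins L) @ listing L S')"
proof -
  interpret functor_from_free QH FreeL P by (rule P_from_free)
  have wt: "well_typed QH (DGen (S, O'))" using assms by auto
  have hom: "FAr P (dclass QH (DGen (S, O'))) \<in> hom FreeL (FOb P (ins_list S)) (FOb P (listing H O'))"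
    by (rule ar) (rule free_homI[OF wt], simp_all)
  have q: "is_query QL (FAr P (dclass QH (DGen (S, O'))))"
    using downward assms unfolding downward_abstraction_def by auto
  have dist: "distinct (inp QL q) \<and> distinct (outp QL q)" if "q \<in> queries QL" for q
    using that L.distinct_inputs by (cases q) auto
  show thesis
  proof (rule is_queryE[OF q hom dist])
    fix q assume q: "q \<in> queries QL" "mset (FOb P (ins_list S)) = mset (inp QL q)"
      "mset (FOb P (listing H O')) = mset (outp QL q)"
      "FAr P (dclass QH (DGen (S, O'))) = free_select QL (outp QL q) (FOb P (listing H O')) \<bullet>
          dclass QL (DGen q) \<bullet> free_select QL (FOb P (ins_list S)) (inp QL q)"
    obtain S' O'' where q': "q = (S', O'')" by (cases q)
    show thesis by (rule that[of S' O'']) (use q in \<open>simp_all only: q' do_signature_fields\<close>, auto)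
  qed
qed

lemma distinct_P_all: "distinct (concat (map (\<lambda>X. FOb P [X]) (ins_list (nin H))))"
proof -
  \<comment> \<open>The empty output set is always available, and the inputs of this query exhaust
    the variables of \<open>H\<close>.\<close>
  obtain S' O'' where S': "S' \<subseteq> nin L" "mset (FOb P (ins_list (nin H))) = mset (listing L (ins L) @ listing L S')"
    using P_queryE[of "nin H" "{}"] by (metis empty_subsetI subset_refl)
  have "ins_list (nin H) \<in> lists (verts H)" by auto
  hence "mset (concat (map (\<lambda>X. FOb P [X]) (ins_list (nin H)))) = mset (listing L (ins L) @ listing L S')"
    using S'(2) P_mset by metis
  thus ?thesis using L.distinct_inputs[OF S'(1)] mset_eq_imp_distinct_iff by metis
qed

lemma set_all: "set (ins_list (nin H)) = verts H"
  using H.ins_verts by (auto simp: nin_def)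

lemma distinct_P_single: "X \<in> verts H \<Longrightarrow> distinct (FOb P [X])"
  by (rule distinct_of_distinct_concat[OF distinct_P_all]) (simp only: set_all)

lemma set_P:
  assumes "\<Gamma> \<in> lists (verts H)" shows "set (FOb P \<Gamma>) = \<Union> (pi ` set \<Gamma>)"
proof -
  have "set (FOb P \<Gamma>) = set (concat (map (\<lambda>X. FOb P [X]) \<Gamma>))" using P_mset[OF assms] by (rule mset_eq_setD)
  thus ?thesis using assms pi_eq by auto
qed

lemma aligned: "aligned_sets C L H pi"
proof
  fix X assume "X \<in> verts H"
  thus "pi X \<subseteq> verts L" using P_FOb[of "[X]"] pi_eq[of X] by auto
next
  fix X Y assume XY: "X \<in> verts H" "Y \<in> verts H" "X \<noteq> Y"
  have "set (FOb P [X]) \<inter> set (FOb P [Y]) = {}"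
    by (rule disjoint_of_distinct_concat[OF distinct_P_all]) (simp_all only: set_all XY not_False_eq_True)
  thus "pi X \<inter> pi Y = {}" using XY pi_eq by simp
next
  have "\<Union> (pi ` ins H) = (\<Union>X \<in> ins H. set (FOb P [X]))"
    by (rule SUP_cong[OF HOL.refl]) (use pi_eq H.ins_verts in blast)
  thus "\<Union> (pi ` ins H) = ins L" using ins_img by simp
next
  \<comment> \<open>Tested on the query without intervention that returns all outputs: its image is
    a query of \<open>L\<close>, whose outputs lie in \<open>outs L\<close>.\<close>
  obtain O'' where O'': "O'' \<subseteq> outs L" "mset (FOb P (listing H (outs H))) = mset (listing L O'')"
    using P_queryE[of "{}" "outs H"] by (metis empty_subsetI subset_refl)
  have l: "listing H (outs H) \<in> lists (verts H)" by auto
  have "\<Union> (pi ` set (listing H (outs H))) = set (listing L O'')"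
    using set_P[OF l] mset_eq_setD[OF O''(2)] by simp
  thus "\<Union> (pi ` outs H) \<subseteq> outs L" using O''(1) H.outs_verts by (simp add: Int_absorb2) blast
qed

sublocale A: aligned_sets C L H pi by (rule aligned)

lemma mset_low:
  assumes "X \<in> verts H" shows "mset (FOb P [X]) = mset (listing L (pi X))"
proof -
  have "set (listing L (pi X)) = set (FOb P [X])" using A.pi_verts[OF assms] pi_eq[OF assms] by auto
  thus ?thesis using distinct_P_single[OF assms] set_eq_iff_mset_eq_distinct L.distinct_listing by metis
qed

text \<open>The image of a query is a priori just some query, but the multisets of its inputs and
  outputs identify it: removing \<open>ins L\<close> from the inputs leaves the set of intervened
  variables.\<close>

lemma P_gen:
  assumes S: "S \<subseteq> nin H" and O': "O' \<subseteq> outs H"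
  defines "i \<equiv> listing L (ins L) @ listing L (\<Union> (pi ` S))" and "u \<equiv> listing L (\<Union> (pi ` O'))"
  shows "mset (FOb P (ins_list S)) = mset i" "mset (FOb P (listing H O')) = mset u"
    "FAr P (dclass QH (DGen (S, O'))) = free_select QL u (FOb P (listing H O'))
      \<bullet> dclass QL (DGen (\<Union> (pi ` S), \<Union> (pi ` O')))
      \<bullet> free_select QL (FOb P (ins_list S)) i"
proof -
  obtain S' O'' where q: "S' \<subseteq> nin L" "O'' \<subseteq> outs L"
    "mset (FOb P (ins_list S)) = mset (listing L (ins L) @ listing L S')"
    "mset (FOb P (listing H O')) = mset (listing L O'')"
    "FAr P (dclass QH (DGen (S, O'))) = free_select QL (listing L O'') (FOb P (listing H O'))
      \<bullet> dclass QL (DGen (S', O''))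
      \<bullet> free_select QL (FOb P (ins_list S)) (listing L (ins L) @ listing L S')"
    by (rule P_queryE[OF S O'])
  have l: "ins_list S \<in> lists (verts H)" "listing H O' \<in> lists (verts H)" by auto
  have "ins L \<union> S' = \<Union> (pi ` (ins H \<union> S))"
    using mset_eq_setD[OF q(3)] set_P[OF l(1)] unfolding H.set_inputs[OF S] L.set_inputs[OF q(1)] by blast
  hence "ins L \<union> S' = ins L \<union> \<Union> (pi ` S)" using A.pi_ins by auto
  moreover have "ins L \<inter> S' = {}" "ins L \<inter> \<Union> (pi ` S) = {}" using q(1) A.img_nin[OF S] by (auto simp: nin_def)
  ultimately have S': "S' = \<Union> (pi ` S)" by blast
  have "O'' \<inter> verts L = \<Union> (pi ` (O' \<inter> verts H))"
    using mset_eq_setD[OF q(4)] set_P[OF l(2)] by simp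
  hence O'': "O'' = \<Union> (pi ` O')" using q(2) L.outs_verts O' H.outs_verts by (simp add: Int_absorb2)
  show "mset (FOb P (ins_list S)) = mset i" "mset (FOb P (listing H O')) = mset u"
    "FAr P (dclass QH (DGen (S, O'))) = free_select QL u (FOb P (listing H O'))
      \<bullet> dclass QL (DGen (\<Union> (pi ` S), \<Union> (pi ` O')))
      \<bullet> free_select QL (FOb P (ins_list S)) i"
    using q(3-5) unfolding S' O'' i_def u_def by auto
qed

subsection \<open>The isomorphism with the canonical abstraction\<close>

text \<open>The only deterministic isomorphism between these two lists, hence the only possible
  component at \<open>X\<close>.\<close>

definition perm :: "'h \<Rightarrow> ('l, 'l set \<times> 'l set) diagram set" where
  "perm X = free_select QL (listing L (pi X)) (FOb P [X])"

definition perms :: "'h list \<Rightarrow> ('l, 'l set \<times> 'l set) diagram set" where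
  "perms = extend_components FreeL (canon_functor pi) P perm"

lemma perm_props:
  assumes "X \<in> verts H"
  shows "perm X \<in> hom FreeL (listing L (pi X)) (FOb P [X])" "iso_arrow FreeL (perm X)"
    "deterministic FreeL (perm X)"
proof -
  have "listing L (pi X) \<in> lists (types QL)" by auto
  note p = free_select_props[OF this L.distinct_listing mset_low[OF assms]]
  show "perm X \<in> hom FreeL (listing L (pi X)) (FOb P [X])" "iso_arrow FreeL (perm X)"
    "deterministic FreeL (perm X)"
    unfolding perm_def by (rule p)+
qed

lemma parallel: "parallel_functors QH FreeL (canon_functor pi) P"
  by (intro parallel_functors.intro A.canon_from_free P_from_free)

lemma perm_components:
  "X \<in> types QH \<Longrightarrow> perm X \<in> hom FreeL (FOb (canon_functor pi) [X]) (FOb P [X])"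
  "X \<in> types QH \<Longrightarrow> deterministic FreeL (perm X)"
  using perm_props by simp_all

lemma perms_props:
  assumes "\<Gamma> \<in> lists (verts H)"
  shows "perms \<Gamma> \<in> hom FreeL (low pi \<Gamma>) (FOb P \<Gamma>)" "iso_arrow FreeL (perms \<Gamma>)"
    "deterministic FreeL (perms \<Gamma>)"
proof -
  have \<Gamma>: "\<Gamma> \<in> lists (types QH)" using assms by simp
  note e = parallel_functors.ext_simps[OF parallel perm_components \<Gamma>]
  show "perms \<Gamma> \<in> hom FreeL (low pi \<Gamma>) (FOb P \<Gamma>)"
    unfolding perms_def hom_def using e(1-3) by (simp del: free_fields)
  show "deterministic FreeL (perms \<Gamma>)" unfolding perms_def by (rule e(4))
  have iso: "iso_arrow FreeL (perm X)" if "X \<in> types QH" for X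
    using that perm_props(2)[of X] by simp
  show "iso_arrow FreeL (perms \<Gamma>)"
    unfolding perms_def by (rule parallel_functors.ext_iso[OF parallel perm_components _ \<Gamma>]) (assumption | rule iso)+
qed

lemma perms_single: "X \<in> verts H \<Longrightarrow> perms [X] = perm X"
  using parallel_functors.ext_single[OF parallel perm_components, of X] by (simp add: perms_def)

text \<open>At a query both functors wrap reorderings around the same generator. A reordering
  composed with \<open>perms\<close> is again a deterministic isomorphism out of a distinct list,
  and uniqueness identifies it with the reordering of the other functor.\<close>

lemma perms_transformation:
  "markov_transformation FreeH FreeL (canon_functor pi) P perms"
  unfolding perms_def
proof (rule parallel_functors.ext_transformation[OF parallel perm_components], fold perms_def)
  fix q assume "q \<in> queries QH"
  then obtain S O' where q: "q = (S, O')" "S \<subseteq> nin H" "O' \<subseteq> outs H" by auto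
  let ?i = "listing L (ins L) @ listing L (\<Union> (pi ` S))" and ?u = "listing L (\<Union> (pi ` O'))"
  let ?is = "ins_list S" and ?os = "listing H O'" and ?g = "dclass QL (DGen (\<Union> (pi ` S), \<Union> (pi ` O')))"
  let ?a = "free_select QL (low pi ?is) ?i" and ?b = "free_select QL ?u (low pi ?os)"
  let ?c = "free_select QL (FOb P ?is) ?i" and ?d = "free_select QL ?u (FOb P ?os)"
  note a = A.canon_selects(1-3)[OF q(2,3)] and b = A.canon_selects(4-6)[OF q(2,3)] and g = A.gen_hom[OF q(2,3)]
  note Pq = P_gen[OF q(2,3)]
  have l: "?is \<in> lists (verts H)" "?os \<in> lists (verts H)" by auto
  have di: "distinct (FOb P ?is)"
    using L.distinct_inputs[OF A.img_nin[OF q(2)]] mset_eq_imp_distinct_iff[OF Pq(1)] by blast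
  have Pl: "FOb P ?is \<in> lists (types QL)" "?u \<in> lists (types QL)" using P_FOb[OF l(1)] by auto
  note c = free_select_props[OF Pl(1) di Pq(1)[symmetric]] and d = free_select_props[OF Pl(2) L.distinct_listing Pq(2)]
  note pi = perms_props[OF l(1)] and po = perms_props[OF l(2)]
  note comp = free_L.cmp_hom
  have hs: "f \<in> Ar FreeL" "Dom FreeL f = \<Gamma>" "Cod FreeL f = \<Delta>"
    if "f \<in> hom FreeL \<Gamma> \<Delta>" for f \<Gamma> \<Delta>
    using that unfolding hom_def by blast+
  have ou: "perms ?os \<bullet> ?b = ?d"
  proof (rule free_det_iso[OF comp[OF b(1) po(1)] _ _ L.distinct_listing])
    show "iso_arrow FreeL (perms ?os \<bullet> ?b)"
      by (rule free_L.iso_cmp[OF b(2) po(2)]) (simp only: hs[OF b(1)] hs[OF po(1)])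
    show "deterministic FreeL (perms ?os \<bullet> ?b)"
      by (rule free_L.det_cmp[OF b(3) po(3)]) (simp only: hs[OF b(1)] hs[OF po(1)])
  qed
  have "in": "?c \<bullet> perms ?is = ?a"
  proof (rule free_det_iso[OF comp[OF pi(1) c(1)] _ _ A.distinct_ins_low[OF q(2)]])
    show "iso_arrow FreeL (?c \<bullet> perms ?is)"
      by (rule free_L.iso_cmp[OF pi(2) c(2)]) (simp only: hs[OF c(1)] hs[OF pi(1)])
    show "deterministic FreeL (?c \<bullet> perms ?is)"
      by (rule free_L.det_cmp[OF pi(3) c(3)]) (simp only: hs[OF c(1)] hs[OF pi(1)])
  qed
  have "perms ?os \<bullet> (?b \<bullet> (?g \<bullet> ?a))
      = (perms ?os \<bullet> ?b) \<bullet> (?g \<bullet> ?a)"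
    by (rule free_L.cmp_assoc[OF comp[OF a(1) g] b(1) po(1), symmetric])
  also have "\<dots> = ?d \<bullet> (?g \<bullet> (?c \<bullet> perms ?is))"
    unfolding ou "in" ..
  also have "\<dots> = ?d \<bullet> ((?g \<bullet> ?c) \<bullet> perms ?is)"
    unfolding free_L.cmp_assoc[OF pi(1) c(1) g] ..
  also have "\<dots> = (?d \<bullet> (?g \<bullet> ?c)) \<bullet> perms ?is"
    by (rule free_L.cmp_assoc[OF pi(1) comp[OF c(1) g] d(1), symmetric])
  finally show "perms (outp QH q) \<bullet> FAr (canon_functor pi) (dclass QH (DGen q))
      = FAr P (dclass QH (DGen q)) \<bullet> perms (inp QH q)"
    unfolding q(1) do_signature_fields A.canon_FAr_gen[OF q(2,3)] Pq(3) unfolding canon_gen_def prod.case .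
qed

text \<open>\<open>T\<close> transported along \<open>perms\<close> to the canonical functor, where
  it can be compared with \<open>tensor_alignment\<close>.\<close>

definition T' :: "'h list \<Rightarrow> 'a" where
  "T' \<Gamma> = T \<Gamma> \<cdot> FAr FL (perms \<Gamma>)"

lemma canon_between: "functor_between FreeH FreeL (canon_functor pi)"
  using A.canon_from_free by (simp add: functor_from_free_def)

lemma FL_between: "functor_between FreeL C FL"
  using L.functor_from_free_do_model by (simp add: functor_from_free_def)

lemma comp_P_between: "functor_between FreeH C (comp_functor FreeL C FL P)"
  by (intro functor_between.intro markov_category_free L.markov_category_axioms comp_markov_functor P_between FL_between)

lemma FH_between: "functor_between FreeH C FH"
  using H.functor_from_free_do_model by (simp add: functor_from_free_def)

lemma K_between: "functor_between FreeH C A.K"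
  using A.K_from_free by (simp add: functor_from_free_def)

lemma T_transformation: "markov_transformation FreeH C (comp_functor FreeL C FL P) FH T"
  using downward unfolding downward_abstraction_def by blast

lemma T'_transformation: "markov_transformation FreeH C A.K FH T'"
proof -
  have 1: "markov_transformation FreeH C A.K (comp_functor FreeL C FL P) (\<lambda>X. FAr FL (perms X))"
    by (rule transformation_between.whisker_transformation[OF transformation_between.intro[OF canon_between P_between perms_transformation] FL_between])
  show ?thesis
    unfolding T'_def
    by (rule transformation_between.comp_transformation[OF transformation_between.intro[OF K_between comp_P_between 1]
          transformation_between.intro[OF comp_P_between FH_between T_transformation]])
qed

lemma T'_single:
  assumes "X \<in> verts H" shows "T' [X] = tau X"
proof -
  have "FAr FL (perm X) = L.sel (listing L (pi X)) (FOb P [X])"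
    by (rule L.do_model_det_iso[OF perm_props[OF assms] L.distinct_listing])
  thus ?thesis unfolding T'_def perms_single[OF assms] tau_eq[OF assms] using pi_eq[OF assms] by simp
qed

text \<open>A monoidal transformation out of the free category is determined by its components at
  single variables, and those of \<open>T'\<close> are given by \<open>tau\<close>.\<close>

lemma T'_eq:
  assumes "\<Gamma> \<in> lists (verts H)" shows "T' \<Gamma> = tensor_alignment C L H pi tau \<Gamma>"
proof -
  have \<Gamma>: "\<Gamma> \<in> lists (types QH)" using assms by simp
  have "T' \<Gamma> = extend_components C A.K FH (\<lambda>X. T' [X]) \<Gamma>"
    by (rule parallel_functors.transformation_eq_extend[OF A.parallel_K T'_transformation \<Gamma>])
  also have "\<dots> = extend_components C A.K FH tau \<Gamma>"
    by (rule extend_components_cong) (use assms T'_single in auto)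
  also have "\<dots> = tensor_alignment C L H pi tau \<Gamma>" by (rule A.tensor_alignment_eq_extend[OF assms, symmetric])
  finally show ?thesis .
qed

lemma T_simps:
  assumes "\<Gamma> \<in> lists (verts H)"
  shows "T \<Gamma> \<in> hom C (L.wires (FOb P \<Gamma>)) (H.wires \<Gamma>)" "epic C (T \<Gamma>)"
  using markov_transformation.component_hom[OF T_transformation, of \<Gamma>] downward assms
  by (simp_all add: downward_abstraction_def)

lemma T'_epic:
  assumes "\<Gamma> \<in> lists (verts H)" shows "epic C (T' \<Gamma>)"
proof -
  note p = perms_props[OF assms] and t = T_simps[OF assms]
  have "FAr FL (perms \<Gamma>) \<in> hom C (FOb FL (low pi \<Gamma>)) (FOb FL (FOb P \<Gamma>))" by (rule FL.ar[OF p(1)])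
  thus ?thesis unfolding T'_def
    by (intro L.epic_cmp_iso[OF t(2)] FL.functor_iso[OF p(2)]) (use t(1) in \<open>simp add: hom_def\<close>)
qed

text \<open>Naturality of \<open>T'\<close> at the query with output set \<open>outs H\<close> is
  the required equation verbatim, and the tensor products that have to be epic are components of
  \<open>T'\<close>.\<close>

lemma restrict_constructive: "constructive_abstraction C L H pi tau"
proof -
  interpret T': markov_transformation FreeH C A.K FH T' by (rule T'_transformation)
  have X: "[X] \<in> Ob FreeH" "[X] \<in> lists (verts H)" if "X \<in> verts H" for X using that by simp_all
  have "variable_alignment C L H pi tau"
  proof
    fix X assume v: "X \<in> verts H"
    show "tau X \<in> hom C (tens C (map (vob L) (listing L (pi X)))) (vob H X)"
      using T'.component_hom[OF X(1)[OF v]] unfolding T'_single[OF v] by simp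
    show "deterministic C (tau X)" using T'.component_det[OF X(1)[OF v]] unfolding T'_single[OF v] .
    show "epic C (tau X)" using T'_epic[OF X(2)[OF v]] unfolding T'_single[OF v] .
  next
    fix Xs assume "Xs \<in> lists (verts H)"
    thus "epic C (tensor_alignment C L H pi tau Xs)" using T'_epic T'_eq by simp
  qed (use A.pi_verts A.pi_disjoint A.pi_ins A.pi_outs in blast)+
  moreover have "tensor_alignment C L H pi tau (listing H (outs H))
      \<cdot> channel C (intervene L (\<Union> (pi ` S))) (low pi (ins_list S)) (low pi (listing H (outs H)))
    = channel C (intervene H S) (ins_list S) (listing H (outs H)) \<cdot> tensor_alignment C L H pi tau (ins_list S)"
    if S: "S \<subseteq> nin H" for S
  proof -
    have l: "ins_list S \<in> lists (verts H)" "listing H (outs H) \<in> lists (verts H)" by auto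
    have "well_typed QH (DGen (S, outs H))" using S by auto
    hence "dclass QH (DGen (S, outs H)) \<in> hom FreeH (ins_list S) (listing H (outs H))"
      by (rule free_homI) simp_all
    from T'.natural[OF this] show ?thesis
      unfolding A.K_gen[OF S subset_refl] H.do_model_gen[OF S subset_refl] T'_eq[OF l(1)] T'_eq[OF l(2)] .
  qed
  ultimately show ?thesis unfolding constructive_abstraction_def Let_def by blast
qed

lemma isomorphic_canon:
  "isomorphic_abstractions C QL FL QH (canon_functor pi, tensor_alignment C L H pi tau) (P, T)"
proof -
  have "iso_arrow FreeL (perms \<Gamma>) \<and> T \<Gamma> \<cdot> FAr FL (perms \<Gamma>) = tensor_alignment C L H pi tau \<Gamma>"
    if "\<Gamma> \<in> Ob FreeH" for \<Gamma>
    using perms_props(2)[of \<Gamma>] T'_eq[of \<Gamma>] that by (simp add: T'_def)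
  thus ?thesis unfolding isomorphic_abstractions_def prod.case using perms_transformation by blast
qed

end

section \<open>Isomorphism classes and the bijection\<close>

context causal_pair begin

lemma do_abstraction: "(P, T) \<in> do_abstractions C L H \<Longrightarrow> do_abstraction C L H P T"
  by unfold_locales

lemma restrict_mem:
  assumes "A \<in> do_abstractions C L H" shows "restrict_to_variables C L H A \<in> constructive_abstractions C L H"
proof -
  obtain P T where A: "A = (P, T)" by (cases A)
  interpret do_abstraction C L H P T by (rule do_abstraction) (use assms A in simp)
  have "pi \<in> extensional (verts H)" "tau \<in> extensional (verts H)" by (simp_all add: restrict_to_variables_def)
  thus ?thesis using restrict_constructive unfolding A constructive_abstractions_def
    by (simp add: case_prod_beta)
qed

lemma transformation_iso_props:
  assumes A: "(P, T) \<in> do_abstractions C L H" "(P', T') \<in> do_abstractions C L H"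
    and \<alpha>: "markov_transformation FreeH FreeL P P' \<alpha>"
  shows "transformation_between FreeH FreeL P P' \<alpha>"
  using do_abstraction.P_between[OF do_abstraction[OF A(1)]] do_abstraction.P_between[OF do_abstraction[OF A(2)]] \<alpha>
  by (intro transformation_between.intro)

lemma iso_refl: "A \<in> do_abstractions C L H \<Longrightarrow> (A, A) \<in> do_abstractions_iso C L H"
proof -
  assume A: "A \<in> do_abstractions C L H"
  obtain P T where PT: "A = (P, T)" by (cases A)
  interpret D: do_abstraction C L H P T by (rule do_abstraction) (use A PT in simp)
  have "iso_arrow FreeL (Idn FreeL (FOb P \<Gamma>)) \<and> T \<Gamma> \<cdot> FAr FL (Idn FreeL (FOb P \<Gamma>)) = T \<Gamma>"
    if "\<Gamma> \<in> Ob FreeH" for \<Gamma>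
  proof -
    have \<Gamma>: "\<Gamma> \<in> lists (verts H)" using that by simp
    have Ob: "FOb P \<Gamma> \<in> Ob FreeL" using D.P_FOb[OF \<Gamma>] by simp
    have "FAr FL (Idn FreeL (FOb P \<Gamma>)) = Idn C (L.wires (FOb P \<Gamma>))"
      using FL.ar_id[OF Ob] by simp
    thus ?thesis using D.T_simps(1)[OF \<Gamma>] L.cmp_id_right free_L.iso_id[OF Ob] by simp
  qed
  hence "isomorphic_abstractions C QL FL QH (P, T) (P, T)"
    unfolding isomorphic_abstractions_def prod.case using identity_transformation[OF D.P_between] by blast
  thus ?thesis using A PT by (simp add: do_abstractions_iso_def)
qed

lemma isoE:
  assumes "(A, B) \<in> do_abstractions_iso C L H"
  obtains P T P' T' \<alpha> where "A = (P, T)" "B = (P', T')" "(P, T) \<in> do_abstractions C L H" "(P', T') \<in> do_abstractions C L H"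
    "transformation_between FreeH FreeL P P' \<alpha>"
    "\<And>\<Gamma>. \<Gamma> \<in> lists (verts H) \<Longrightarrow> iso_arrow FreeL (\<alpha> \<Gamma>)"
    "\<And>\<Gamma>. \<Gamma> \<in> lists (verts H) \<Longrightarrow> T' \<Gamma> \<cdot> FAr FL (\<alpha> \<Gamma>) = T \<Gamma>"
proof -
  obtain P T where A: "A = (P, T)" by (cases A)
  obtain P' T' where B: "B = (P', T')" by (cases B)
  obtain \<alpha> where \<alpha>: "markov_transformation FreeH FreeL P P' \<alpha>"
    "\<And>\<Gamma>. \<Gamma> \<in> Ob FreeH \<Longrightarrow> iso_arrow FreeL (\<alpha> \<Gamma>) \<and> T' \<Gamma> \<cdot> FAr FL (\<alpha> \<Gamma>) = T \<Gamma>"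
    using assms unfolding A B do_abstractions_iso_def isomorphic_abstractions_def by auto
  have m: "(P, T) \<in> do_abstractions C L H" "(P', T') \<in> do_abstractions C L H"
    using assms unfolding A B do_abstractions_iso_def by auto
  show thesis
    by (rule that[OF A B m transformation_iso_props[OF m \<alpha>(1)]]) (use \<alpha>(2) in simp_all)
qed

lemma isoI:
  assumes "(P, T) \<in> do_abstractions C L H" "(P', T') \<in> do_abstractions C L H"
    "markov_transformation FreeH FreeL P P' \<alpha>"
    "\<And>\<Gamma>. \<Gamma> \<in> lists (verts H) \<Longrightarrow> iso_arrow FreeL (\<alpha> \<Gamma>) \<and> T' \<Gamma> \<cdot> FAr FL (\<alpha> \<Gamma>) = T \<Gamma>"
  shows "((P, T), (P', T')) \<in> do_abstractions_iso C L H"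
  using assms unfolding do_abstractions_iso_def isomorphic_abstractions_def by auto

lemma iso_sym: "(A, B) \<in> do_abstractions_iso C L H \<Longrightarrow> (B, A) \<in> do_abstractions_iso C L H"
proof (elim isoE)
  fix P T P' T' \<alpha>
  assume AB: "A = (P, T)" "B = (P', T')" and m: "(P, T) \<in> do_abstractions C L H" "(P', T') \<in> do_abstractions C L H"
    and \<alpha>: "transformation_between FreeH FreeL P P' \<alpha>"
    and iso: "\<And>\<Gamma>. \<Gamma> \<in> lists (verts H) \<Longrightarrow> iso_arrow FreeL (\<alpha> \<Gamma>)"
    and eq: "\<And>\<Gamma>. \<Gamma> \<in> lists (verts H) \<Longrightarrow> T' \<Gamma> \<cdot> FAr FL (\<alpha> \<Gamma>) = T \<Gamma>"
  interpret D: do_abstraction C L H P' T' by (rule do_abstraction[OF m(2)])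
  have c: "T \<Gamma> \<cdot> FAr FL (inv_arrow FreeL (\<alpha> \<Gamma>)) = T' \<Gamma>" if \<Gamma>: "\<Gamma> \<in> lists (verts H)" for \<Gamma>
  proof -
    have "\<Gamma> \<in> Ob FreeH" using \<Gamma> by simp
    note h = transformation_between.axioms(3)[OF \<alpha>, THEN markov_transformation.component_hom, OF this]
    have "inv_arrow FreeL (\<alpha> \<Gamma>) \<in> hom FreeL (Dom FreeL (inv_arrow FreeL (\<alpha> \<Gamma>)))
        (Cod FreeL (inv_arrow FreeL (\<alpha> \<Gamma>)))"
      by (rule free_L.hom_self[OF free_L.inv_simps(1)[OF iso[OF \<Gamma>]]])
    hence hi: "inv_arrow FreeL (\<alpha> \<Gamma>) \<in> hom FreeL (FOb P' \<Gamma>) (FOb P \<Gamma>)"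
      using h free_L.inv_simps(2,3)[OF iso[OF \<Gamma>]] unfolding hom_def by simp
    have "FAr FL (\<alpha> \<Gamma>) \<cdot> FAr FL (inv_arrow FreeL (\<alpha> \<Gamma>)) = FAr FL (\<alpha> \<Gamma> \<bullet> inv_arrow FreeL (\<alpha> \<Gamma>))"
      by (rule FL.ar_cmp[OF hi h, symmetric])
    also have "\<alpha> \<Gamma> \<bullet> inv_arrow FreeL (\<alpha> \<Gamma>) = Idn FreeL (FOb P' \<Gamma>)"
      using h free_L.inv_simps(4)[OF iso[OF \<Gamma>]] unfolding hom_def by simp
    also have "FAr FL (Idn FreeL (FOb P' \<Gamma>)) = Idn C (FOb FL (FOb P' \<Gamma>))"
      by (rule FL.ar_id) (use D.P_FOb[OF \<Gamma>] in simp)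
    finally have id: "FAr FL (\<alpha> \<Gamma>) \<cdot> FAr FL (inv_arrow FreeL (\<alpha> \<Gamma>)) = Idn C (FOb FL (FOb P' \<Gamma>))" .
    have "T \<Gamma> \<cdot> FAr FL (inv_arrow FreeL (\<alpha> \<Gamma>)) = (T' \<Gamma> \<cdot> FAr FL (\<alpha> \<Gamma>)) \<cdot> FAr FL (inv_arrow FreeL (\<alpha> \<Gamma>))"
      by (simp only: eq[OF \<Gamma>])
    also have "\<dots> = T' \<Gamma> \<cdot> (FAr FL (\<alpha> \<Gamma>) \<cdot> FAr FL (inv_arrow FreeL (\<alpha> \<Gamma>)))"
      by (rule L.cmp_assoc[OF FL.ar[OF hi] FL.ar[OF h]]) (use D.T_simps(1)[OF \<Gamma>] in simp)
    also have "\<dots> = T' \<Gamma>" unfolding id by (rule L.cmp_id_right) (use D.T_simps(1)[OF \<Gamma>] in simp)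
    finally show ?thesis .
  qed
  have t: "markov_transformation FreeH FreeL P' P (\<lambda>X. inv_arrow FreeL (\<alpha> X))"
    by (rule transformation_between.inverse_transformation[OF \<alpha>]) (simp add: iso)
  show ?thesis unfolding AB by (rule isoI[OF m(2,1) t]) (rule conjI[OF free_L.iso_inv[OF iso] c])
qed

lemma iso_trans:
  assumes "(A, B) \<in> do_abstractions_iso C L H" "(B, E) \<in> do_abstractions_iso C L H"
  shows "(A, E) \<in> do_abstractions_iso C L H"
proof -
  obtain P T P' T' \<alpha> where AB: "A = (P, T)" "B = (P', T')"
    and m: "(P, T) \<in> do_abstractions C L H" "(P', T') \<in> do_abstractions C L H"
    and \<alpha>: "transformation_between FreeH FreeL P P' \<alpha>"
    and iso: "\<And>\<Gamma>. \<Gamma> \<in> lists (verts H) \<Longrightarrow> iso_arrow FreeL (\<alpha> \<Gamma>)"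
    and eq: "\<And>\<Gamma>. \<Gamma> \<in> lists (verts H) \<Longrightarrow> T' \<Gamma> \<cdot> FAr FL (\<alpha> \<Gamma>) = T \<Gamma>"
    by (rule isoE[OF assms(1)]) blast
  obtain P1 T1 P'' T'' \<beta> where B1: "B = (P1, T1)" and E: "E = (P'', T'')"
    and m1: "(P1, T1) \<in> do_abstractions C L H" and m2: "(P'', T'') \<in> do_abstractions C L H"
    and \<beta>1: "transformation_between FreeH FreeL P1 P'' \<beta>"
    and iso': "\<And>\<Gamma>. \<Gamma> \<in> lists (verts H) \<Longrightarrow> iso_arrow FreeL (\<beta> \<Gamma>)"
    and eq1: "\<And>\<Gamma>. \<Gamma> \<in> lists (verts H) \<Longrightarrow> T'' \<Gamma> \<cdot> FAr FL (\<beta> \<Gamma>) = T1 \<Gamma>"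
    by (rule isoE[OF assms(2)]) blast
  have P1: "P1 = P'" "T1 = T'" using AB B1 by auto
  note \<beta> = \<beta>1[unfolded P1] and eq' = eq1[unfolded P1]
  interpret D: do_abstraction C L H P'' T'' by (rule do_abstraction[OF m2])
  have c: "iso_arrow FreeL (\<beta> \<Gamma> \<bullet> \<alpha> \<Gamma>) \<and> T'' \<Gamma> \<cdot> FAr FL (\<beta> \<Gamma> \<bullet> \<alpha> \<Gamma>) = T \<Gamma>"
    if \<Gamma>: "\<Gamma> \<in> lists (verts H)" for \<Gamma>
  proof
    have O\<Gamma>: "\<Gamma> \<in> Ob FreeH" using \<Gamma> by simp
    note h = transformation_between.axioms(3)[OF \<alpha>, THEN markov_transformation.component_hom, OF O\<Gamma>]
    note h' = transformation_between.axioms(3)[OF \<beta>, THEN markov_transformation.component_hom, OF O\<Gamma>]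
    show "iso_arrow FreeL (\<beta> \<Gamma> \<bullet> \<alpha> \<Gamma>)"
      by (rule free_L.iso_cmp[OF iso[OF \<Gamma>] iso'[OF \<Gamma>]]) (use h h' in \<open>simp add: hom_def\<close>)
    have "T'' \<Gamma> \<cdot> FAr FL (\<beta> \<Gamma> \<bullet> \<alpha> \<Gamma>) = T'' \<Gamma> \<cdot> (FAr FL (\<beta> \<Gamma>) \<cdot> FAr FL (\<alpha> \<Gamma>))"
      unfolding FL.ar_cmp[OF h h'] ..
    also have "\<dots> = (T'' \<Gamma> \<cdot> FAr FL (\<beta> \<Gamma>)) \<cdot> FAr FL (\<alpha> \<Gamma>)"
      by (rule L.cmp_assoc[OF FL.ar[OF h] FL.ar[OF h'], symmetric]) (use D.T_simps(1)[OF \<Gamma>] in simp)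
    also have "\<dots> = T \<Gamma>" unfolding eq'[OF \<Gamma>] eq[OF \<Gamma>] ..
    finally show "T'' \<Gamma> \<cdot> FAr FL (\<beta> \<Gamma> \<bullet> \<alpha> \<Gamma>) = T \<Gamma>" .
  qed
  show ?thesis unfolding AB E
    by (rule isoI[OF m(1) m2 transformation_between.comp_transformation[OF \<alpha> \<beta>]]) (rule c)
qed

lemma equiv_iso: "equiv (do_abstractions C L H) (do_abstractions_iso C L H)"
proof (rule equivI)
  show "do_abstractions_iso C L H \<subseteq> do_abstractions C L H \<times> do_abstractions C L H"
    by (auto simp: do_abstractions_iso_def)
  show "refl_on (do_abstractions C L H) (do_abstractions_iso C L H)"
    unfolding refl_on_def using iso_refl by blast
  show "sym_on UNIV (do_abstractions_iso C L H)" unfolding sym_on_def using iso_sym by blast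
  show "trans_on UNIV (do_abstractions_iso C L H)" unfolding trans_on_def using iso_trans by blast
qed

text \<open>The component at \<open>[X]\<close> is a deterministic isomorphism out of a distinct
  list. So \<open>FL\<close> sends it to a wire selection, which merges with the permutation built
  into the restriction.\<close>

lemma restrict_iso:
  assumes "(A, B) \<in> do_abstractions_iso C L H"
  shows "restrict_to_variables C L H A = restrict_to_variables C L H B"
proof -
  obtain P T P' T' \<alpha> where AB: "A = (P, T)" "B = (P', T')"
    and m: "(P, T) \<in> do_abstractions C L H" "(P', T') \<in> do_abstractions C L H"
    and \<alpha>: "transformation_between FreeH FreeL P P' \<alpha>"
    and iso: "\<And>\<Gamma>. \<Gamma> \<in> lists (verts H) \<Longrightarrow> iso_arrow FreeL (\<alpha> \<Gamma>)"
    and eq: "\<And>\<Gamma>. \<Gamma> \<in> lists (verts H) \<Longrightarrow> T' \<Gamma> \<cdot> FAr FL (\<alpha> \<Gamma>) = T \<Gamma>"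
    by (rule isoE[OF assms]) blast
  interpret D: do_abstraction C L H P T by (rule do_abstraction[OF m(1)])
  interpret D': do_abstraction C L H P' T' by (rule do_abstraction[OF m(2)])
  have c: "set (FOb P [X]) = set (FOb P' [X])"
      "T [X] \<cdot> L.sel (listing L (set (FOb P [X]))) (FOb P [X])
      = T' [X] \<cdot> L.sel (listing L (set (FOb P' [X]))) (FOb P' [X])"
    if X: "X \<in> verts H" for X
  proof -
    have l: "[X] \<in> lists (verts H)" and Ob: "[X] \<in> Ob FreeH" using X by auto
    note tr = transformation_between.axioms(3)[OF \<alpha>]
    note h = markov_transformation.component_hom[OF tr Ob] and dt = markov_transformation.component_det[OF tr Ob]
    have s: "set (FOb P [X]) = set (FOb P' [X])"
      by (rule mset_eq_setD[OF free_iso_mset[OF h iso[OF l]]])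
    let ?l = "listing L (set (FOb P [X]))"
    have v: "set (FOb P [X]) \<subseteq> verts L" using D.P_FOb[OF l] by auto
    have sl: "set (FOb P' [X]) \<subseteq> set (FOb P [X])" "set (FOb P [X]) \<subseteq> set ?l" using s v by auto
    have ob: "vob L ` set ?l \<subseteq> Ob C" "vob L ` set (FOb P [X]) \<subseteq> Ob C" using L.vob_ob v by auto
    have w: "FAr FL (\<alpha> [X]) = L.sel (FOb P [X]) (FOb P' [X])"
      by (rule L.do_model_det_iso[OF h iso[OF l] dt D.distinct_P_single[OF X]])
    have hw: "L.sel ?l (FOb P [X]) \<in> hom C (L.wires ?l) (FOb FL (FOb P [X]))"
      using L.wire_select_simps[OF sl(2) ob(1)] by (simp add: hom_def)
    have "T [X] \<cdot> L.sel ?l (FOb P [X]) = (T' [X] \<cdot> FAr FL (\<alpha> [X])) \<cdot> L.sel ?l (FOb P [X])"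
      by (simp only: eq[OF l])
    also have "\<dots> = T' [X] \<cdot> (FAr FL (\<alpha> [X]) \<cdot> L.sel ?l (FOb P [X]))"
      by (rule L.cmp_assoc[OF hw FL.ar[OF h]]) (use D'.T_simps(1)[OF l] in simp)
    also have "\<dots> = T' [X] \<cdot> L.sel ?l (FOb P' [X])"
      unfolding w L.select_select[OF sl ob(1)] ..
    finally show "T [X] \<cdot> L.sel (listing L (set (FOb P [X]))) (FOb P [X])
      = T' [X] \<cdot> L.sel (listing L (set (FOb P' [X]))) (FOb P' [X])" unfolding s .
    show "set (FOb P [X]) = set (FOb P' [X])" by (rule s)
  qed
  show ?thesis unfolding AB restrict_to_variables_def prod.case
    by (intro arg_cong2[where f = Pair] restrict_ext c)
qed

text \<open>Both abstractions are isomorphic to the canonical abstraction of their common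
  restriction.\<close>

lemma restrict_inj:
  assumes A: "A \<in> do_abstractions C L H" and B: "B \<in> do_abstractions C L H"
    and eq: "restrict_to_variables C L H A = restrict_to_variables C L H B"
  shows "(A, B) \<in> do_abstractions_iso C L H"
proof -
  \<comment> \<open>\<open>r\<close> is a variable of its own so that \<open>A\<close> and
    \<open>B\<close> can be compared with literally the same canonical abstraction.\<close>
  have canon: "((canon_functor (fst r), tensor_alignment C L H (fst r) (snd r)), E) \<in> do_abstractions_iso C L H"
    if E: "E \<in> do_abstractions C L H" and r: "r = restrict_to_variables C L H E" for E r
  proof -
    obtain P T where PT: "E = (P, T)" by (cases E)
    interpret do_abstraction C L H P T by (rule do_abstraction) (use E PT in simp)
    show ?thesis
      using isomorphic_canon canon_abstraction[OF restrict_constructive] E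
      unfolding do_abstractions_iso_def r PT by simp
  qed
  show ?thesis
    using iso_trans[OF iso_sym[OF canon[OF A HOL.refl]] canon[OF B eq]] .
qed

lemma restrict_surj:
  "restrict_to_variables C L H ` do_abstractions C L H = constructive_abstractions C L H"
proof
  show "restrict_to_variables C L H ` do_abstractions C L H \<subseteq> constructive_abstractions C L H"
    using restrict_mem by blast
  show "constructive_abstractions C L H \<subseteq> restrict_to_variables C L H ` do_abstractions C L H"
  proof
    fix x assume x: "x \<in> constructive_abstractions C L H"
    obtain pi tau where pt: "x = (pi, tau)" by (cases x)
    have "constructive_abstraction C L H pi tau" "pi \<in> extensional (verts H)" "tau \<in> extensional (verts H)"
      using x unfolding pt constructive_abstractions_def by auto
    from canon_abstraction[OF this(1)] restrict_canon[OF this]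
    show "x \<in> restrict_to_variables C L H ` do_abstractions C L H" unfolding pt by (metis image_eqI)
  qed
qed

end

text \<open>The third assumption is the converse of \<open>respects\<close>: equal values occur only
  within one class, whence injectivity on the quotient.\<close>

lemma bij_betw_univ:
  assumes "equiv A r" "f respects r" "\<And>x y. x \<in> A \<Longrightarrow> y \<in> A \<Longrightarrow> f x = f y \<Longrightarrow> (x, y) \<in> r"
  shows "bij_betw (univ f) (A // r) (f ` A)"
proof -
  have univ: "univ f (r `` {x}) = f x" if "x \<in> A" for x
    using univ_commute[OF assms(1,2) that] by (simp add: proj_def)
  show ?thesis
    unfolding bij_betw_def
  proof
    show "inj_on (univ f) (A // r)"
    proof (rule inj_onI)
      fix X Y assume X: "X \<in> A // r" and Y: "Y \<in> A // r" and eq: "univ f X = univ f Y"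
      obtain x where x: "x \<in> A" "X = r `` {x}" using X by (rule quotientE)
      obtain y where y: "y \<in> A" "Y = r `` {y}" using Y by (rule quotientE)
      have "(x, y) \<in> r" using assms(3) x y eq univ by simp
      thus "X = Y" using x y equiv_class_eq[OF assms(1)] by simp
    qed
    show "univ f ` (A // r) = f ` A"
      using univ by (auto simp: quotient_def image_iff)
  qed
qed

theorem theorem25:
  fixes C :: "('o, 'a) markov_data"
    and L :: "('l, 'o, 'a) causal_model"
    and H :: "('h, 'o, 'a) causal_model"
  assumes "markov_category C"
    and "is_causal_model C L"
    and "is_causal_model C H"
    and "nin H \<subseteq> outs H"
  shows "equiv (do_abstractions C L H) (do_abstractions_iso C L H)
    \<and> restrict_to_variables C L H respects do_abstractions_iso C L H
    \<and> bij_betw (univ (restrict_to_variables C L H))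
        (do_abstractions C L H // do_abstractions_iso C L H)
        (constructive_abstractions C L H)"
proof -
  interpret causal_pair C L H
    using assms by (intro causal_pair.intro causal_model_in.intro)
  have resp: "restrict_to_variables C L H respects do_abstractions_iso C L H"
    by (rule congruentI) (rule restrict_iso)
  show ?thesis
    by (intro conjI equiv_iso resp bij_betw_univ[OF equiv_iso resp restrict_inj, unfolded restrict_surj])
qed

end
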